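(* Let $d\ge1$ and $p\ge1$ be integers and let $\mathbf a=(a_1,\dots,a_d)\in\mathbb R^d$ with $a_j\ne0$ for each $j$. Then there exist a constant $C_{d,p,\mathbf a}>0$ and an integer $r_0=r_0(d,p,\mathbf a)$ such that, for all integers $r\ge r_0$, all $k>0$ and all $f\in\mathcal W^{p+3,d}$, $$\bigl|\mathcal I^{k,d,\mathbf a}f-\mathcal I^{k,d,\mathbf a,r}f\bigr|\ \le\ C_{d,p,\mathbf a}\,k^{-(d+1)}\bigl(\log^{d-1}N(r,d)\bigr)^{p}\Bigl(\frac1{N(r,d)}\Bigr)^{p-1}\|f\|_{\mathcal W^{p+3,d}},$$ where $N(r,d)$ is the number of point evaluations of $f$ used in the quadrature rule $\mathcal I^{k,d,\mathbf a,r}f$.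
   Context: **Integral.** For $k>0$, $\mathbf a\in\mathbb R^d$: $\mathcal I^{k,d,\mathbf a}f:=\int_{[-1,1]^d}f(\boldsymbol y)\exp(\mathrm i k\,\mathbf a\cdot\boldsymbol y)\,d\boldsymbol y$. **Function space.** For a positive integer $q$, $\mathcal W^{q,d}$ is the space of functions $f:[-1,1]^d\to\mathbb R$ such that $\partial^{|\mathbf s|}f/\partial\boldsymbol y^{\mathbf s}\in C([-1,1]^d)$ for all $\mathbf s\in\mathbb N_0^d$ with $|\mathbf s|_\infty=\max_i s_i\le q$, with norm $\|f\|_{\mathcal W^{q,d}}=\max_{|\mathbf s|_\infty\le q}\|\partial^{|\mathbf s|}f/\partial\boldsymbol y^{\mathbf s}\|_{\infty,[-1,1]^d}$. **Splitting of $\mathbf a$.** For $a\in\mathbb R$, $k>0$: $\tilde a=a$ if $k|a|\ge1$, $\tilde a=0$ otherwise, and $\hat a=a-\tilde a$. Applied componentwise this gives $\tilde{\mathbf a},\hat{\mathbf a}$. Set $\hat f(\boldsymbol y)=f(\boldsymbol y)\exp(\mathrm i k\,\hat{\mathbf a}\cdot\boldsymbol y)$. **1D grids and interpolation.** $n_\ell=2^{\ell-1}$ for $\ell\ge1$. The level-$1$ grid is $X^1=\{0\}$; for $\ell\ge2$ the level-$\ell$ grid is $X^\ell=\{\cos(j\pi/n_\ell):j=0,\dots,n_\ell\}$. $Q^1g$ is the constant $g(0)$; for $\ell\ge2$, $Q^\ell g$ is the polynomial of degree at most $n_\ell$ interpolating $g$ on $X^\ell$; $Q^0g=0$; $D^\ell=Q^\ell-Q^{\ell-1}$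 for $\ell\ge1$. **Smolyak interpolant.** For $r\in\mathbb N=\{1,2,\dots\}$, with $|\boldsymbol\ell|=\ell_1+\dots+\ell_d$, $$\mathcal Q^{r,d}g=\sum_{\boldsymbol\ell\in\mathbb N^d,\ |\boldsymbol\ell|\le r+d-1}(D^{\ell_1}\otimes\cdots\otimes D^{\ell_d})g,$$ where $D^{\ell_j}$ acts in the variable $y_j$. **FCCS rule.** $\mathcal I^{k,d,\mathbf a,r}f:=\int_{[-1,1]^d}(\mathcal Q^{r,d}\hat f)(\boldsymbol y)\exp(\mathrm i k\,\tilde{\mathbf a}\cdot\boldsymbol y)\,d\boldsymbol y$. It uses the values of $f$ at the points of the sparse grid $\bigcup_{\boldsymbol\ell\in\mathbb N^d,\,|\boldsymbol\ell|\le r+d-1}X^{\ell_1}\times\cdots\times X^{\ell_d}$, and $N(r,d)$ is the cardinality of this set. **Conventions.** $\log^{d-1}N=(\log N)^{d-1}$ (equal to $1$ if $d=1$). *)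

theory Defs
  imports "HOL-Analysis.Analysis" "HOL-Computational_Algebra.Polynomial"
begin

text \<open>
  The dimension \<open>d\<close> is \<open>CARD('d)\<close>: points of \<open>\<real>\<^sup>d\<close> are vectors of type \<^typ>\<open>real ^ 'd\<close>, and the
  coordinates are indexed by the elements of \<^typ>\<open>'d\<close>, so no order of the coordinates is available.
  Functions on \<open>[-1,1]\<^sup>d\<close> are represented by total functions on \<^typ>\<open>real ^ 'd\<close>; only their values
  on the cube matter in what follows.
\<close>

definition cube :: "(real ^ 'd) set" where
  "cube = {y. \<forall>i. -1 \<le> y $ i \<and> y $ i \<le> 1}"

definition upd :: "real ^ 'd \<Rightarrow> 'd \<Rightarrow> real \<Rightarrow> real ^ 'd" where
  "upd y j t = (\<chi> i. if i = j then t else y $ i)"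


subsection \<open>Functions with bounded mixed derivatives\<close>

text \<open>Derivatives are taken within \<open>[-1,1]\<close>, hence are one-sided on the faces of the cube.\<close>

definition pdifferentiable :: "'d \<Rightarrow> (real ^ 'd \<Rightarrow> real) \<Rightarrow> bool" where
  "pdifferentiable j g \<longleftrightarrow>
     (\<forall>y\<in>cube. (\<lambda>t. g (upd y j t)) differentiable (at (y $ j) within {-1..1}))"

definition pdiff :: "'d \<Rightarrow> (real ^ 'd \<Rightarrow> real) \<Rightarrow> real ^ 'd \<Rightarrow> real" where
  "pdiff j g y = vector_derivative (\<lambda>t. g (upd y j t)) (at (y $ j) within {-1..1})"

text \<open>
  A list \<open>js\<close> of coordinates stands for the mixed derivative with multi-index
  \<open>s\<^sub>i = count_list js i\<close>, taken in the order given by the list (last entry first). In the space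
  below all orders of differentiation occur, and by Schwarz's theorem they give the same function.
\<close>

definition mixed_deriv :: "'d list \<Rightarrow> (real ^ 'd \<Rightarrow> real) \<Rightarrow> real ^ 'd \<Rightarrow> real" where
  "mixed_deriv js f = foldr pdiff js f"

definition mixed_orders :: "nat \<Rightarrow> 'd list set" where
  "mixed_orders q = {js. \<forall>i. count_list js i \<le> q}"

definition W_space :: "nat \<Rightarrow> (real ^ 'd \<Rightarrow> real) set" where
  "W_space q = {f. \<forall>js \<in> mixed_orders q.
      continuous_on cube (mixed_deriv js f) \<and>
      (\<forall>i. i # js \<in> mixed_orders q \<longrightarrow> pdifferentiable i (mixed_deriv js f))}"

definition W_norm :: "nat \<Rightarrow> (real ^ 'd \<Rightarrow> real) \<Rightarrow> real" where
  "W_norm q f = (MAX js \<in> mixed_orders q. SUP y \<in> cube. \<bar>mixed_deriv js f y\<bar>)"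

lemma finite_mixed_orders: "finite (mixed_orders q :: ('d :: finite) list set)"
proof (rule finite_subset)
  show "mixed_orders q \<subseteq> {js :: 'd list. set js \<subseteq> UNIV \<and> length js \<le> CARD('d) * q}"
  proof
    fix js :: "'d list"
    assume js: "js \<in> mixed_orders q"
    have "length js = (\<Sum>i\<in>UNIV. count_list js i)"
      by (rule sum_count_set[symmetric]) auto
    also have "\<dots> \<le> (\<Sum>i\<in>(UNIV :: 'd set). q)"
      using js by (intro sum_mono) (simp add: mixed_orders_def)
    finally show "js \<in> {js :: 'd list. set js \<subseteq> UNIV \<and> length js \<le> CARD('d) * q}"
      by simp
  qed
qed (rule finite_lists_length_le, simp)

lemma Nil_in_mixed_orders: "[] \<in> mixed_orders q"
  by (simp add: mixed_orders_def)


subsection \<open>The oscillatory integral and the splitting of its phase\<close>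

definition osc_integral :: "real \<Rightarrow> real ^ 'd \<Rightarrow> (real ^ 'd \<Rightarrow> real) \<Rightarrow> complex" where
  "osc_integral k a f =
     integral cube (\<lambda>y. complex_of_real (f y) * exp (\<i> * complex_of_real (k * (a \<bullet> y))))"

definition a_tilde :: "real \<Rightarrow> real ^ 'd \<Rightarrow> real ^ 'd" where
  "a_tilde k a = (\<chi> j. if k * \<bar>a $ j\<bar> \<ge> 1 then a $ j else 0)"

definition a_hat :: "real \<Rightarrow> real ^ 'd \<Rightarrow> real ^ 'd" where
  "a_hat k a = a - a_tilde k a"

definition f_hat :: "real \<Rightarrow> real ^ 'd \<Rightarrow> (real ^ 'd \<Rightarrow> real) \<Rightarrow> real ^ 'd \<Rightarrow> complex" where
  "f_hat k a f y = complex_of_real (f y) * exp (\<i> * complex_of_real (k * (a_hat k a \<bullet> y)))"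


subsection \<open>One-dimensional interpolation\<close>

text \<open>Levels are at least 1; the values of \<open>n_pts\<close> and \<open>grid\<close> at level 0 are never used.\<close>

definition n_pts :: "nat \<Rightarrow> nat" where
  "n_pts l = 2 ^ (l - 1)"

definition grid :: "nat \<Rightarrow> real set" where
  "grid l = (if l \<le> 1 then {0} else {cos (real j * pi / real (n_pts l)) | j. j \<le> n_pts l})"

definition interp_poly :: "nat \<Rightarrow> (real \<Rightarrow> complex) \<Rightarrow> complex poly" where
  "interp_poly l g =
     (THE p. degree p \<le> n_pts l \<and> (\<forall>x \<in> grid l. poly p (complex_of_real x) = g x))"

definition Q_op :: "nat \<Rightarrow> (real \<Rightarrow> complex) \<Rightarrow> real \<Rightarrow> complex" where
  "Q_op l g x = (if l = 0 then 0 else if l = 1 then g 0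
                 else poly (interp_poly l g) (complex_of_real x))"

definition D_op :: "nat \<Rightarrow> (real \<Rightarrow> complex) \<Rightarrow> real \<Rightarrow> complex" where
  "D_op l g x = Q_op l g x - Q_op (l - 1) g x"


subsection \<open>The Smolyak interpolant and the quadrature rule\<close>

definition in_var :: "'d \<Rightarrow> ((real \<Rightarrow> complex) \<Rightarrow> real \<Rightarrow> complex)
    \<Rightarrow> (real ^ 'd \<Rightarrow> complex) \<Rightarrow> real ^ 'd \<Rightarrow> complex" where
  "in_var j T g y = T (\<lambda>t. g (upd y j t)) (y $ j)"

text \<open>
  The tensor product is the composition over all coordinates \<open>j\<close> of \<open>D_op (l j)\<close> acting in the
  \<open>j\<close>-th variable. These operators commute (lemma \<open>comp_fun_commute_D_op\<close> below), so that
  \<^const>\<open>Finite_Set.fold\<close> is meaningful and the order of composition is irrelevant.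
\<close>

definition tensor_D :: "('d \<Rightarrow> nat) \<Rightarrow> (real ^ 'd \<Rightarrow> complex) \<Rightarrow> real ^ 'd \<Rightarrow> complex" where
  "tensor_D l g = Finite_Set.fold (\<lambda>j. in_var j (D_op (l j))) g UNIV"

definition levels :: "nat \<Rightarrow> ('d :: finite \<Rightarrow> nat) set" where
  "levels r = {l. (\<forall>j. 1 \<le> l j) \<and> (\<Sum>j\<in>UNIV. l j) \<le> r + CARD('d) - 1}"

definition smolyak :: "nat \<Rightarrow> (real ^ 'd \<Rightarrow> complex) \<Rightarrow> real ^ 'd \<Rightarrow> complex" where
  "smolyak r g y = (\<Sum>l \<in> levels r. tensor_D l g y)"

definition fccs :: "real \<Rightarrow> real ^ 'd \<Rightarrow> nat \<Rightarrow> (real ^ 'd \<Rightarrow> real) \<Rightarrow> complex" where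
  "fccs k a r f =
     integral cube
       (\<lambda>y. smolyak r (f_hat k a f) y * exp (\<i> * complex_of_real (k * (a_tilde k a \<bullet> y))))"

definition sparse_grid :: "nat \<Rightarrow> (real ^ 'd) set" where
  "sparse_grid r = (\<Union>l \<in> levels r. {y. \<forall>j. y $ j \<in> grid (l j)})"

definition num_pts :: "'d :: finite itself \<Rightarrow> nat \<Rightarrow> nat" where
  "num_pts _ r = card (sparse_grid r :: (real ^ 'd) set)"

lemma finite_levels: "finite (levels r :: ('d :: finite \<Rightarrow> nat) set)"
proof (rule finite_subset)
  show "levels r \<subseteq> (UNIV :: 'd set) \<rightarrow>\<^sub>E {..r + CARD('d) - 1}"
  proof
    fix l :: "'d \<Rightarrow> nat"
    assume l: "l \<in> levels r"
    have "l j \<le> (\<Sum>j\<in>UNIV. l j)" for j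
      by (rule member_le_sum) auto
    with l show "l \<in> UNIV \<rightarrow>\<^sub>E {..r + CARD('d) - 1}"
      by (auto simp: levels_def intro: order_trans)
  qed
qed (intro finite_PiE; simp)

lemma finite_grid: "finite (grid l)"
  by (simp add: grid_def)

lemma finite_sparse_grid: "finite (sparse_grid r :: (real ^ 'd) set)"
proof -
  have "finite {y :: real ^ 'd. \<forall>j. y $ j \<in> grid (l j)}" for l
  proof -
    have "{y :: real ^ 'd. \<forall>j. y $ j \<in> grid (l j)} \<subseteq> (\<lambda>h. \<chi> j. h j) ` (UNIV \<rightarrow>\<^sub>E (\<Union>j. grid (l j)))"
    proof
      fix y :: "real ^ 'd"
      assume "y \<in> {y. \<forall>j. y $ j \<in> grid (l j)}"
      then show "y \<in> (\<lambda>h. \<chi> j. h j) ` (UNIV \<rightarrow>\<^sub>E (\<Union>j. grid (l j)))"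
        by (intro image_eqI[of _ _ "\<lambda>j. y $ j"]) auto
    qed
    then show ?thesis
      by (rule finite_subset) (intro finite_imageI finite_PiE; simp add: finite_grid)
  qed
  then show ?thesis
    by (simp add: sparse_grid_def finite_levels)
qed


subsection \<open>Well-definedness of the interpolation operators\<close>

lemma card_grid:
  assumes "2 \<le> l"
  shows "card (grid l) = n_pts l + 1"
proof -
  have "grid l = (\<lambda>j. cos (real j * pi / real (n_pts l))) ` {..n_pts l}"
    using assms by (auto simp: grid_def)
  moreover have "inj_on (\<lambda>j. cos (real j * pi / real (n_pts l))) {..n_pts l}"
  proof (rule inj_onI)
    fix i j
    assume ij: "i \<in> {..n_pts l}" "j \<in> {..n_pts l}"
      and eq: "cos (real i * pi / real (n_pts l)) = cos (real j * pi / real (n_pts l))"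
    have n: "0 < real (n_pts l)"
      by (simp add: n_pts_def)
    have "0 \<le> real i * pi / real (n_pts l)" "real i * pi / real (n_pts l) \<le> pi"
      "0 \<le> real j * pi / real (n_pts l)" "real j * pi / real (n_pts l) \<le> pi"
      using ij n by (auto simp: divide_le_eq mult.commute)
    then have "real i * pi / real (n_pts l) = real j * pi / real (n_pts l)"
      using eq by (rule cos_inj_pi)
    then show "i = j"
      using n by simp
  qed
  ultimately show ?thesis
    by (simp add: card_image)
qed

definition lagrange :: "nat \<Rightarrow> real \<Rightarrow> complex poly" where
  "lagrange l z = (\<Prod>w \<in> grid l - {z}.
     smult (1 / complex_of_real (z - w)) [:- complex_of_real w, 1:])"

lemma interp_poly_lagrange:
  assumes "2 \<le> l"
  shows "interp_poly l g = (\<Sum>z \<in> grid l. smult (g z) (lagrange l z))" (is "_ = ?p")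
  unfolding interp_poly_def
proof (rule the_equality)
  have deg: "degree (lagrange l z) \<le> n_pts l" if z: "z \<in> grid l" for z
  proof -
    have "degree (lagrange l z) \<le> (\<Sum>w \<in> grid l - {z}.
        degree (smult (1 / complex_of_real (z - w)) [:- complex_of_real w, 1:]))"
      unfolding lagrange_def
      by (rule order_trans[OF degree_prod_sum_le]) (simp_all add: finite_grid o_def)
    also have "\<dots> \<le> (\<Sum>w \<in> grid l - {z}. 1)"
      by (intro sum_mono) (simp add: degree_smult_eq)
    also have "\<dots> = n_pts l"
      using card_grid[OF assms] z finite_grid[of l] by (simp add: card_Diff_singleton)
    finally show ?thesis .
  qed
  have val: "poly (lagrange l z) (complex_of_real x) = (if x = z then 1 else 0)"
    if "z \<in> grid l" "x \<in> grid l" for z x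
  proof -
    have "poly (lagrange l z) (complex_of_real x) =
        (\<Prod>w \<in> grid l - {z}. complex_of_real ((x - w) / (z - w)))"
      unfolding lagrange_def poly_prod by (intro prod.cong) (simp_all add: diff_divide_distrib)
    also have "\<dots> = (if x = z then 1 else 0)"
    proof (cases "x = z")
      case False
      with that have "x \<in> grid l - {z}"
        by simp
      with False finite_grid[of l] show ?thesis
        by (auto simp: prod_zero_iff intro!: bexI[of _ x])
    qed simp
    finally show ?thesis .
  qed
  show p: "degree ?p \<le> n_pts l \<and> (\<forall>x \<in> grid l. poly ?p (complex_of_real x) = g x)"
  proof (intro conjI ballI)
    show "degree ?p \<le> n_pts l"
      by (intro degree_sum_le finite_grid) (meson deg degree_smult_le order_trans)
  next
    fix x
    assume x: "x \<in> grid l"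
    have "poly ?p (complex_of_real x) = (\<Sum>z \<in> grid l. if x = z then g z else 0)"
      unfolding poly_sum by (intro sum.cong) (auto simp: val x)
    also have "\<dots> = g x"
      using x finite_grid by (simp add: sum.delta')
    finally show "poly ?p (complex_of_real x) = g x" .
  qed
  fix p
  assume q: "degree p \<le> n_pts l \<and> (\<forall>x \<in> grid l. poly p (complex_of_real x) = g x)"
  show "p = ?p"
  proof (rule poly_eqI_degree[of "complex_of_real ` grid l"])
    have "card (complex_of_real ` grid l) = n_pts l + 1"
      using card_grid[OF assms] by (simp add: card_image inj_on_def)
    then show "degree p < card (complex_of_real ` grid l)"
      "degree ?p < card (complex_of_real ` grid l)"
      using p q by auto
    show "poly p x = poly ?p x" if "x \<in> complex_of_real ` grid l" for x
      using that p q by (metis (no_types, lifting) imageE)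
  qed
qed

definition finite_rule :: "((real \<Rightarrow> complex) \<Rightarrow> real \<Rightarrow> complex) \<Rightarrow> bool" where
  "finite_rule T \<longleftrightarrow> (\<exists>S w. finite S \<and> (\<forall>g x. T g x = (\<Sum>z \<in> S. w z x * g z)))"

lemma finite_rule_Q_op: "finite_rule (Q_op l)"
proof -
  consider "l = 0" | "l = 1" | "2 \<le> l"
    by linarith
  then show ?thesis
  proof cases
    case 1
    then have "Q_op l g x = (\<Sum>z \<in> {}. 0 * g z)" for g x
      by (simp add: Q_op_def)
    then show ?thesis
      unfolding finite_rule_def by (intro exI[of _ "{}"] exI[of _ "\<lambda>_ _. 0"]) simp
  next
    case 2
    then have "Q_op l g x = (\<Sum>z \<in> {0}. 1 * g z)" for g x
      by (simp add: Q_op_def)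
    then show ?thesis
      unfolding finite_rule_def by (intro exI[of _ "{0}"] exI[of _ "\<lambda>_ _. 1"]) simp
  next
    case 3
    then have "Q_op l g x = (\<Sum>z \<in> grid l. poly (lagrange l z) (complex_of_real x) * g z)" for g x
      by (simp add: Q_op_def interp_poly_lagrange poly_sum mult.commute)
    then show ?thesis
      unfolding finite_rule_def
      by (intro exI[of _ "grid l"] exI[of _ "\<lambda>z x. poly (lagrange l z) (complex_of_real x)"])
        (simp add: finite_grid)
  qed
qed

lemma finite_rule_D_op: "finite_rule (D_op l)"
proof -
  obtain S w where S: "finite S" "\<And>g x. Q_op l g x = (\<Sum>z \<in> S. w z x * g z)"
    using finite_rule_Q_op[of l] unfolding finite_rule_def by blast
  obtain S' w' where S': "finite S'" "\<And>g x. Q_op (l - 1) g x = (\<Sum>z \<in> S'. w' z x * g z)"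
    using finite_rule_Q_op[of "l - 1"] unfolding finite_rule_def by blast
  define v where "v z x = (if z \<in> S then w z x else 0) - (if z \<in> S' then w' z x else 0)" for z x
  have "D_op l g x = (\<Sum>z \<in> S \<union> S'. v z x * g z)" for g x
  proof -
    have "(\<Sum>z \<in> S. w z x * g z) = (\<Sum>z \<in> S \<union> S'. (if z \<in> S then w z x else 0) * g z)"
      using S(1) S'(1) by (intro sum.mono_neutral_cong_left) auto
    moreover have "(\<Sum>z \<in> S'. w' z x * g z) = (\<Sum>z \<in> S \<union> S'. (if z \<in> S' then w' z x else 0) * g z)"
      using S(1) S'(1) by (intro sum.mono_neutral_cong_left) auto
    ultimately show ?thesis
      by (simp only: D_op_def S(2) S'(2) v_def left_diff_distrib sum_subtractf)
  qed
  then show ?thesis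
    unfolding finite_rule_def using S(1) S'(1) by (intro exI[of _ "S \<union> S'"] exI[of _ v]) simp
qed

lemma comp_fun_commute_D_op: "comp_fun_commute (\<lambda>j :: 'd :: finite. in_var j (D_op (l j)))"
proof
  fix i j :: 'd
  show "in_var i (D_op (l i)) \<circ> in_var j (D_op (l j)) =
      in_var j (D_op (l j)) \<circ> in_var i (D_op (l i))"
  proof (cases "i = j")
    case False
    obtain S w where S: "\<And>g x. D_op (l i) g x = (\<Sum>z \<in> S. w z x * g z)"
      using finite_rule_D_op[of "l i"] unfolding finite_rule_def by blast
    obtain S' w' where S': "\<And>g x. D_op (l j) g x = (\<Sum>z \<in> S'. w' z x * g z)"
      using finite_rule_D_op[of "l j"] unfolding finite_rule_def by blast
    have u: "upd (upd y i s) j t = upd (upd y j t) i s" "upd y i s $ j = y $ j"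
      "upd y j t $ i = y $ i" for y s t
      using False by (auto simp: upd_def vec_eq_iff)
    show ?thesis
    proof (intro ext)
      fix g y
      have "(\<Sum>z \<in> S. w z (y $ i) * (\<Sum>z' \<in> S'. w' z' (y $ j) * g (upd (upd y i z) j z'))) =
        (\<Sum>z \<in> S. \<Sum>z' \<in> S'. w' z' (y $ j) * (w z (y $ i) * g (upd (upd y j z') i z)))"
        by (simp add: sum_distrib_left u(1) mult.left_commute)
      also have "\<dots> = (\<Sum>z' \<in> S'. w' z' (y $ j) * (\<Sum>z \<in> S. w z (y $ i) * g (upd (upd y j z') i z)))"
        by (subst sum.swap) (simp add: sum_distrib_left)
      finally show "(in_var i (D_op (l i)) \<circ> in_var j (D_op (l j))) g y =
          (in_var j (D_op (l j)) \<circ> in_var i (D_op (l i))) g y"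
        by (simp add: in_var_def S S' u(2,3))
    qed
  qed simp
qed

end

theory Submission
  imports Defs
begin

text \<open>
  Replacing \<open>f\<close> by its telescoping sum over all level vectors, the error of the rule is the sum over
  the omitted vectors \<open>l\<close> of tensor products of the one-dimensional functionals
  \<open>g \<mapsto> \<integral> (D\<^sup>l g)(x) exp (i \<omega> x) dx\<close>. Each of them is a finite combination of point values, so
  it commutes with derivatives in the other variables, and a bound by the \<open>C\<^sup>q\<close> norm in each variable
  gives the product of the bounds times the \<open>W\<close> norm of \<open>f\<close>.

  In one variable, expand \<open>g\<close> in Chebyshev polynomials: the \<open>m\<close>-th coefficient is \<open>O(m\<^sup>-\<^sup>q)\<close>, and
  by aliasing \<open>D\<^sup>l T\<^sub>m\<close> is a difference of Chebyshev polynomials of degree at most \<open>m\<close>, which vanishes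
  when \<open>m\<close> is small compared with \<open>2\<^sup>l\<close>. One integration by parts gives a factor \<open>1 / k\<close>. If
  \<open>l \<ge> 3\<close>, the interpolation error vanishes at the endpoints and a second integration by parts gives
  \<open>1 / k\<^sup>2\<close>, where Parseval's identity bounds the total variation of \<open>T\<^sub>m'\<close> by \<open>m\<close> to the power
  \<open>5 / 2\<close>. With \<open>q = p + 3\<close> the functional of level \<open>l\<close> is thus at most a constant times \<open>1 / k\<close> times
  \<open>2\<close> to the power \<open>- (p - 3 / 4) l\<close>. For \<open>r > d\<close> every omitted vector has a level of at least \<open>3\<close>,
  which accounts for the exponent \<open>d + 1\<close> of \<open>1 / k\<close>.
\<close>

section \<open>Chebyshev expansions\<close>

text \<open>The sum over all level vectors is never formed. Inside a box {1..L}^d it collapses to a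
  tensor product of \<open>Q_op L\<close>, whose distance to the interpolated function is O(1/L);
  all other bounds are uniform in L, and L tends to infinity at the end. The interpolated function
  is f times the slow phase, whose derivatives do not enter the norm of f. That phase is a product
  over the coordinates with frequencies at most 1, so it is moved into the weights of the
  functionals and the tensor argument sees f alone. In a coordinate with k |a_j| < 1 nothing
  oscillates; there 1 / (k |a_j|) exceeds 1 and trivial bounds replace integration by parts. The
  exponent p - 3/4 is a budget. The moments grow at most like m to the power 5/2, the coefficients
  decay like m to the power -(p + 3). Of the surplus p + 1/2, a part 5/4 makes the series in m
  converge and p - 3/4 becomes decay in the level. Of this, 1/8 sums the omitted vectors and another
  1/8 absorbs the powers of r in the number of points, which leaves p - 1.\<close>

definition cheb_coeff :: "(real \<Rightarrow> complex) \<Rightarrow> nat \<Rightarrow> complex" where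
  "cheb_coeff h m = integral {0..pi} (\<lambda>t. h (cos t) * of_real (cos (real m * t)))"

lemma continuous_on_comp_cos:
  assumes "continuous_on {-1..1} h"
  shows "continuous_on {0..pi} (\<lambda>t. h (cos t))"
  by (rule continuous_on_compose2[OF assms]) (auto intro!: continuous_intros)

lemma cheb_coeff_integrable:
  fixes h :: "real \<Rightarrow> complex"
  assumes "continuous_on {-1..1} h"
  shows "(\<lambda>t. h (cos t) * of_real (cos (real m * t))) integrable_on {0..pi}"
  by (intro integrable_continuous_interval continuous_intros continuous_on_comp_cos assms)

lemma norm_integral_le:
  fixes f :: "real \<Rightarrow> complex"
  assumes "continuous_on {a..b} f" "\<And>x. x \<in> {a..b} \<Longrightarrow> norm (f x) \<le> M" "a \<le> b"
  shows "norm (integral {a..b} f) \<le> M * (b - a)"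
  using integral_bound[OF assms(3,1)] assms(2) by (simp add: mult.commute)

lemma norm_cheb_coeff_le:
  assumes "continuous_on {-1..1} h" "\<And>x. x \<in> {-1..1} \<Longrightarrow> norm (h x) \<le> M"
  shows "norm (cheb_coeff h m) \<le> pi * M"
proof -
  have "norm (cheb_coeff h m) \<le> M * (pi - 0)"
    unfolding cheb_coeff_def
  proof (rule norm_integral_le)
    show "continuous_on {0..pi} (\<lambda>t. h (cos t) * of_real (cos (real m * t)))"
      by (intro continuous_intros continuous_on_comp_cos assms)
    fix t :: real
    have "norm (h (cos t)) * \<bar>cos (real m * t)\<bar> \<le> M * 1"
    proof (rule mult_mono)
      show "norm (h (cos t)) \<le> M" by (rule assms(2)) auto
      then show "0 \<le> M" using norm_ge_zero order_trans by blast
    qed auto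
    then show "norm (h (cos t) * of_real (cos (real m * t))) \<le> M"
      by (simp add: norm_mult)
  qed auto
  then show ?thesis by (simp add: mult.commute)
qed

text \<open>Integrate the derivative of h(cos t) sin(m t) over [0, pi]: the boundary terms vanish
  with the sine, and sin t sin(m t) is half a difference of cosines, which produces the two
  neighbouring coefficients.\<close>

lemma cheb_coeff_deriv:
  assumes der: "\<And>x. x \<in> {-1..1} \<Longrightarrow> (h has_vector_derivative h' x) (at x within {-1..1})"
    and cont: "continuous_on {-1..1} h'" and m: "1 \<le> m"
  shows "of_nat (2 * m) * cheb_coeff h m = cheb_coeff h' (m - 1) - cheb_coeff h' (m + 1)"
proof -
  have conth: "continuous_on {-1..1} h"
    using der by (meson continuous_on_eq_continuous_within has_vector_derivative_continuous)
  define F where "F t = h (cos t) * of_real (sin (real m * t))" for t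
  define F' where "F' t = h (cos t) * of_real (real m * cos (real m * t))
     - h' (cos t) * of_real (cos (real (m - 1) * t) - cos (real (m + 1) * t)) / 2" for t
  have "(F' has_integral (F pi - F 0)) {0..pi}"
  proof (rule fundamental_theorem_of_calculus)
    fix t :: real
    assume t: "t \<in> {0..pi}"
    have "(h \<circ> cos has_vector_derivative (- sin t) *\<^sub>R h' (cos t)) (at t within {0..pi})"
    proof (rule vector_diff_chain_within)
      show "(cos has_vector_derivative - sin t) (at t within {0..pi})"
        by (auto intro!: derivative_eq_intros simp: has_real_derivative_iff_has_vector_derivative[symmetric])
      show "(h has_vector_derivative h' (cos t)) (at (cos t) within cos ` {0..pi})"
        by (rule has_vector_derivative_within_subset[OF der]) auto
    qed
    then have 1: "((\<lambda>t. h (cos t)) has_vector_derivative - (of_real (sin t) * h' (cos t))) (at t within {0..pi})"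
      by (simp add: o_def scaleR_conv_of_real)
    have "((\<lambda>t. sin (real m * t)) has_vector_derivative real m * cos (real m * t)) (at t within {0..pi})"
      by (auto intro!: derivative_eq_intros simp: has_real_derivative_iff_has_vector_derivative[symmetric])
    then have 2: "((\<lambda>t. complex_of_real (sin (real m * t))) has_vector_derivative
        of_real (real m * cos (real m * t))) (at t within {0..pi})"
      by (rule bounded_linear.has_vector_derivative[OF bounded_linear_of_real])
    have id: "cos (real (m - 1) * t) - cos (real (m + 1) * t) = 2 * (sin t * sin (real m * t))"
      using m cos_diff[of "real m * t" t] cos_add[of "real m * t" t] by (simp add: of_nat_diff algebra_simps)
    have "(F has_vector_derivative (h (cos t) * of_real (real m * cos (real m * t)) +
        - (of_real (sin t) * h' (cos t)) * of_real (sin (real m * t)))) (at t within {0..pi})"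
      unfolding F_def by (rule has_vector_derivative_mult[OF 1 2])
    moreover have "h (cos t) * of_real (real m * cos (real m * t)) +
        - (of_real (sin t) * h' (cos t)) * of_real (sin (real m * t)) = F' t"
      unfolding F'_def id by simp
    ultimately show "(F has_vector_derivative F' t) (at t within {0..pi})"
      by simp
  qed simp
  moreover have "F pi = 0" "F 0 = 0"
    by (simp_all add: F_def)
  ultimately have "integral {0..pi} F' = 0"
    by (simp add: integral_unique)
  moreover have "integral {0..pi} F' = of_nat m * cheb_coeff h m - (cheb_coeff h' (m - 1) - cheb_coeff h' (m + 1)) / 2"
  proof -
    have "(F' has_integral of_nat m * cheb_coeff h m - (cheb_coeff h' (m - 1) - cheb_coeff h' (m + 1)) / 2) {0..pi}"
    proof -
      have "((\<lambda>t. of_nat m * (h (cos t) * of_real (cos (real m * t)))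
          - (h' (cos t) * of_real (cos (real (m - 1) * t)) - h' (cos t) * of_real (cos (real (m + 1) * t))) / 2)
        has_integral of_nat m * cheb_coeff h m - (cheb_coeff h' (m - 1) - cheb_coeff h' (m + 1)) / 2) {0..pi}"
        unfolding cheb_coeff_def
        by (intro has_integral_diff has_integral_mult_right has_integral_divide
            integrable_integral cheb_coeff_integrable conth cont)
      then show ?thesis
        by (rule has_integral_eq[rotated]) (simp add: F'_def algebra_simps)
    qed
    then show ?thesis by (rule integral_unique)
  qed
  ultimately show ?thesis
    by (simp add: field_simps)
qed

lemma cheb_coeff_add_cmult:
  assumes "continuous_on {-1..1} g" "continuous_on {-1..1} h"
  shows "cheb_coeff (\<lambda>x. g x + c * h x) m = cheb_coeff g m + c * cheb_coeff h m"
proof -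
  have "((\<lambda>t. g (cos t) * of_real (cos (real m * t)) + c * (h (cos t) * of_real (cos (real m * t))))
     has_integral cheb_coeff g m + c * cheb_coeff h m) {0..pi}"
    unfolding cheb_coeff_def
    by (intro has_integral_add has_integral_mult_right integrable_integral cheb_coeff_integrable assms)
  then have "((\<lambda>t. (g (cos t) + c * h (cos t)) * of_real (cos (real m * t)))
     has_integral cheb_coeff g m + c * cheb_coeff h m) {0..pi}"
    by (simp add: algebra_simps)
  then show ?thesis
    unfolding cheb_coeff_def by (rule integral_unique)
qed

section \<open>Coefficient decay for smooth functions with a slow phase\<close>

text \<open>The derivatives are carried as an explicit family with one common bound, rather than
  through an iterated derivative operator. In the tensor argument \<open>g s\<close> is a
  contraction of mixed derivatives of f, and such a family is supplied directly.\<close>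

definition deriv_tower :: "nat \<Rightarrow> (nat \<Rightarrow> real \<Rightarrow> complex) \<Rightarrow> real \<Rightarrow> bool" where
  "deriv_tower q g M \<longleftrightarrow>
    (\<forall>s<q. \<forall>x\<in>{-1..1}. (g s has_vector_derivative g (Suc s) x) (at x within {-1..1})) \<and>
    continuous_on {-1..1} (g q) \<and> (\<forall>s\<le>q. \<forall>x\<in>{-1..1}. norm (g s x) \<le> M)"

lemma deriv_tower_continuous:
  assumes "deriv_tower q g M" "s \<le> q"
  shows "continuous_on {-1..1} (g s)"
proof (cases "s = q")
  case False
  then have "s < q" using assms(2) by simp
  then show ?thesis
    using assms(1) unfolding deriv_tower_def
    by (meson continuous_on_eq_continuous_within has_vector_derivative_continuous)
qed (use assms in \<open>simp add: deriv_tower_def\<close>)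

text \<open>Differentiating \<open>g 0\<close> times the phase gives two terms of the same shape,
  one with \<open>g 1\<close> and one with \<open>g 0\<close> and a factor \<kappa> of modulus at
  most 1. The induction therefore treats g and its shifted tower together, and the phase costs only
  a factor 2 per derivative.\<close>

lemma norm_cheb_coeff_phase_le:
  assumes "deriv_tower q g M" "\<bar>\<kappa>\<bar> \<le> 1"
  shows "norm (cheb_coeff (\<lambda>x. g 0 x * exp (\<i> * of_real (\<kappa> * x))) m) \<le> pi * 4 ^ (q * (q + 1)) * M / (real m + 1) ^ q"
  using assms
proof (induction q arbitrary: g m)
  case 0
  have "norm (cheb_coeff (\<lambda>x. g 0 x * exp (\<i> * of_real (\<kappa> * x))) m) \<le> pi * M"
    using 0 by (intro norm_cheb_coeff_le continuous_intros) (auto simp: deriv_tower_def norm_mult)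
  then show ?case by simp
next
  case (Suc q)
  let ?e = "\<lambda>x::real. exp (\<i> * of_real (\<kappa> * x))"
  let ?C = "pi * 4 ^ (q * (q + 1)) * M"
  let ?C' = "pi * 4 ^ (Suc q * (Suc q + 1)) * M"
  have M0: "0 \<le> M"
    using Suc.prems(1) unfolding deriv_tower_def by (meson atLeastAtMost_iff norm_ge_zero order_trans zero_le zero_le_one neg_le_0_iff_le)
  have cont: "continuous_on {-1..1} (\<lambda>x. g s x * ?e x)" if "s \<le> Suc q" for s
    by (intro continuous_intros deriv_tower_continuous[OF Suc.prems(1) that])
  have t0: "deriv_tower q g M"
    using Suc.prems(1) deriv_tower_continuous[OF Suc.prems(1), of q] unfolding deriv_tower_def by auto
  have t1: "deriv_tower q (\<lambda>s. g (Suc s)) M"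
    using Suc.prems(1) unfolding deriv_tower_def by auto
  have 0: "norm (cheb_coeff (\<lambda>x. g 0 x * ?e x) n) \<le> ?C / (real n + 1) ^ q" for n
    by (rule Suc.IH[OF t0 Suc.prems(2)])
  have 1: "norm (cheb_coeff (\<lambda>x. g 1 x * ?e x) n) \<le> ?C / (real n + 1) ^ q" for n
    using Suc.IH[OF t1 Suc.prems(2)] by simp
  define h' where "h' x = g 1 x * ?e x + \<i> * of_real \<kappa> * (g 0 x * ?e x)" for x
  have h': "norm (cheb_coeff h' n) \<le> 2 * ?C / (real n + 1) ^ q" for n
  proof -
    have "cheb_coeff h' n = cheb_coeff (\<lambda>x. g 1 x * ?e x) n + \<i> * of_real \<kappa> * cheb_coeff (\<lambda>x. g 0 x * ?e x) n"
      unfolding h'_def by (rule cheb_coeff_add_cmult[OF cont cont]) auto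
    also have "norm \<dots> \<le> norm (cheb_coeff (\<lambda>x. g 1 x * ?e x) n) + norm (\<i> * of_real \<kappa> * cheb_coeff (\<lambda>x. g 0 x * ?e x) n)"
      by (rule norm_triangle_ineq)
    also have "\<dots> \<le> norm (cheb_coeff (\<lambda>x. g 1 x * ?e x) n) + 1 * norm (cheb_coeff (\<lambda>x. g 0 x * ?e x) n)"
      unfolding norm_mult using Suc.prems(2) by (intro add_left_mono mult_right_mono) auto
    also have "\<dots> \<le> ?C / (real n + 1) ^ q + 1 * (?C / (real n + 1) ^ q)"
      by (intro add_mono mult_left_mono 0 1) auto
    also have "\<dots> = 2 * ?C / (real n + 1) ^ q"
      by simp
    finally show ?thesis .
  qed
  show ?case
  proof (cases "m = 0")
    \<comment> \<open>The recurrence divides by m and says nothing for m = 0; the sup bound is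
      enough there.\<close>
    case True
    have "norm (cheb_coeff (\<lambda>x. g 0 x * ?e x) 0) \<le> pi * M"
      using Suc.prems(1) by (intro norm_cheb_coeff_le cont) (auto simp: deriv_tower_def norm_mult)
    also have "\<dots> = pi * 1 * M" by simp
    also have "\<dots> \<le> pi * 4 ^ (Suc q * (Suc q + 1)) * M"
      using M0 by (intro mult_right_mono mult_left_mono one_le_power) auto
    finally show ?thesis using True by simp
  next
    case False
    then have m: "1 \<le> m" by simp
    have rec: "of_nat (2 * m) * cheb_coeff (\<lambda>x. g 0 x * ?e x) m = cheb_coeff h' (m - 1) - cheb_coeff h' (m + 1)"
    proof (rule cheb_coeff_deriv[OF _ _ m])
      fix x :: real assume x: "x \<in> {-1..1}"
      have a: "(g 0 has_vector_derivative g 1 x) (at x within {-1..1})"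
        using Suc.prems(1) x unfolding deriv_tower_def by auto
      have b: "(?e has_vector_derivative \<i> * of_real \<kappa> * ?e x) (at x within {-1..1})"
      proof -
        have "((\<lambda>z. exp (\<i> * (of_real \<kappa> * z))) has_field_derivative \<i> * of_real \<kappa> * exp (\<i> * (of_real \<kappa> * of_real x))) (at (of_real x))"
          by (auto intro!: derivative_eq_intros)
        from has_vector_derivative_real_field[OF this]
        show ?thesis by (simp add: o_def)
      qed
      show "((\<lambda>x. g 0 x * ?e x) has_vector_derivative h' x) (at x within {-1..1})"
        using has_vector_derivative_mult[OF a b] by (simp add: h'_def algebra_simps)
    next
      show "continuous_on {-1..1} h'"
        unfolding h'_def by (intro continuous_on_add continuous_on_mult continuous_on_const cont) auto
    qed
    have C0: "0 \<le> ?C" using M0 by simp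
    have "real (2 * m) * norm (cheb_coeff (\<lambda>x. g 0 x * ?e x) m) = norm (of_nat (2 * m) * cheb_coeff (\<lambda>x. g 0 x * ?e x) m)"
      unfolding norm_mult norm_of_nat ..
    also have "\<dots> \<le> norm (cheb_coeff h' (m - 1)) + norm (cheb_coeff h' (m + 1))"
      unfolding rec by (rule norm_triangle_ineq4)
    also have "\<dots> \<le> 2 * ?C / real m ^ q + 2 * ?C / real m ^ q"
    proof (rule add_mono)
      show "norm (cheb_coeff h' (m - 1)) \<le> 2 * ?C / real m ^ q"
        using h'[of "m - 1"] m by (simp add: of_nat_diff)
      have "norm (cheb_coeff h' (m + 1)) \<le> 2 * ?C / (real (m + 1) + 1) ^ q" by (rule h')
      also have "\<dots> \<le> 2 * ?C / real m ^ q"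
        using C0 m by (intro divide_left_mono power_mono mult_pos_pos zero_less_power) auto
      finally show "norm (cheb_coeff h' (m + 1)) \<le> 2 * ?C / real m ^ q" .
    qed
    finally have "norm (cheb_coeff (\<lambda>x. g 0 x * ?e x) m) \<le> 2 * ?C / real m ^ Suc q"
      using m by (simp add: field_simps)
    also have "\<dots> \<le> ?C' / (real m + 1) ^ Suc q"
    proof -
      \<comment> \<open>Passing from m to m + 1 in the denominator costs \<open>2 ^ Suc q\<close>,
        on top of the factor 2 already present. The exponent q (q + 1) grows by 2 q + 2 in each
        step, which covers both.\<close>
      have "(real m + 1) ^ Suc q \<le> (2 * real m) ^ Suc q"
        using m by (intro power_mono) auto
      then have "2 * ?C * (real m + 1) ^ Suc q \<le> 2 * ?C * (2 ^ Suc q * real m ^ Suc q)"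
        unfolding power_mult_distrib by (rule mult_left_mono) (use C0 in simp)
      also have "\<dots> = (2 * 2 ^ Suc q * ?C) * real m ^ Suc q" by simp
      also have "\<dots> \<le> ?C' * real m ^ Suc q"
      proof (rule mult_right_mono)
        have "(2::real) * 2 ^ Suc q = 2 ^ (q + 2)" by simp
        also have "\<dots> \<le> 4 ^ (2 * q + 2)"
        proof -
          have "(2::real) ^ (q + 2) \<le> 2 ^ (2 * (2 * q + 2))" by (intro power_increasing) auto
          then show ?thesis by (simp add: power_mult)
        qed
        finally have "2 * 2 ^ Suc q * ?C \<le> 4 ^ (2 * q + 2) * ?C"
          using C0 by (rule mult_right_mono)
        also have "\<dots> = ?C'" by (simp add: power_add[symmetric] algebra_simps)
        finally show "2 * 2 ^ Suc q * ?C \<le> ?C'" .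
      qed simp
      finally have "2 * ?C * (real m + 1) ^ Suc q \<le> ?C' * real m ^ Suc q" .
      moreover have "0 < real m ^ Suc q" "0 < (real m + 1) ^ Suc q"
        using m by simp_all
      ultimately show ?thesis
        by (simp only: pos_divide_le_eq times_divide_eq_left pos_le_divide_eq)
    qed
    finally show ?thesis .
  qed
qed

section \<open>Completeness of the cosines and pointwise expansion\<close>

text \<open>Product formulas turn vanishing cosine moments into orthogonality to every polynomial in
  cos t. By Weierstrass, d is a uniform limit of polynomials, so d is orthogonal to itself.\<close>

lemma eq_0_if_cos_moments_eq_0:
  fixes d :: "real \<Rightarrow> real"
  assumes cont: "continuous_on {-1..1} d"
    and int: "\<And>m. ((\<lambda>t. d (cos t) * cos (real m * t)) has_integral 0) {0..pi}"
    and x: "x \<in> {-1..1}"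
  shows "d x = 0"
proof -
  \<comment> \<open>The cosine factor is kept general so that the power can be lowered by 2 cos t
    cos(m t) = cos((m + 1) t) + cos((m - 1) t); for m = 0 the factor cos t is itself the cosine with
    m = 1.\<close>
  have pow: "((\<lambda>t. d (cos t) * cos t ^ i * cos (real m * t)) has_integral 0) {0..pi}" for i m
  proof (induction i arbitrary: m)
    case 0
    then show ?case using int by simp
  next
    case (Suc i)
    show ?case
    proof (cases m)
      case 0
      then show ?thesis using Suc.IH[of 1] by (simp add: mult_ac)
    next
      case (Suc n)
      have "((\<lambda>t. (d (cos t) * cos t ^ i * cos (real (m + 1) * t) + d (cos t) * cos t ^ i * cos (real n * t)) / 2)
          has_integral (0 + 0) / 2) {0..pi}"
        by (intro has_integral_divide has_integral_add Suc.IH)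
      moreover have "(d (cos t) * cos t ^ i * cos (real (m + 1) * t) + d (cos t) * cos t ^ i * cos (real n * t)) / 2
        = d (cos t) * cos t ^ Suc i * cos (real m * t)" for t
      proof -
        have "cos (real (m + 1) * t) + cos (real n * t) = 2 * (cos t * cos (real m * t))"
          using Suc cos_add[of "real m * t" t] cos_diff[of "real m * t" t] by (simp add: algebra_simps)
        moreover have "(d (cos t) * cos t ^ i * cos (real (m + 1) * t) + d (cos t) * cos t ^ i * cos (real n * t)) / 2
          = d (cos t) * cos t ^ i * (cos (real (m + 1) * t) + cos (real n * t)) / 2"
          by (simp only: distrib_left)
        ultimately show ?thesis by simp
      qed
      ultimately show ?thesis by simp
    qed
  qed
  have contc: "continuous_on {0..pi} (\<lambda>t. d (cos t))"
    by (rule continuous_on_compose2[OF cont]) (auto intro!: continuous_intros)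
  obtain B where B: "B > 0" "\<And>x. x \<in> {-1..1} \<Longrightarrow> \<bar>d x\<bar> \<le> B"
  proof -
    have "bounded (d ` {-1..1})"
      using cont by (intro compact_imp_bounded compact_continuous_image) auto
    then show ?thesis using that unfolding bounded_pos by auto
  qed
  have small: "integral {0..pi} (\<lambda>t. (d (cos t))\<^sup>2) \<le> e" if e: "e > 0" for e
  proof -
    \<comment> \<open>Since P is orthogonal to d, the integral of d squared equals that of d (d -
      P), which is at most B times the tolerance times pi, that is e.\<close>
    obtain P where P: "real_polynomial_function P" "\<And>x. x \<in> {-1..1} \<Longrightarrow> \<bar>d x - P x\<bar> < e / (B * pi)"
      using Stone_Weierstrass_real_polynomial_function[OF _ cont, of "e / (B * pi)"] e B(1) by auto
    obtain a n where an: "P = (\<lambda>x. \<Sum>i\<le>n. a i * x ^ i)"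
      using P(1) real_polynomial_function_iff_sum by blast
    have "((\<lambda>t. \<Sum>i\<le>n. a i * (d (cos t) * cos t ^ i * cos (real 0 * t))) has_integral (\<Sum>i\<le>n. a i * 0)) {0..pi}"
      by (intro has_integral_sum has_integral_mult_right pow) auto
    then have "((\<lambda>t. d (cos t) * P (cos t)) has_integral 0) {0..pi}"
      by (simp add: an sum_distrib_left mult_ac)
    moreover have "((\<lambda>t. (d (cos t))\<^sup>2) has_integral integral {0..pi} (\<lambda>t. (d (cos t))\<^sup>2)) {0..pi}"
      by (intro integrable_integral integrable_continuous_interval continuous_intros contc)
    ultimately have "((\<lambda>t. (d (cos t))\<^sup>2 - d (cos t) * P (cos t)) has_integral
        integral {0..pi} (\<lambda>t. (d (cos t))\<^sup>2) - 0) {0..pi}"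
      by (intro has_integral_diff)
    moreover have "((\<lambda>t. B * (e / (B * pi))) has_integral (B * (e / (B * pi))) * (pi - 0)) {0..pi}"
      using has_integral_const_real[of "B * (e / (B * pi))" 0 pi] by (simp add: mult.commute)
    ultimately have "integral {0..pi} (\<lambda>t. (d (cos t))\<^sup>2) - 0 \<le> (B * (e / (B * pi))) * (pi - 0)"
    proof (rule has_integral_le)
      fix t :: real
      have "(d (cos t))\<^sup>2 - d (cos t) * P (cos t) \<le> \<bar>d (cos t) * (d (cos t) - P (cos t))\<bar>"
        by (simp add: power2_eq_square algebra_simps)
      also have "\<dots> \<le> B * (e / (B * pi))"
        unfolding abs_mult using B P(2)[of "cos t"] by (intro mult_mono) (auto intro: less_imp_le)
      finally show "(d (cos t))\<^sup>2 - d (cos t) * P (cos t) \<le> B * (e / (B * pi))" .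
    qed
    then show ?thesis using B(1) by simp
  qed
  have "integral {0..pi} (\<lambda>t. (d (cos t))\<^sup>2) \<le> 0"
    by (rule field_le_epsilon) (simp add: small)
  moreover have "integral {0..pi} (\<lambda>t. (d (cos t))\<^sup>2) \<ge> 0"
    by (intro integral_nonneg integrable_continuous_interval continuous_intros contc) auto
  ultimately have "integral {0..pi} (\<lambda>t. (d (cos t))\<^sup>2) = 0" by simp
  moreover have "continuous_on {0..pi} (\<lambda>t. (d (cos t))\<^sup>2)"
    by (intro continuous_intros contc)
  ultimately have "\<forall>t\<in>{0..pi}. (d (cos t))\<^sup>2 = 0"
    by (subst (asm) integral_eq_0_iff) auto
  moreover have "arccos x \<in> {0..pi}" "cos (arccos x) = x"
    using x arccos_bounded[of x] by auto
  ultimately show ?thesis by force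
qed

lemma eq_0_if_cheb_coeff_eq_0:
  assumes cont: "continuous_on {-1..1} d" and zero: "\<And>m. cheb_coeff d m = 0" and x: "x \<in> {-1..1}"
  shows "d x = 0"
proof -
  have I: "((\<lambda>t. d (cos t) * of_real (cos (real m * t))) has_integral 0) {0..pi}" for m
    using integrable_integral[OF cheb_coeff_integrable[OF cont, of m]] zero[of m] by (simp add: cheb_coeff_def)
  have "Re (d x) = 0"
  proof (rule eq_0_if_cos_moments_eq_0[OF _ _ x])
    show "continuous_on {-1..1} (\<lambda>x. Re (d x))" by (intro continuous_intros cont)
    show "((\<lambda>t. Re (d (cos t)) * cos (real m * t)) has_integral 0) {0..pi}" for m
      using has_integral_Re[OF I[of m]] by simp
  qed
  moreover have "Im (d x) = 0"
  proof (rule eq_0_if_cos_moments_eq_0[OF _ _ x])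
    show "continuous_on {-1..1} (\<lambda>x. Im (d x))" by (intro continuous_intros cont)
    show "((\<lambda>t. Im (d (cos t)) * cos (real m * t)) has_integral 0) {0..pi}" for m
      using has_integral_Im[OF I[of m]] by simp
  qed
  ultimately show ?thesis by (simp add: complex_eq_iff)
qed

text \<open>The normalization left out of \<open>cheb_coeff\<close>: the reciprocal of the integral
  of cos(m t) squared over [0, pi].\<close>

definition cheb_weight :: "nat \<Rightarrow> complex" where
  "cheb_weight m = (if m = 0 then 1 else 2) / of_real pi"

lemma has_integral_cos_int:
  fixes k :: int
  shows "((\<lambda>t. cos (of_int k * t)) has_integral (if k = 0 then pi else 0)) {0..pi}"
proof (cases "k = 0")
  case True
  then show ?thesis using has_integral_const_real[of "1::real" 0 pi] by simp
next
  case False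
  have "((\<lambda>t. cos (of_int k * t)) has_integral (sin (of_int k * pi) / of_int k - sin (of_int k * 0) / of_int k)) {0..pi}"
    using False by (intro fundamental_theorem_of_calculus)
      (auto intro!: derivative_eq_intros simp: has_real_derivative_iff_has_vector_derivative[symmetric])
  moreover have "sin (of_int k * pi) = 0"
    by (simp add: sin_zero_iff_int2)
  ultimately show ?thesis using False by simp
qed

lemma has_integral_cos_cos:
  "((\<lambda>t. cos (real m * t) * cos (real n * t)) has_integral
     (if m = n then (if m = 0 then pi else pi / 2) else 0)) {0..pi}"
proof -
  have "((\<lambda>t. (cos (of_int (int m - int n) * t) + cos (of_int (int m + int n) * t)) / 2) has_integral
      ((if int m - int n = 0 then pi else 0) + (if int m + int n = 0 then pi else 0)) / 2) {0..pi}"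
    by (intro has_integral_divide has_integral_add has_integral_cos_int)
  moreover have "(cos (of_int (int m - int n) * t) + cos (of_int (int m + int n) * t)) / 2 =
      cos (real m * t) * cos (real n * t)" for t
    using cos_add[of "real m * t" "real n * t"] cos_diff[of "real m * t" "real n * t"] by (simp add: algebra_simps)
  moreover have "((if int m - int n = 0 then pi else 0) + (if int m + int n = 0 then pi else 0)) / 2 =
     (if m = n then (if m = 0 then pi else pi / 2) else 0)" by auto
  ultimately show ?thesis by simp
qed

text \<open>The series converges uniformly by the M-test, so its sum is continuous and may be
  integrated termwise against each cosine. It therefore has the coefficients of h, and completeness
  identifies the two functions.\<close>

lemma chebyshev_expansion:
  assumes cont: "continuous_on {-1..1} h" and b: "\<And>m. norm (cheb_coeff h m) \<le> b m" and sb: "summable b"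
    and x: "x \<in> {-1..1}"
  shows "(\<lambda>m. cheb_weight m * cheb_coeff h m * of_real (cos (real m * arccos x))) sums h x"
proof -
  define u where "u m y = cheb_weight m * cheb_coeff h m * of_real (cos (real m * arccos y))" for m y
  define S where "S y = (\<Sum>m. u m y)" for y
  have ub: "norm (u m y) \<le> b m" for m y
  proof -
    have "norm (cheb_weight m) \<le> 1" using pi_gt3 by (simp add: cheb_weight_def norm_divide)
    then have "norm (cheb_weight m) * norm (cheb_coeff h m) * \<bar>cos (real m * arccos y)\<bar> \<le> 1 * b m * 1"
      using b[of m] by (intro mult_mono) (auto intro: order_trans[OF norm_ge_zero])
    then show ?thesis by (simp add: u_def norm_mult)
  qed
  have su: "summable (\<lambda>m. u m y)" for y
    by (rule summable_comparison_test'[OF sb, of 0]) (use ub in auto)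
  have ul: "uniform_limit {-1..1} (\<lambda>n y. \<Sum>m<n. u m y) S sequentially"
    unfolding S_def by (rule Weierstrass_m_test[OF ub sb])
  have contu: "continuous_on {-1..1} (u m)" for m
    unfolding u_def by (intro continuous_intros continuous_on_arccos') auto
  have contS: "continuous_on {-1..1} S"
    by (rule uniform_limit_theorem[OF _ ul]) (auto intro!: always_eventually continuous_intros contu)
  have u_cos: "u m (cos t) = cheb_weight m * cheb_coeff h m * of_real (cos (real m * t))" if "t \<in> {0..pi}" for m t
    using that by (simp add: u_def arccos_cos)
  have coeffS: "cheb_coeff S n = cheb_coeff h n" for n
  proof -
    have 1: "((\<lambda>t. (\<Sum>m<N. u m (cos t)) * of_real (cos (real n * t))) has_integral (if n < N then cheb_coeff h n else 0)) {0..pi}" for N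
    proof -
      have "((\<lambda>t. \<Sum>m<N. cheb_weight m * cheb_coeff h m * of_real (cos (real m * t) * cos (real n * t))) has_integral
         (\<Sum>m<N. cheb_weight m * cheb_coeff h m * of_real (if m = n then (if m = 0 then pi else pi / 2) else 0))) {0..pi}"
        by (intro has_integral_sum has_integral_mult_right has_integral_of_real has_integral_cos_cos) auto
      moreover have "(\<Sum>m<N. cheb_weight m * cheb_coeff h m * of_real (if m = n then (if m = 0 then pi else pi / 2) else 0))
         = (\<Sum>m<N. if m = n then cheb_coeff h n else 0)"
        by (intro sum.cong) (auto simp: cheb_weight_def)
      moreover have "\<dots> = (if n < N then cheb_coeff h n else 0)"
        by (simp add: sum.delta)
      ultimately have "((\<lambda>t. \<Sum>m<N. cheb_weight m * cheb_coeff h m * of_real (cos (real m * t) * cos (real n * t))) has_integral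
         (if n < N then cheb_coeff h n else 0)) {0..pi}" by simp
      then show ?thesis
        by (rule has_integral_eq[rotated]) (simp only: sum_distrib_right u_cos of_real_mult mult.assoc)
    qed
    have ul2: "uniform_limit {0..pi} (\<lambda>N t. (\<Sum>m<N. u m (cos t)) * of_real (cos (real n * t)))
        (\<lambda>t. S (cos t) * of_real (cos (real n * t))) sequentially"
    proof (rule uniform_limitI)
      fix e :: real assume "e > 0"
      from uniform_limitD[OF ul this]
      show "\<forall>\<^sub>F N in sequentially. \<forall>t\<in>{0..pi}. dist ((\<Sum>m<N. u m (cos t)) * of_real (cos (real n * t)))
          (S (cos t) * of_real (cos (real n * t))) < e"
      proof eventually_elim
        case (elim N)
        show ?case
        proof
          fix t :: real
          have "dist ((\<Sum>m<N. u m (cos t)) * of_real (cos (real n * t))) (S (cos t) * of_real (cos (real n * t)))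
              = dist (\<Sum>m<N. u m (cos t)) (S (cos t)) * \<bar>cos (real n * t)\<bar>"
            by (simp add: dist_norm left_diff_distrib[symmetric] norm_mult)
          also have "\<dots> \<le> dist (\<Sum>m<N. u m (cos t)) (S (cos t)) * 1"
            by (intro mult_left_mono) auto
          also have "\<dots> < e" using elim by simp
          finally show "dist ((\<Sum>m<N. u m (cos t)) * of_real (cos (real n * t))) (S (cos t) * of_real (cos (real n * t))) < e" .
        qed
      qed
    qed
    obtain I J where IJ:
        "\<And>N. ((\<lambda>t. (\<Sum>m<N. u m (cos t)) * of_real (cos (real n * t))) has_integral I N) {0..pi}"
        "((\<lambda>t. S (cos t) * of_real (cos (real n * t))) has_integral J) {0..pi}" "I \<longlonglongrightarrow> J"
    proof (rule uniform_limit_integral[OF ul2])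
      show "continuous_on {0..pi} (\<lambda>t. (\<Sum>m<N. u m (cos t)) * of_real (cos (real n * t)))" for N
        by (intro continuous_intros continuous_on_comp_cos contu)
    qed auto
    \<comment> \<open>The n-th coefficient of a partial sum is already the right one as soon as the
      n-th term is included.\<close>
    have "I = (\<lambda>N. if n < N then cheb_coeff h n else 0)"
      using IJ(1) 1 has_integral_unique by blast
    moreover have "(\<lambda>N. if n < N then cheb_coeff h n else 0) \<longlonglongrightarrow> cheb_coeff h n"
      by (rule tendsto_eventually) (use eventually_gt_at_top[of n] in eventually_elim, simp)
    ultimately have "J = cheb_coeff h n"
      using IJ(3) LIMSEQ_unique by blast
    with IJ(2) show ?thesis
      unfolding cheb_coeff_def[of S] by (simp add: integral_unique)
  qed
  have "h x - S x = 0"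
  proof (rule eq_0_if_cheb_coeff_eq_0[OF _ _ x, of "\<lambda>x. h x - S x"])
    show "continuous_on {-1..1} (\<lambda>x. h x - S x)" by (intro continuous_intros cont contS)
    show "cheb_coeff (\<lambda>x. h x - S x) m = 0" for m
      using cheb_coeff_add_cmult[OF cont contS, of "-1" m] by (simp add: coeffS)
  qed
  then have "h x = S x" by simp
  moreover have "(\<lambda>m. u m x) sums S x" unfolding S_def by (rule summable_sums[OF su])
  ultimately show ?thesis by (simp add: u_def)
qed

section \<open>Interpolation of Chebyshev polynomials\<close>

fun cheb_poly :: "nat \<Rightarrow> complex poly" where
  "cheb_poly 0 = 1"
| "cheb_poly (Suc 0) = [:0, 1:]"
| "cheb_poly (Suc (Suc n)) = [:0, 2:] * cheb_poly (Suc n) - cheb_poly n"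

lemma degree_cheb_poly: "degree (cheb_poly n) \<le> n"
proof (induction n rule: cheb_poly.induct)
  case (3 n)
  have "degree ([:0, 2:] * cheb_poly (Suc n)) \<le> 1 + Suc n"
    using degree_mult_le[of "[:0, 2:]" "cheb_poly (Suc n)"] 3(1) by simp
  then show ?case
    using 3(2) by (auto intro!: degree_diff_le)
qed auto

lemma poly_cheb_poly_cos: "poly (cheb_poly n) (of_real (cos t)) = of_real (cos (real n * t))"
proof (induction n rule: cheb_poly.induct)
  case (3 n)
  have "cos (real (Suc (Suc n)) * t) = 2 * (cos t * cos (real (Suc n) * t)) - cos (real n * t)"
    using cos_add[of "real (Suc n) * t" t] cos_diff[of "real (Suc n) * t" t] by (simp add: algebra_simps)
  then show ?case
    by (simp add: 3)
qed auto

text \<open>The Chebyshev polynomial in trigonometric form. It is used on [-1,1] only, where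
  \<open>arccos\<close> inverts the cosine and the values agree with
  \<open>cheb_poly\<close>.\<close>

definition cheb :: "nat \<Rightarrow> real \<Rightarrow> complex" where
  "cheb m x = of_real (cos (real m * arccos x))"

lemma cheb_cos: "t \<in> {0..pi} \<Longrightarrow> cheb m (cos t) = of_real (cos (real m * t))"
  by (simp add: cheb_def arccos_cos)

lemma poly_cheb_poly: "x \<in> {-1..1} \<Longrightarrow> poly (cheb_poly n) (of_real x) = cheb n x"
  using poly_cheb_poly_cos[of n "arccos x"] by (simp add: cheb_def)

lemma continuous_on_cheb: "continuous_on {-1..1} (cheb m)"
  unfolding cheb_def by (intro continuous_intros continuous_on_arccos') auto

lemma norm_cheb_le: "norm (cheb m x) \<le> 1"
  by (simp add: cheb_def)

lemma grid_subset: "grid l \<subseteq> {-1..1}"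
  by (auto simp: grid_def)

lemma interp_poly_eqI:
  assumes l: "2 \<le> l" and p: "degree p \<le> n_pts l" "\<And>x. x \<in> grid l \<Longrightarrow> poly p (of_real x) = g x"
  shows "interp_poly l g = p"
  unfolding interp_poly_def
proof (rule the_equality)
  show "degree p \<le> n_pts l \<and> (\<forall>x\<in>grid l. poly p (complex_of_real x) = g x)"
    using p by auto
  fix p' assume p': "degree p' \<le> n_pts l \<and> (\<forall>x\<in>grid l. poly p' (complex_of_real x) = g x)"
  have card: "card (complex_of_real ` grid l) = n_pts l + 1"
    using card_grid[OF l] by (simp add: card_image inj_on_def)
  show "p' = p"
    by (rule poly_eqI_degree[of "complex_of_real ` grid l"]) (use p p' card in auto)
qed

text \<open>At the angles j pi / n the cosines of frequency m, m + 2 n and 2 n - m coincide.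
  Reducing m modulo 2 n and reflecting residues above n lands in {0..n}; both moves preserve parity
  because 2 n is even.\<close>

lemma alias_index:
  assumes "0 < n"
  shows "\<exists>m'\<le>min m n. (m \<le> n \<longrightarrow> m' = m) \<and> (even m' \<longleftrightarrow> even m) \<and>
    (\<forall>j. cos (real m * (real j * pi / real n)) = cos (real m' * (real j * pi / real n)))"
proof -
  define a b where "a = m div (2 * n)" and "b = m mod (2 * n)"
  have m: "m = 2 * n * a + b" and b: "b < 2 * n"
    using assms by (simp_all add: a_def b_def)
  have per: "cos (real m * (real j * pi / real n)) = cos (real b * (real j * pi / real n))" for j
  proof -
    have "real m * (real j * pi / real n) = real b * (real j * pi / real n) + 2 * pi * real (a * j)"
      using assms by (simp add: m field_simps)
    moreover have "cos (x + 2 * pi * real i) = cos x" for x i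
      using cos_2npi[of i] sin_2npi[of i] by (simp add: cos_add mult_ac)
    ultimately show ?thesis by (simp only:)
  qed
  show ?thesis
  proof (cases "b \<le> n")
    case True
    moreover have "m \<le> n \<longrightarrow> b = m" using assms by (simp add: b_def)
    ultimately show ?thesis using per m by (intro exI[of _ b]) auto
  next
    case False
    have "cos (real b * (real j * pi / real n)) = cos (real (2 * n - b) * (real j * pi / real n))" for j
    proof -
      have "real (2 * n - b) * (real j * pi / real n) = 2 * pi * real j - real b * (real j * pi / real n)"
        using assms b by (simp add: of_nat_diff field_simps)
      moreover have "cos (2 * pi * real j - x) = cos x" for x
        using cos_2npi[of j] sin_2npi[of j] by (simp add: cos_diff mult_ac)
      ultimately show ?thesis by simp
    qed
    moreover have "m > n" using False m by auto
    moreover have "even (2 * n - b) \<longleftrightarrow> even m" using b m by auto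
    ultimately show ?thesis using per False b by (intro exI[of _ "2 * n - b"]) auto
  qed
qed

text \<open>The aliased polynomial has degree at most \<open>n_pts l\<close> and agrees with T_m at
  the nodes, so it is the interpolant. Parity is recorded because it fixes the value at -1.\<close>

lemma Q_op_cheb:
  assumes "2 \<le> l"
  obtains m' where "m' \<le> m" "m \<le> n_pts l \<Longrightarrow> m' = m" "even m' \<longleftrightarrow> even m"
    "\<And>x. x \<in> {-1..1} \<Longrightarrow> Q_op l (cheb m) x = cheb m' x"
proof -
  have n: "0 < n_pts l" by (simp add: n_pts_def)
  obtain m' where m': "m' \<le> min m (n_pts l)" "m \<le> n_pts l \<longrightarrow> m' = m" "even m' \<longleftrightarrow> even m"
    "\<And>j. cos (real m * (real j * pi / real (n_pts l))) = cos (real m' * (real j * pi / real (n_pts l)))"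
    using alias_index[OF n, of m] by blast
  have "interp_poly l (cheb m) = cheb_poly m'"
  proof (rule interp_poly_eqI[OF assms])
    show "degree (cheb_poly m') \<le> n_pts l"
      using degree_cheb_poly[of m'] m'(1) by simp
    fix x assume "x \<in> grid l"
    then obtain j where j: "x = cos (real j * pi / real (n_pts l))" "j \<le> n_pts l"
      using assms by (auto simp: grid_def)
    have "real j * pi / real (n_pts l) \<in> {0..pi}"
      using j(2) n by (auto simp: divide_le_eq mult.commute)
    then show "poly (cheb_poly m') (of_real x) = cheb m x"
      using m'(4)[of j] by (simp add: j(1) poly_cheb_poly_cos cheb_cos)
  qed
  then have "Q_op l (cheb m) x = cheb m' x" if "x \<in> {-1..1}" for x
    using assms that by (simp add: Q_op_def poly_cheb_poly)
  then show ?thesis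
    using m' by (intro that[of m']) auto
qed

lemma cheb_0 [simp]: "cheb 0 x = 1"
  by (simp add: cheb_def)

text \<open>For l at least 3 both interpolants reproduce T_m. At l = 2 the lower one is evaluation
  at 0, exact on constants; the strict inequality then forces m = 0.\<close>

lemma D_op_cheb_eq_0:
  assumes "2 \<le> l" "m < 2 ^ (l - 2)" "x \<in> {-1..1}"
  shows "D_op l (cheb m) x = 0"
proof (cases "l = 2")
  case True
  then have "m = 0" using assms by simp
  obtain m' where "m' \<le> m" "\<And>x. x \<in> {-1..1} \<Longrightarrow> Q_op l (cheb m) x = cheb m' x"
    using Q_op_cheb[OF assms(1), of m] by metis
  with \<open>m = 0\<close> True assms(3) show ?thesis by (simp add: D_op_def Q_op_def[of "Suc 0"])
next
  case False
  then have l: "2 \<le> l - 1" using assms(1) by simp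
  have "(2::nat) ^ (l - 2) \<le> 2 ^ (l - 1)" by (rule power_increasing) auto
  moreover have l2: "l - 1 - 1 = l - 2" by simp
  ultimately have m: "m \<le> n_pts (l - 1)" "m \<le> n_pts l"
    unfolding n_pts_def l2 using assms(2) by - linarith+
  have "Q_op l (cheb m) x = cheb m x"
    by (rule Q_op_cheb[OF assms(1), of m]) (use m assms(3) in auto)
  moreover have "Q_op (l - 1) (cheb m) x = cheb m x"
    by (rule Q_op_cheb[OF l, of m]) (use m assms(3) in auto)
  ultimately show ?thesis by (simp add: D_op_def)
qed

text \<open>From level 3 on, both interpolations use the endpoints. Equal parity expresses that the
  difference vanishes at -1 as well as at 1.\<close>

lemma D_op_cheb:
  assumes "3 \<le> l"
  obtains m1 m2 where "m1 \<le> m" "m2 \<le> m" "even m1 \<longleftrightarrow> even m2"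
    "\<And>x. x \<in> {-1..1} \<Longrightarrow> D_op l (cheb m) x = cheb m1 x - cheb m2 x"
proof -
  have l: "2 \<le> l" "2 \<le> l - 1" using assms by auto
  obtain m1 where 1: "m1 \<le> m" "even m1 \<longleftrightarrow> even m"
    "\<And>x. x \<in> {-1..1} \<Longrightarrow> Q_op l (cheb m) x = cheb m1 x"
    by (rule Q_op_cheb[OF l(1), of m], rule that)
  obtain m2 where 2: "m2 \<le> m" "even m2 \<longleftrightarrow> even m"
    "\<And>x. x \<in> {-1..1} \<Longrightarrow> Q_op (l - 1) (cheb m) x = cheb m2 x"
    by (rule Q_op_cheb[OF l(2), of m], rule that)
  show ?thesis by (rule that[of m1 m2]) (use 1 2 in \<open>auto simp: D_op_def\<close>)
qed

text \<open>The scalar c absorbs the low levels: 0 at level 0 and T_m(0) at level 1. One estimate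
  then covers all levels.\<close>

lemma Q_op_cheb':
  obtains m' c where "m' \<le> m" "norm c \<le> 1"
    "\<And>x. x \<in> {-1..1} \<Longrightarrow> Q_op l (cheb m) x = c * cheb m' x"
proof -
  consider "l = 0" | "l = 1" | "2 \<le> l" by linarith
  then show ?thesis
  proof cases
    case 1
    then show ?thesis by (intro that[of 0 0]) (auto simp: Q_op_def)
  next
    case 2
    then show ?thesis by (intro that[of 0 "cheb m 0"]) (auto simp: Q_op_def norm_cheb_le)
  next
    case 3
    obtain m' where "m' \<le> m" "\<And>x. x \<in> {-1..1} \<Longrightarrow> Q_op l (cheb m) x = cheb m' x"
      by (rule Q_op_cheb[OF 3, of m], rule that)
    then show ?thesis by (intro that[of m' 1]) auto
  qed
qed

section \<open>Oscillatory moments of Chebyshev polynomials\<close>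

text \<open>The quotient sin(n t) / sin t continued over the zeros of the sine, that is, the
  second-kind Chebyshev polynomial of index n - 1 at cos t. The recursion is sin((n + 2) t) - sin(n
  t) = 2 sin t cos((n + 1) t) divided by sin t.\<close>

fun V_kernel :: "nat \<Rightarrow> real \<Rightarrow> real" where
  "V_kernel 0 t = 0"
| "V_kernel (Suc 0) t = 1"
| "V_kernel (Suc (Suc n)) t = 2 * cos (real (Suc n) * t) + V_kernel n t"

text \<open>The derivative of \<open>V_kernel\<close> as a sine polynomial with distinct frequencies
  below n, so that orthogonality gives its square integral.\<close>

fun W_kernel :: "nat \<Rightarrow> real \<Rightarrow> real" where
  "W_kernel 0 t = 0"
| "W_kernel (Suc 0) t = 0"
| "W_kernel (Suc (Suc n)) t = - 2 * real (Suc n) * sin (real (Suc n) * t) + W_kernel n t"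

lemma sin_mult_V_kernel: "sin t * V_kernel n t = sin (real n * t)"
proof (induction n t rule: V_kernel.induct)
  case (3 n t)
  have "sin (real (Suc (Suc n)) * t) = 2 * (sin t * cos (real (Suc n) * t)) + sin (real n * t)"
    using sin_add[of "real (Suc n) * t" t] sin_diff[of "real (Suc n) * t" t] by (simp add: algebra_simps)
  then show ?case using 3 by (simp add: algebra_simps)
qed auto

lemma abs_V_kernel_le: "\<bar>V_kernel n t\<bar> \<le> real n"
proof (induction n t rule: V_kernel.induct)
  case (3 n t)
  have "\<bar>2 * cos (real (Suc n) * t) + V_kernel n t\<bar> \<le> \<bar>2 * cos (real (Suc n) * t)\<bar> + \<bar>V_kernel n t\<bar>"
    by (rule abs_triangle_ineq)
  also have "\<dots> \<le> 2 + real n"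
    using 3 abs_cos_le_one[of "real (Suc n) * t"] unfolding abs_mult by linarith
  finally show ?case by simp
qed auto

lemma V_kernel_deriv: "(V_kernel n has_real_derivative W_kernel n t) (at t within A)"
proof (induction n t rule: W_kernel.induct)
  case (3 n t)
  have eq: "V_kernel (Suc (Suc n)) = (\<lambda>t. 2 * cos (real (Suc n) * t) + V_kernel n t)"
    by auto
  show ?case unfolding eq by (rule derivative_eq_intros 3 refl)+ (simp add: algebra_simps)
next
  case (1 t)
  have "V_kernel 0 = (\<lambda>t. 0)" by auto
  then show ?case by simp
next
  case (2 t)
  have "V_kernel (Suc 0) = (\<lambda>t. 1)" by auto
  then show ?case by simp
qed

lemma continuous_on_W_kernel: "continuous_on A (W_kernel n)"
proof (induction n rule: induct_nat_012)
  case (ge2 n)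
  have eq: "W_kernel (Suc (Suc n)) = (\<lambda>t. - 2 * real (Suc n) * sin (real (Suc n) * t) + W_kernel n t)"
    by auto
  show ?case unfolding eq by (intro continuous_intros ge2)
next
  case 0
  have "W_kernel 0 = (\<lambda>t. 0)" by auto
  then show ?case by simp
next
  case 1
  have "W_kernel (Suc 0) = (\<lambda>t. 0)" by auto
  then show ?case by simp
qed

lemma has_integral_sin_sin:
  assumes "0 < m"
  shows "((\<lambda>t. sin (real m * t) * sin (real n * t)) has_integral (if m = n then pi / 2 else 0)) {0..pi}"
proof -
  have "((\<lambda>t. (cos (of_int (int m - int n) * t) - cos (of_int (int m + int n) * t)) / 2) has_integral
      ((if int m - int n = 0 then pi else 0) - (if int m + int n = 0 then pi else 0)) / 2) {0..pi}"
    by (intro has_integral_divide has_integral_diff has_integral_cos_int)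
  moreover have "(cos (of_int (int m - int n) * t) - cos (of_int (int m + int n) * t)) / 2 =
      sin (real m * t) * sin (real n * t)" for t
    using cos_add[of "real m * t" "real n * t"] cos_diff[of "real m * t" "real n * t"] by (simp add: algebra_simps)
  moreover have "((if int m - int n = 0 then pi else 0) - (if int m + int n = 0 then pi else 0)) / 2 =
     (if m = n then pi / 2 else 0)" using assms by auto
  ultimately show ?thesis by simp
qed

lemma has_integral_W_kernel_sin:
  "n \<le> m \<Longrightarrow> ((\<lambda>t. W_kernel n t * sin (real m * t)) has_integral 0) {0..pi}"
proof (induction n rule: induct_nat_012)
  case (ge2 n)
  have "((\<lambda>t. - 2 * real (Suc n) * (sin (real (Suc n) * t) * sin (real m * t)) + W_kernel n t * sin (real m * t))
     has_integral (- 2 * real (Suc n) * (if Suc n = m then pi / 2 else 0) + 0)) {0..pi}"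
    by (intro has_integral_add has_integral_mult_right has_integral_sin_sin ge2) (use ge2 in auto)
  then show ?case using ge2(3) by (simp add: algebra_simps)
qed auto

text \<open>The new sine is orthogonal to all earlier ones, so the cross term vanishes and the
  square integral grows by 2 pi (n + 1)^2. The cubic bound follows from (n + 1)^2 + n^3 <= (n +
  2)^3.\<close>

lemma has_integral_W_kernel_square:
  "\<exists>I. ((\<lambda>t. (W_kernel n t)\<^sup>2) has_integral I) {0..pi} \<and> I \<le> 2 * pi * real n ^ 3"
proof (induction n rule: induct_nat_012)
  case (ge2 n)
  then obtain I where I: "((\<lambda>t. (W_kernel n t)\<^sup>2) has_integral I) {0..pi}" "I \<le> 2 * pi * real n ^ 3"
    by auto
  let ?c = "real (Suc n)"
  have "((\<lambda>t. 4 * ?c\<^sup>2 * (sin (?c * t) * sin (?c * t)) - 4 * ?c * (W_kernel n t * sin (?c * t)) + (W_kernel n t)\<^sup>2)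
      has_integral (4 * ?c\<^sup>2 * (if Suc n = Suc n then pi / 2 else 0) - 4 * ?c * 0 + I)) {0..pi}"
    by (intro has_integral_add has_integral_diff has_integral_mult_right has_integral_sin_sin I has_integral_W_kernel_sin) auto
  moreover have "4 * ?c\<^sup>2 * (sin (?c * t) * sin (?c * t)) - 4 * ?c * (W_kernel n t * sin (?c * t)) + (W_kernel n t)\<^sup>2
      = (W_kernel (Suc (Suc n)) t)\<^sup>2" for t
    by (simp add: power2_eq_square algebra_simps)
  ultimately have "((\<lambda>t. (W_kernel (Suc (Suc n)) t)\<^sup>2) has_integral (4 * ?c\<^sup>2 * (pi / 2) + I)) {0..pi}"
    by simp
  moreover have "4 * ?c\<^sup>2 * (pi / 2) + I \<le> 2 * pi * real (Suc (Suc n)) ^ 3"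
  proof -
    have "4 * ?c\<^sup>2 * (pi / 2) + I \<le> 2 * pi * (?c\<^sup>2 + real n ^ 3)"
      using I(2) by (simp add: algebra_simps)
    also have "\<dots> \<le> 2 * pi * real (Suc (Suc n)) ^ 3"
      by (intro mult_left_mono) (auto simp: power2_eq_square power3_eq_cube algebra_simps)
    finally show ?thesis .
  qed
  ultimately show ?case by blast
qed (auto intro: exI[of _ 0])

text \<open>Cauchy--Schwarz in the form \<open>2 \<bar>W\<bar> \<le> W\<^sup>2 / c + c\<close> with \<open>c = n sqrt n\<close>.\<close>

lemma integral_abs_W_kernel_le:
  "integral {0..pi} (\<lambda>t. \<bar>W_kernel n t\<bar>) \<le> 5 * (real n * sqrt (real n))"
proof (cases "n = 0")
  case False
  define c where "c = real n * sqrt (real n)"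
  have c: "c > 0" using False by (simp add: c_def)
  have c2: "c * c = real n ^ 3"
    by (simp add: c_def power3_eq_cube)
  obtain I where I: "((\<lambda>t. (W_kernel n t)\<^sup>2) has_integral I) {0..pi}" "I \<le> 2 * pi * real n ^ 3"
    using has_integral_W_kernel_square by blast
  have 1: "((\<lambda>t. \<bar>W_kernel n t\<bar>) has_integral integral {0..pi} (\<lambda>t. \<bar>W_kernel n t\<bar>)) {0..pi}"
    by (intro integrable_integral integrable_continuous_interval continuous_intros continuous_on_W_kernel)
  have 2: "((\<lambda>t. ((W_kernel n t)\<^sup>2 / c + c) / 2) has_integral (I / c + c * (pi - 0)) / 2) {0..pi}"
    using has_integral_const_real[of c 0 pi]
    by (intro has_integral_divide has_integral_add I) (simp add: mult.commute)
  have "integral {0..pi} (\<lambda>t. \<bar>W_kernel n t\<bar>) \<le> (I / c + c * (pi - 0)) / 2"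
  proof (rule has_integral_le[OF 1 2])
    fix t
    have "0 \<le> (\<bar>W_kernel n t\<bar> - c)\<^sup>2 / c" using c by simp
    also have "\<dots> = (W_kernel n t)\<^sup>2 / c + c - 2 * \<bar>W_kernel n t\<bar>"
      using c by (simp add: power2_eq_square field_simps)
    finally show "\<bar>W_kernel n t\<bar> \<le> ((W_kernel n t)\<^sup>2 / c + c) / 2" by simp
  qed
  also have "\<dots> \<le> (2 * pi * c + c * pi) / 2"
  proof -
    have "I / c \<le> (2 * pi * (c * c)) / c"
      unfolding c2 using c I(2) by (intro divide_right_mono) auto
    then have "I / c \<le> 2 * pi * c" using c by simp
    then show ?thesis by (intro divide_right_mono add_mono) auto
  qed
  \<comment> \<open>The two halves of the bound contribute 2 pi and pi; half of 3 pi is below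
    5.\<close>
  also have "\<dots> = (3 / 2 * pi) * c" by simp
  also have "\<dots> \<le> 5 * c"
    using pi_less_4 c pi_approx by (intro mult_right_mono) auto
  finally show ?thesis by (simp add: c_def)
qed simp

section \<open>Integration by parts for the moments\<close>

definition osc_moment :: "nat \<Rightarrow> real \<Rightarrow> complex" where
  "osc_moment m \<omega> = integral {-1..1} (\<lambda>x. cheb m x * exp (\<i> * of_real (\<omega> * x)))"

text \<open>What remains of \<open>osc_moment\<close> after one integration by parts: the factor
  cos(m t) has been differentiated, and its factor -m is split off.\<close>

definition osc_sine :: "nat \<Rightarrow> real \<Rightarrow> complex" where
  "osc_sine m \<omega> = integral {0..pi} (\<lambda>t. of_real (sin (real m * t)) * exp (\<i> * of_real (\<omega> * cos t)))"

lemma osc_moment_eq: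
  "osc_moment m \<omega> = integral {0..pi} (\<lambda>t. of_real (sin t * cos (real m * t)) * exp (\<i> * of_real (\<omega> * cos t)))"
proof -
  let ?f = "\<lambda>x. cheb m x * exp (\<i> * of_real (\<omega> * x))"
  have "((\<lambda>t. - sin t *\<^sub>R ?f (cos t)) has_integral (integral {cos 0..cos pi} ?f - integral {cos pi..cos 0} ?f)) {0..pi}"
  proof (rule has_integral_substitution_general[of "{}"])
    show "continuous_on {-1..1} ?f" by (intro continuous_intros continuous_on_cheb)
  qed (auto intro!: continuous_intros derivative_eq_intros)
  then have "((\<lambda>t. - (- sin t *\<^sub>R ?f (cos t))) has_integral osc_moment m \<omega>) {0..pi}"
    by (subst has_integral_neg_iff) (simp add: osc_moment_def)
  then have "((\<lambda>t. of_real (sin t * cos (real m * t)) * exp (\<i> * of_real (\<omega> * cos t))) has_integral osc_moment m \<omega>) {0..pi}"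
    by (rule has_integral_eq[rotated]) (simp add: cheb_cos scaleR_conv_of_real)
  then show ?thesis by (simp add: integral_unique)
qed

text \<open>The derivative of exp(i \<omega> cos t) is -i \<omega> sin t times itself, so a factor
  sin t in the amplitude is worth one power of 1 / \<omega>. Applied with u = cos(m t) and with u =
  \<open>V_kernel m\<close>.\<close>

lemma integral_by_parts_exp_cos:
  fixes u u' :: "real \<Rightarrow> real"
  assumes "\<And>t. t \<in> {0..pi} \<Longrightarrow> (u has_real_derivative u' t) (at t within {0..pi})" "continuous_on {0..pi} u'"
  shows "\<i> * of_real \<omega> * integral {0..pi} (\<lambda>t. of_real (sin t * u t) * exp (\<i> * of_real (\<omega> * cos t))) =
    integral {0..pi} (\<lambda>t. of_real (u' t) * exp (\<i> * of_real (\<omega> * cos t))) -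
    (of_real (u pi) * exp (\<i> * of_real (- \<omega>)) - of_real (u 0) * exp (\<i> * of_real \<omega>))"
proof -
  let ?e = "\<lambda>t::real. exp (\<i> * of_real (\<omega> * cos t))"
  have contu: "continuous_on {0..pi} u"
    using assms(1) by (meson DERIV_continuous_on)
  have "((\<lambda>t. of_real (u' t) * ?e t - \<i> * of_real \<omega> * (of_real (sin t * u t) * ?e t)) has_integral
      (of_real (u pi) * ?e pi - of_real (u 0) * ?e 0)) {0..pi}"
  proof (rule fundamental_theorem_of_calculus)
    fix t assume t: "t \<in> {0..pi}"
    have 1: "((\<lambda>t. complex_of_real (u t)) has_vector_derivative of_real (u' t)) (at t within {0..pi})"
      using assms(1)[OF t] unfolding has_real_derivative_iff_has_vector_derivative
      by (rule bounded_linear.has_vector_derivative[OF bounded_linear_of_real])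
    have "((\<lambda>z. exp (\<i> * (of_real \<omega> * cos z))) has_field_derivative
       - (\<i> * of_real \<omega> * sin (of_real t) * exp (\<i> * (of_real \<omega> * cos (of_real t))))) (at (of_real t))"
      by (auto intro!: derivative_eq_intros)
    from has_vector_derivative_real_field[OF this]
    have 2: "(?e has_vector_derivative - (\<i> * of_real \<omega> * of_real (sin t) * ?e t)) (at t within {0..pi})"
      by (simp add: o_def cos_of_real sin_of_real)
    show "((\<lambda>t. of_real (u t) * ?e t) has_vector_derivative
        of_real (u' t) * ?e t - \<i> * of_real \<omega> * (of_real (sin t * u t) * ?e t)) (at t within {0..pi})"
      using has_vector_derivative_mult[OF 1 2] by (simp add: algebra_simps)
  qed simp
  moreover have "((\<lambda>t. of_real (u' t) * ?e t - \<i> * of_real \<omega> * (of_real (sin t * u t) * ?e t)) has_integral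
     integral {0..pi} (\<lambda>t. of_real (u' t) * ?e t) - \<i> * of_real \<omega> * integral {0..pi} (\<lambda>t. of_real (sin t * u t) * ?e t)) {0..pi}"
    by (intro has_integral_diff has_integral_mult_right integrable_integral integrable_continuous_interval
        continuous_intros assms contu)
  ultimately have "of_real (u pi) * ?e pi - of_real (u 0) * ?e 0 = 
     integral {0..pi} (\<lambda>t. of_real (u' t) * ?e t) - \<i> * of_real \<omega> * integral {0..pi} (\<lambda>t. of_real (sin t * u t) * ?e t)"
    by (rule has_integral_unique)
  then show ?thesis by (simp add: algebra_simps)
qed

lemma norm_osc_sine_le: "norm (osc_sine m \<omega>) \<le> pi"
proof -
  have "norm (osc_sine m \<omega>) \<le> 1 * (pi - 0)"
    unfolding osc_sine_def
    by (rule norm_integral_le) (auto intro!: continuous_intros simp: norm_mult)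
  then show ?thesis by simp
qed

lemma osc_moment_by_parts:
  "\<i> * of_real \<omega> * osc_moment m \<omega> = - (of_nat m * osc_sine m \<omega>) -
    ((- 1) ^ m * exp (\<i> * of_real (- \<omega>)) - exp (\<i> * of_real \<omega>))"
proof -
  have "\<i> * of_real \<omega> * osc_moment m \<omega> =
      integral {0..pi} (\<lambda>t. of_real (- real m * sin (real m * t)) * exp (\<i> * of_real (\<omega> * cos t))) -
      (of_real (cos (real m * pi)) * exp (\<i> * of_real (- \<omega>)) - of_real (cos (real m * 0)) * exp (\<i> * of_real \<omega>))"
    unfolding osc_moment_eq
    by (rule integral_by_parts_exp_cos) (auto intro!: derivative_eq_intros continuous_intros)
  also have "integral {0..pi} (\<lambda>t. of_real (- real m * sin (real m * t)) * exp (\<i> * of_real (\<omega> * cos t)))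
     = - (of_nat m * osc_sine m \<omega>)"
    unfolding osc_sine_def by (simp add: mult.assoc)
  finally show ?thesis by (simp add: cos_npi)
qed

text \<open>Writing sin(m t) as sin t times \<open>V_kernel m t\<close> provides the factor sin t
  for another integration by parts. The two boundary values are at most m each, and the remaining
  integrand is \<open>W_kernel m\<close>.\<close>

lemma norm_osc_sine_le':
  "\<bar>\<omega>\<bar> * norm (osc_sine m \<omega>) \<le> 2 * real m + 5 * (real m * sqrt (real m))"
proof -
  have eq: "\<i> * of_real \<omega> * osc_sine m \<omega> =
      integral {0..pi} (\<lambda>t. of_real (W_kernel m t) * exp (\<i> * of_real (\<omega> * cos t))) -
      (of_real (V_kernel m pi) * exp (\<i> * of_real (- \<omega>)) - of_real (V_kernel m 0) * exp (\<i> * of_real \<omega>))"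
    unfolding osc_sine_def sin_mult_V_kernel[symmetric]
    by (rule integral_by_parts_exp_cos[OF V_kernel_deriv continuous_on_W_kernel])
  have W: "norm (integral {0..pi} (\<lambda>t. of_real (W_kernel m t) * exp (\<i> * of_real (\<omega> * cos t)))) \<le> 5 * (real m * sqrt (real m))"
  proof (rule order_trans[OF integral_norm_bound_integral integral_abs_W_kernel_le])
    show "(\<lambda>t. complex_of_real (W_kernel m t) * exp (\<i> * of_real (\<omega> * cos t))) integrable_on {0..pi}"
      by (intro integrable_continuous_interval continuous_intros continuous_on_W_kernel)
    show "(\<lambda>t. \<bar>W_kernel m t\<bar>) integrable_on {0..pi}"
      by (intro integrable_continuous_interval continuous_intros continuous_on_W_kernel)
  qed (simp add: norm_mult)
  have V: "norm (complex_of_real (V_kernel m t) * exp (\<i> * of_real s)) \<le> real m" for t s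
    using abs_V_kernel_le[of m t] by (simp add: norm_mult)
  have "\<bar>\<omega>\<bar> * norm (osc_sine m \<omega>) = norm (\<i> * of_real \<omega> * osc_sine m \<omega>)"
    by (simp add: norm_mult)
  also have "\<dots> \<le> 5 * (real m * sqrt (real m)) + (real m + real m)"
    unfolding eq by (intro order_trans[OF norm_triangle_ineq4] add_mono W V)
  finally show ?thesis by simp
qed

lemma norm_osc_moment_le: "norm (osc_moment m \<omega>) \<le> 2"
proof -
  have "norm (osc_moment m \<omega>) \<le> 1 * (1 - (-1))"
    unfolding osc_moment_def
    by (rule norm_integral_le) (auto intro!: continuous_intros continuous_on_cheb simp: norm_mult norm_cheb_le)
  then show ?thesis by simp
qed

lemma norm_osc_moment_le':
  "\<bar>\<omega>\<bar> * norm (osc_moment m \<omega>) \<le> 4 * (real m + 1)"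
proof -
  have "\<bar>\<omega>\<bar> * norm (osc_moment m \<omega>) = norm (\<i> * of_real \<omega> * osc_moment m \<omega>)"
    by (simp add: norm_mult)
  also have "\<dots> \<le> real m * pi + (1 + 1)"
    unfolding osc_moment_by_parts
    by (intro order_trans[OF norm_triangle_ineq4] add_mono) (auto simp: norm_mult norm_power norm_osc_sine_le mult_left_mono)
  also have "\<dots> \<le> 4 * (real m + 1)"
    using mult_left_mono[of pi 4 "real m"] pi_less_4 by simp
  finally show ?thesis .
qed

text \<open>Interpolation errors at levels \<open>l \<ge> 3\<close> vanish at both endpoints, so the boundary terms of the
  first integration by parts cancel and a second one gains another power of \<open>\<omega>\<close>.\<close>

lemma norm_osc_moment_diff_le:
  assumes "even m1 \<longleftrightarrow> even m2" "m1 \<le> m" "m2 \<le> m"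
  shows "\<omega>\<^sup>2 * norm (osc_moment m1 \<omega> - osc_moment m2 \<omega>) \<le> 14 * ((real m + 1)\<^sup>2 * sqrt (real m + 1))"
proof -
  have par: "(- 1 :: complex) ^ m1 = (- 1) ^ m2"
    using assms(1) by (cases "even m1") auto
  \<comment> \<open>For n at least 1 the bound 2 n + 5 n sqrt n is at most 7 n sqrt n; the extra
    factor n comes from the first integration by parts.\<close>
  have s: "\<bar>\<omega>\<bar> * (real n * norm (osc_sine n \<omega>)) \<le> 7 * ((real m + 1)\<^sup>2 * sqrt (real m + 1))" if "n \<le> m" for n
  proof (cases "n = 0")
    case False
    then have "1 \<le> sqrt (real n)" by simp
    then have "real n * 1 \<le> real n * sqrt (real n)" by (intro mult_left_mono) auto
    then have "\<bar>\<omega>\<bar> * norm (osc_sine n \<omega>) \<le> 7 * (real n * sqrt (real n))"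
      using norm_osc_sine_le'[of \<omega> n] by simp
    then have "real n * (\<bar>\<omega>\<bar> * norm (osc_sine n \<omega>)) \<le> real n * (7 * (real n * sqrt (real n)))"
      by (intro mult_left_mono) auto
    also have "\<dots> = 7 * ((real n)\<^sup>2 * sqrt (real n))" by (simp add: power2_eq_square)
    also have "\<dots> \<le> 7 * ((real m + 1)\<^sup>2 * sqrt (real m + 1))"
      using that by (intro mult_left_mono mult_mono power_mono) auto
    finally show ?thesis by (simp add: mult_ac)
  qed simp
  have "\<omega>\<^sup>2 * norm (osc_moment m1 \<omega> - osc_moment m2 \<omega>) =
      \<bar>\<omega>\<bar> * norm (\<i> * of_real \<omega> * osc_moment m1 \<omega> - \<i> * of_real \<omega> * osc_moment m2 \<omega>)"
  proof -
    have "norm (\<i> * of_real \<omega> * osc_moment m1 \<omega> - \<i> * of_real \<omega> * osc_moment m2 \<omega>)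
      = \<bar>\<omega>\<bar> * norm (osc_moment m1 \<omega> - osc_moment m2 \<omega>)"
      unfolding right_diff_distrib[symmetric] by (simp add: norm_mult)
    then show ?thesis by (simp add: power2_eq_square)
  qed
  also have "\<i> * of_real \<omega> * osc_moment m1 \<omega> - \<i> * of_real \<omega> * osc_moment m2 \<omega> =
     of_nat m2 * osc_sine m2 \<omega> - of_nat m1 * osc_sine m1 \<omega>"
    unfolding osc_moment_by_parts par by simp
  also have "\<bar>\<omega>\<bar> * norm (of_nat m2 * osc_sine m2 \<omega> - of_nat m1 * osc_sine m1 \<omega>)
     \<le> \<bar>\<omega>\<bar> * (real m2 * norm (osc_sine m2 \<omega>) + real m1 * norm (osc_sine m1 \<omega>))"
    by (intro mult_left_mono order_trans[OF norm_triangle_ineq4]) (auto simp: norm_mult)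
  also have "\<dots> \<le> 14 * ((real m + 1)\<^sup>2 * sqrt (real m + 1))"
    using s[OF assms(2)] s[OF assms(3)] by (simp add: distrib_left)
  finally show ?thesis .
qed

definition osc_D :: "nat \<Rightarrow> real \<Rightarrow> (real \<Rightarrow> complex) \<Rightarrow> complex" where
  "osc_D l \<omega> g = integral {-1..1} (\<lambda>x. D_op l g x * exp (\<i> * of_real (\<omega> * x)))"

lemma osc_D_cheb_eq_0:
  assumes "2 \<le> l" "m < 2 ^ (l - 2)"
  shows "osc_D l \<omega> (cheb m) = 0"
proof -
  have "osc_D l \<omega> (cheb m) = integral {-1..1} (\<lambda>x::real. 0 :: complex)"
    unfolding osc_D_def by (rule integral_cong) (simp add: D_op_cheb_eq_0[OF assms])
  then show ?thesis by simp
qed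

lemma has_integral_osc_moment:
  "((\<lambda>x. cheb m x * exp (\<i> * of_real (\<omega> * x))) has_integral osc_moment m \<omega>) {-1..1}"
  unfolding osc_moment_def
  by (intro integrable_integral integrable_continuous_interval continuous_intros continuous_on_cheb)

text \<open>Here \<alpha> stands for k |a_j| and \<omega> for k times the fast part of a_j. Either
  they agree in modulus and integration by parts applies, or \<alpha> < 1 and the trivial bound 2
  for a moment is already below 4 (m + 1) / \<alpha>.\<close>

lemma norm_osc_D_cheb_le:
  assumes \<alpha>: "0 < \<alpha>" "\<bar>\<omega>\<bar> = \<alpha> \<or> \<alpha> < 1"
  shows "norm (osc_D l \<omega> (cheb m)) \<le> 8 * (real m + 1) / \<alpha>"
proof -
  obtain m1 c1 where 1: "m1 \<le> m" "norm c1 \<le> 1" "\<And>x. x \<in> {-1..1} \<Longrightarrow> Q_op l (cheb m) x = c1 * cheb m1 x"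
    using Q_op_cheb'[where l = l and m = m] by metis
  obtain m2 c2 where 2: "m2 \<le> m" "norm c2 \<le> 1" "\<And>x. x \<in> {-1..1} \<Longrightarrow> Q_op (l - 1) (cheb m) x = c2 * cheb m2 x"
    using Q_op_cheb'[where l = "l - 1" and m = m] by metis
  have "((\<lambda>x. c1 * (cheb m1 x * exp (\<i> * of_real (\<omega> * x))) - c2 * (cheb m2 x * exp (\<i> * of_real (\<omega> * x))))
     has_integral (c1 * osc_moment m1 \<omega> - c2 * osc_moment m2 \<omega>)) {-1..1}"
    by (intro has_integral_diff has_integral_mult_right has_integral_osc_moment)
  then have "((\<lambda>x. D_op l (cheb m) x * exp (\<i> * of_real (\<omega> * x)))
     has_integral (c1 * osc_moment m1 \<omega> - c2 * osc_moment m2 \<omega>)) {-1..1}"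
    by (rule has_integral_eq[rotated]) (simp add: D_op_def 1 2(3)[unfolded One_nat_def] algebra_simps)
  then have eq: "osc_D l \<omega> (cheb m) = c1 * osc_moment m1 \<omega> - c2 * osc_moment m2 \<omega>"
    unfolding osc_D_def by (rule integral_unique)
  have J: "norm (c * osc_moment n \<omega>) \<le> 4 * (real m + 1) / \<alpha>" if "n \<le> m" "norm c \<le> 1" for n c
  proof -
    have "\<alpha> * norm (osc_moment n \<omega>) \<le> 4 * (real m + 1)"
    proof (cases "\<bar>\<omega>\<bar> = \<alpha>")
      case True
      then show ?thesis using norm_osc_moment_le'[of \<omega> n] that by simp
    next
      case False
      then have "\<alpha> * norm (osc_moment n \<omega>) \<le> 1 * 2"
        using \<alpha> norm_osc_moment_le[of n \<omega>] by (intro mult_mono) auto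
      then show ?thesis by simp
    qed
    then have "norm (osc_moment n \<omega>) \<le> 4 * (real m + 1) / \<alpha>"
      using \<alpha>(1) by (simp add: pos_le_divide_eq mult.commute)
    then show ?thesis
      using mult_mono[OF that(2), of "norm (osc_moment n \<omega>)" "4 * (real m + 1) / \<alpha>"] by (simp add: norm_mult)
  qed
  have "norm (osc_D l \<omega> (cheb m)) \<le> 4 * (real m + 1) / \<alpha> + 4 * (real m + 1) / \<alpha>"
    unfolding eq by (intro order_trans[OF norm_triangle_ineq4] add_mono J 1 2)
  then show ?thesis by simp
qed

lemma norm_osc_D_cheb_le':
  assumes \<alpha>: "0 < \<alpha>" "\<bar>\<omega>\<bar> = \<alpha> \<or> \<alpha> < 1" and l: "3 \<le> l"
  shows "norm (osc_D l \<omega> (cheb m)) \<le> 14 * ((real m + 1)\<^sup>2 * sqrt (real m + 1)) / \<alpha>\<^sup>2"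
proof -
  obtain m1 m2 where m: "m1 \<le> m" "m2 \<le> m" "even m1 \<longleftrightarrow> even m2"
    "\<And>x. x \<in> {-1..1} \<Longrightarrow> D_op l (cheb m) x = cheb m1 x - cheb m2 x"
    using D_op_cheb[OF l, of m] by metis
  have "((\<lambda>x. cheb m1 x * exp (\<i> * of_real (\<omega> * x)) - cheb m2 x * exp (\<i> * of_real (\<omega> * x)))
     has_integral (osc_moment m1 \<omega> - osc_moment m2 \<omega>)) {-1..1}"
    by (intro has_integral_diff has_integral_osc_moment)
  then have "((\<lambda>x. D_op l (cheb m) x * exp (\<i> * of_real (\<omega> * x)))
     has_integral (osc_moment m1 \<omega> - osc_moment m2 \<omega>)) {-1..1}"
    by (rule has_integral_eq[rotated]) (simp add: m algebra_simps)
  then have eq: "osc_D l \<omega> (cheb m) = osc_moment m1 \<omega> - osc_moment m2 \<omega>"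
    unfolding osc_D_def by (rule integral_unique)
  have "\<alpha>\<^sup>2 * norm (osc_D l \<omega> (cheb m)) \<le> 14 * ((real m + 1)\<^sup>2 * sqrt (real m + 1))"
  proof (cases "\<bar>\<omega>\<bar> = \<alpha>")
    case True
    then have "\<omega>\<^sup>2 = \<alpha>\<^sup>2" by (metis power2_abs)
    then show ?thesis using norm_osc_moment_diff_le[OF m(3,1,2), of \<omega>] by (simp add: eq)
  next
    \<comment> \<open>Without oscillation the trivial bound 4 is enough, because \<alpha> <
      1.\<close>
    case False
    have "norm (osc_D l \<omega> (cheb m)) \<le> 2 + 2"
      unfolding eq by (intro order_trans[OF norm_triangle_ineq4] add_mono norm_osc_moment_le)
    moreover have "\<alpha>\<^sup>2 \<le> 1" using \<alpha> False by (simp add: power_le_one)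
    ultimately have "\<alpha>\<^sup>2 * norm (osc_D l \<omega> (cheb m)) \<le> 1 * 4"
      by (intro mult_mono) auto
    also have "\<dots> \<le> 14 * (1 * 1)" by simp
    also have "\<dots> \<le> 14 * ((real m + 1)\<^sup>2 * sqrt (real m + 1))"
      by (intro mult_left_mono mult_mono) (auto simp: one_le_power)
    finally show ?thesis .
  qed
  then show ?thesis
    using \<alpha>(1) by (simp add: pos_le_divide_eq mult.commute)
qed

section \<open>Functionals given by point values\<close>

text \<open>Extended by zero off the grid, so that the operators of all levels up to L can be summed
  over one common node set.\<close>

definition Q_weight :: "nat \<Rightarrow> real \<Rightarrow> real \<Rightarrow> complex" where
  "Q_weight l z x = (if l = 0 \<or> z \<notin> grid l then 0 else if l = 1 then 1 else poly (lagrange l z) (of_real x))"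

definition D_weight :: "nat \<Rightarrow> real \<Rightarrow> real \<Rightarrow> complex" where
  "D_weight l z x = Q_weight l z x - Q_weight (l - 1) z x"

definition nodes :: "nat \<Rightarrow> real set" where
  "nodes L = (\<Union>l\<le>L. grid l)"

lemma finite_nodes: "finite (nodes L)"
  by (simp add: nodes_def finite_grid)

lemma nodes_subset: "nodes L \<subseteq> {-1..1}"
  using grid_subset by (auto simp: nodes_def)

lemma grid_subset_nodes: "l \<le> L \<Longrightarrow> grid l \<subseteq> nodes L"
  by (auto simp: nodes_def)

lemma Q_op_eq_sum:
  assumes "finite S" "grid l \<subseteq> S"
  shows "Q_op l g x = (\<Sum>z\<in>S. Q_weight l z x * g z)"
proof -
  have "(\<Sum>z\<in>S. Q_weight l z x * g z) = (\<Sum>z\<in>grid l. Q_weight l z x * g z)"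
    by (rule sum.mono_neutral_right) (use assms in \<open>auto simp: Q_weight_def\<close>)
  also have "\<dots> = Q_op l g x"
  proof -
    consider "l = 0" | "l = 1" | "2 \<le> l" by linarith
    then show ?thesis
    proof cases
      case 3
      then have "(\<Sum>z\<in>grid l. Q_weight l z x * g z) = (\<Sum>z\<in>grid l. g z * poly (lagrange l z) (of_real x))"
        by (intro sum.cong) (auto simp: Q_weight_def)
      with 3 show ?thesis by (simp add: Q_op_def interp_poly_lagrange poly_sum)
    qed (auto simp: Q_weight_def Q_op_def grid_def)
  qed
  finally show ?thesis ..
qed

lemma D_op_eq_sum:
  assumes "finite S" "grid l \<subseteq> S" "grid (l - 1) \<subseteq> S"
  shows "D_op l g x = (\<Sum>z\<in>S. D_weight l z x * g z)"
  unfolding D_op_def D_weight_def Q_op_eq_sum[OF assms(1,2)] Q_op_eq_sum[OF assms(1,3)]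
  by (simp only: left_diff_distrib sum_subtractf)

lemma sum_D_weight: "(\<Sum>l=1..L. D_weight l z x) = Q_weight L z x"
proof (induction L)
  case 0
  then show ?case by (simp add: Q_weight_def)
next
  case (Suc L)
  then show ?case by (simp add: D_weight_def)
qed

lemma continuous_on_Q_weight: "continuous_on A (Q_weight l z)"
proof -
  have "continuous_on A (\<lambda>x. poly (lagrange l z) (complex_of_real x))"
    by (intro continuous_intros)
  then show ?thesis
    by (cases "l = 0 \<or> z \<notin> grid l"; cases "l = 1") (auto simp: Q_weight_def cong: continuous_on_cong)
qed

lemma continuous_on_D_weight: "continuous_on A (D_weight l z)"
  unfolding D_weight_def by (intro continuous_intros continuous_on_Q_weight)

definition osc_weight :: "nat \<Rightarrow> real \<Rightarrow> real \<Rightarrow> complex" where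
  "osc_weight l \<omega> z = integral {-1..1} (\<lambda>x. D_weight l z x * exp (\<i> * of_real (\<omega> * x)))"

lemma osc_D_eq_sum:
  assumes "l \<le> L"
  shows "osc_D l \<omega> g = (\<Sum>z\<in>nodes L. osc_weight l \<omega> z * g z)"
proof -
  have "((\<lambda>x. \<Sum>z\<in>nodes L. D_weight l z x * exp (\<i> * of_real (\<omega> * x)) * g z) has_integral
      (\<Sum>z\<in>nodes L. osc_weight l \<omega> z * g z)) {-1..1}"
    unfolding osc_weight_def
    by (intro has_integral_sum finite_nodes has_integral_mult_left integrable_integral
        integrable_continuous_interval continuous_intros continuous_on_D_weight)
  moreover have "(\<Sum>z\<in>nodes L. D_weight l z x * exp (\<i> * of_real (\<omega> * x)) * g z) =
      D_op l g x * exp (\<i> * of_real (\<omega> * x))" for x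
  proof -
    have "D_op l g x = (\<Sum>z\<in>nodes L. D_weight l z x * g z)"
      using assms by (intro D_op_eq_sum finite_nodes grid_subset_nodes) auto
    then show ?thesis by (simp add: sum_distrib_left mult_ac)
  qed
  ultimately show ?thesis
    unfolding osc_D_def by (simp add: integral_unique)
qed

section \<open>Norms of point-value functionals on smooth functions\<close>

text \<open>A bound for the norm of the functional on C^q, tested on derivative towers. In all uses
  S is finite, so the functional passes through derivatives in the other variables and through
  pointwise convergent series.\<close>

definition functional_bound :: "nat \<Rightarrow> real set \<Rightarrow> (real \<Rightarrow> complex) \<Rightarrow> real \<Rightarrow> bool" where
  "functional_bound q S w B \<longleftrightarrow>
     (\<forall>g M. deriv_tower q g M \<longrightarrow> norm (\<Sum>z\<in>S. w z * g 0 z) \<le> B * M)"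

lemma functional_bound_mono:
  assumes "functional_bound q S w B" "B \<le> B'"
  shows "functional_bound q S w B'"
  unfolding functional_bound_def
proof (intro allI impI)
  fix g M assume g: "deriv_tower q g M"
  then have "norm (g 0 0) \<le> M" unfolding deriv_tower_def by auto
  then have "0 \<le> M" using norm_ge_zero order_trans by blast
  then have "B * M \<le> B' * M" using assms(2) by (rule mult_right_mono[rotated])
  moreover have "norm (\<Sum>z\<in>S. w z * g 0 z) \<le> B * M"
    using g assms(1) unfolding functional_bound_def by blast
  ultimately show "norm (\<Sum>z\<in>S. w z * g 0 z) \<le> B' * M" by linarith
qed

lemma summable_inverse_power_Suc: "2 \<le> q \<Longrightarrow> summable (\<lambda>m. 1 / (real m + 1) ^ q)"
  using inverse_power_summable[of q, where 'a = real] summable_Suc_iff[of "\<lambda>n. inverse (real n ^ q)"]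
  by (simp add: inverse_eq_divide add.commute)

definition tower_const :: "nat \<Rightarrow> real" where
  "tower_const q = pi * 4 ^ (q * (q + 1))"

lemma tower_const_pos: "0 < tower_const q"
  by (simp add: tower_const_def)

text \<open>Apply the functional termwise to the Chebyshev expansion of g times the phase. Values on
  the T_m are then required for the weights without phase, while the resulting bound holds for the
  weights with phase.\<close>

lemma functional_bound_of_cheb:
  assumes q: "2 \<le> q" and \<kappa>: "\<bar>\<kappa>\<bar> \<le> 1" and S: "finite S" "S \<subseteq> {-1..1}"
    and b: "\<And>m. norm (\<Sum>z\<in>S. w z * cheb m z) \<le> b m" and sb: "summable (\<lambda>m. b m / (real m + 1) ^ q)"
  shows "functional_bound q S (\<lambda>z. w z * exp (\<i> * of_real (\<kappa> * z)))
    (tower_const q * (\<Sum>m. b m / (real m + 1) ^ q))"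
  unfolding functional_bound_def
proof (intro allI impI)
  fix g M
  assume g: "deriv_tower q g M"
  define h where "h x = g 0 x * exp (\<i> * of_real (\<kappa> * x))" for x :: real
  let ?c = "\<lambda>m. cheb_weight m * cheb_coeff h m"
  let ?K = "tower_const q * M"
  have coeff: "norm (cheb_coeff h m) \<le> ?K * (1 / (real m + 1) ^ q)" for m
    using norm_cheb_coeff_phase_le[OF g \<kappa>, of m] by (simp add: h_def[abs_def] tower_const_def)
  have "continuous_on {-1..1} h"
    unfolding h_def by (intro continuous_intros deriv_tower_continuous[OF g]) auto
  then have exp: "(\<lambda>m. ?c m * cheb m x) sums h x" if "x \<in> {-1..1}" for x
    unfolding cheb_def
    by (rule chebyshev_expansion[OF _ coeff summable_mult[OF summable_inverse_power_Suc[OF q]] that])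
  have "(\<lambda>m. \<Sum>z\<in>S. w z * (?c m * cheb m z)) sums (\<Sum>z\<in>S. w z * h z)"
    by (intro sums_sum sums_mult exp) (use S in auto)
  then have s: "(\<lambda>m. ?c m * (\<Sum>z\<in>S. w z * cheb m z)) sums (\<Sum>z\<in>S. w z * h z)"
    by (simp add: sum_distrib_left mult_ac)
  have le: "norm (?c m * (\<Sum>z\<in>S. w z * cheb m z)) \<le> ?K * (b m / (real m + 1) ^ q)" for m
  proof -
    have "norm (cheb_weight m) \<le> 1" using pi_gt3 by (simp add: cheb_weight_def norm_divide)
    then have "norm (cheb_weight m) * norm (cheb_coeff h m) * norm (\<Sum>z\<in>S. w z * cheb m z)
        \<le> 1 * (?K * (1 / (real m + 1) ^ q)) * b m"
      using coeff[of m] b[of m] by (intro mult_mono) (auto intro: order_trans[OF norm_ge_zero])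
    then show ?thesis by (simp add: norm_mult)
  qed
  have "norm (\<Sum>m. ?c m * (\<Sum>z\<in>S. w z * cheb m z)) \<le> (\<Sum>m. ?K * (b m / (real m + 1) ^ q))"
    by (rule norm_suminf_le[OF le summable_mult[OF sb]])
  also have "\<dots> = ?K * (\<Sum>m. b m / (real m + 1) ^ q)"
    by (rule suminf_mult[OF sb])
  finally show "norm (\<Sum>z\<in>S. w z * exp (\<i> * of_real (\<kappa> * z)) * g 0 z) \<le> tower_const q * (\<Sum>m. b m / (real m + 1) ^ q) * M"
    using sums_unique[OF s] by (simp add: h_def mult_ac)
qed

lemma summable_powr_Suc: "summable (\<lambda>m. (real m + 1) powr (- 5 / 4))"
proof -
  have "summable (\<lambda>m. real m powr (- 5 / 4))"
    by (subst summable_real_powr_iff) auto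
  then show ?thesis
    by (subst (asm) summable_Suc_iff[symmetric]) (simp add: add.commute)
qed

text \<open>The factors are the coefficient bound, the 14 of the moment estimate, and
  \<open>4 powr (real p - 3 / 4)\<close> from the threshold m + 1 = 2^l / 4 below which the terms
  vanish.\<close>

definition decay_const :: "nat \<Rightarrow> real" where
  "decay_const p = tower_const (p + 3) * (14 * 4 powr (real p - 3 / 4) * (\<Sum>m. (real m + 1) powr (- 5 / 4)))"

lemma decay_const_nonneg: "0 \<le> decay_const p"
  unfolding decay_const_def using tower_const_pos[of "p + 3"]
  by (intro mult_nonneg_nonneg suminf_nonneg summable_powr_Suc) auto

text \<open>A stands for \<alpha> or for its square, so that both oscillatory estimates share this
  summation over m.\<close>

lemma functional_bound_osc_aux:
  assumes p: "1 \<le> p" and \<kappa>: "\<bar>\<kappa>\<bar> \<le> 1" and l: "1 \<le> l" "l \<le> L" and A: "0 < A"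
    and b: "\<And>m. norm (osc_D l \<omega> (cheb m)) \<le> 14 * ((real m + 1)\<^sup>2 * sqrt (real m + 1)) / A"
  shows "functional_bound (p + 3) (nodes L) (\<lambda>z. osc_weight l \<omega> z * exp (\<i> * of_real (\<kappa> * z)))
    (decay_const p * 2 powr (- (real p - 3 / 4) * real l) / A)"
proof -
  define s where "s = real p - 3 / 4"
  have s: "0 < s" using p by (simp add: s_def)
  let ?q = "p + 3"
  define c where "c m = norm (osc_D l \<omega> (cheb m))" for m
  have le: "c m / (real m + 1) ^ ?q \<le> 14 / A * 4 powr s * 2 powr (- s * real l) * (real m + 1) powr (- 5 / 4)" for m
  proof (cases "2 ^ l \<le> 4 * (real m + 1)")
    case False
    have "c m = 0"
    proof -
      \<comment> \<open>At l = 1 the inequality 2 <= 4 (m + 1) always holds, so the present case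
        lies in the range of \<open>osc_D_cheb_eq_0\<close>.\<close>
      have l2: "2 \<le> l"
      proof (rule ccontr)
        assume "\<not> 2 \<le> l"
        then have "l = 1" using l by simp
        with False show False by simp
      qed
      then have "l = 2 + (l - 2)" by simp
      then have "(2::real) ^ l = 2 ^ (2 + (l - 2))" by (rule arg_cong)
      then have "(2::real) ^ l = 4 * 2 ^ (l - 2)" unfolding power_add by simp
      with False have "real m + 1 < 2 ^ (l - 2)" by simp
      then have "real m < real (2 ^ (l - 2))" unfolding of_nat_power of_nat_numeral by linarith
      then have "m < 2 ^ (l - 2)" by (simp only: of_nat_less_iff)
      then show ?thesis unfolding c_def by (simp add: osc_D_cheb_eq_0[OF l2])
    qed
    then show ?thesis using A by simp
  next
    case True
    let ?x = "real m + 1"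
    have x: "0 < ?x" by simp
    have "c m / ?x ^ ?q \<le> 14 * (?x\<^sup>2 * sqrt ?x) / A / ?x ^ ?q"
      unfolding c_def by (intro divide_right_mono b) auto
    also have "\<dots> = 14 / A * (?x\<^sup>2 * sqrt ?x / ?x ^ ?q)" by simp
    also have "?x\<^sup>2 * sqrt ?x / ?x ^ ?q = ?x powr (- 5 / 4) * ?x powr (- s)"
    proof -
      have 1: "?x\<^sup>2 = ?x powr 2" "sqrt ?x = ?x powr (1 / 2)" "?x ^ ?q = ?x powr real ?q"
        using powr_realpow[OF x, of 2] powr_realpow[OF x, of ?q] powr_half_sqrt[of ?x] by simp_all
      have "?x\<^sup>2 * sqrt ?x / ?x ^ ?q = ?x powr 2 * ?x powr (1 / 2) / ?x powr real ?q"
        unfolding 1 ..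
      also have "\<dots> = ?x powr (2 + 1 / 2 - real ?q)" by (simp only: powr_add powr_diff)
      also have "2 + 1 / 2 - real ?q = - 5 / 4 + - s" by (simp add: s_def)
      finally show ?thesis by (simp only: powr_add)
    qed
    finally have 1: "c m / ?x ^ ?q \<le> 14 / A * (?x powr (- 5 / 4) * ?x powr (- s))" .
    have 2: "?x powr (- s) \<le> 4 powr s * 2 powr (- s * real l)"
    proof -
      have "?x powr (- s) \<le> (2 ^ l / 4) powr (- s)"
        using True s by (intro powr_mono2') auto
      also have "\<dots> = 4 powr s * 2 powr (- s * real l)"
      proof -
        have "(2 ^ l / 4 :: real) powr (- s) = (2 powr real l) powr (- s) / 4 powr (- s)"
          by (simp add: powr_divide powr_realpow)
        also have "\<dots> = 2 powr (- s * real l) * 4 powr s"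
          by (simp add: powr_powr powr_minus_divide mult.commute)
        finally show ?thesis by (simp only: mult.commute)
      qed
      finally show ?thesis .
    qed
    have "14 / A * (?x powr (- 5 / 4) * ?x powr (- s)) \<le> 14 / A * (?x powr (- 5 / 4) * (4 powr s * 2 powr (- s * real l)))"
      using A 2 by (intro mult_left_mono) auto
    with 1 have "c m / ?x ^ ?q \<le> 14 / A * (?x powr (- 5 / 4) * (4 powr s * 2 powr (- s * real l)))"
      by linarith
    then show ?thesis by (simp only: mult_ac)
  qed
  have sum': "summable (\<lambda>m. 14 / A * 4 powr s * 2 powr (- s * real l) * (real m + 1) powr (- 5 / 4))"
    by (intro summable_mult summable_powr_Suc)
  have sum: "summable (\<lambda>m. c m / (real m + 1) ^ ?q)"
    by (rule summable_comparison_test'[OF sum', of 0]) (use le in \<open>auto simp: c_def\<close>)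
  have "functional_bound ?q (nodes L) (\<lambda>z. osc_weight l \<omega> z * exp (\<i> * of_real (\<kappa> * z)))
    (tower_const ?q * (\<Sum>m. c m / (real m + 1) ^ ?q))"
    by (rule functional_bound_of_cheb[OF _ \<kappa> finite_nodes nodes_subset _ sum])
      (auto simp: c_def osc_D_eq_sum[OF l(2)])
  then show ?thesis
  proof (rule functional_bound_mono)
    have "(\<Sum>m. c m / (real m + 1) ^ ?q) \<le> (\<Sum>m. 14 / A * 4 powr s * 2 powr (- s * real l) * (real m + 1) powr (- 5 / 4))"
      by (rule suminf_le[OF le sum sum'])
    also have "\<dots> = 14 / A * 4 powr s * 2 powr (- s * real l) * (\<Sum>m. (real m + 1) powr (- 5 / 4))"
      by (rule suminf_mult[OF summable_powr_Suc])
    finally have "tower_const ?q * (\<Sum>m. c m / (real m + 1) ^ ?q) \<le>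
        tower_const ?q * (14 / A * 4 powr s * 2 powr (- s * real l) * (\<Sum>m. (real m + 1) powr (- 5 / 4)))"
      using tower_const_pos[of ?q] by (intro mult_left_mono) auto
    also have "\<dots> = decay_const p * 2 powr (- (real p - 3 / 4) * real l) / A"
      by (simp add: decay_const_def s_def)
    finally show "tower_const ?q * (\<Sum>m. c m / (real m + 1) ^ ?q) \<le>
        decay_const p * 2 powr (- (real p - 3 / 4) * real l) / A" .
  qed
qed

lemma functional_bound_osc:
  assumes p: "1 \<le> p" and \<kappa>: "\<bar>\<kappa>\<bar> \<le> 1" and l: "1 \<le> l" "l \<le> L" and \<alpha>: "0 < \<alpha>" "\<bar>\<omega>\<bar> = \<alpha> \<or> \<alpha> < 1"
  shows "functional_bound (p + 3) (nodes L) (\<lambda>z. osc_weight l \<omega> z * exp (\<i> * of_real (\<kappa> * z)))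
    (decay_const p * 2 powr (- (real p - 3 / 4) * real l) / \<alpha>)"
proof (rule functional_bound_osc_aux[OF p \<kappa> l \<alpha>(1)])
  fix m
  \<comment> \<open>The linear growth is weakened to the power 5/2 so that the same summation
    applies.\<close>
  have "(real m + 1) * 1 * 1 \<le> (real m + 1) * (real m + 1) * sqrt (real m + 1)"
    by (intro mult_mono) auto
  then have "real m + 1 \<le> (real m + 1)\<^sup>2 * sqrt (real m + 1)"
    unfolding power2_eq_square by (simp only: mult_1_right)
  moreover have "8 * x \<le> 14 * y" if "x \<le> y" "0 \<le> x" for x y :: real
    using that by linarith
  ultimately have "8 * (real m + 1) \<le> 14 * ((real m + 1)\<^sup>2 * sqrt (real m + 1))"
    by simp
  then have "8 * (real m + 1) / \<alpha> \<le> 14 * ((real m + 1)\<^sup>2 * sqrt (real m + 1)) / \<alpha>"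
    using \<alpha>(1) by (intro divide_right_mono) auto
  then show "norm (osc_D l \<omega> (cheb m)) \<le> 14 * ((real m + 1)\<^sup>2 * sqrt (real m + 1)) / \<alpha>"
    using norm_osc_D_cheb_le[OF \<alpha>, of l m] by linarith
qed

lemma functional_bound_osc':
  assumes p: "1 \<le> p" and \<kappa>: "\<bar>\<kappa>\<bar> \<le> 1" and l: "3 \<le> l" "l \<le> L" and \<alpha>: "0 < \<alpha>" "\<bar>\<omega>\<bar> = \<alpha> \<or> \<alpha> < 1"
  shows "functional_bound (p + 3) (nodes L) (\<lambda>z. osc_weight l \<omega> z * exp (\<i> * of_real (\<kappa> * z)))
    (decay_const p * 2 powr (- (real p - 3 / 4) * real l) / \<alpha>\<^sup>2)"
  by (rule functional_bound_osc_aux[OF p \<kappa>]) (use l \<alpha> norm_osc_D_cheb_le'[OF \<alpha> l(1)] in auto)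

lemma functional_bound_eval:
  assumes \<kappa>: "\<bar>\<kappa>\<bar> \<le> 1" and "x \<in> {-1..1}" "finite S" "x \<in> S"
  shows "functional_bound q S (\<lambda>z. (if z = x then 1 else 0) * exp (\<i> * of_real (\<kappa> * z))) 1"
  unfolding functional_bound_def
proof (intro allI impI)
  fix g M assume g: "deriv_tower q g M"
  have "(\<Sum>z\<in>S. (if z = x then 1 else 0) * exp (\<i> * of_real (\<kappa> * z)) * g 0 z) =
      (\<Sum>z\<in>S. if z = x then exp (\<i> * of_real (\<kappa> * x)) * g 0 x else 0)"
    by (intro sum.cong) auto
  also have "\<dots> = exp (\<i> * of_real (\<kappa> * x)) * g 0 x"
    using assms by (simp add: sum.delta)
  finally show "norm (\<Sum>z\<in>S. (if z = x then 1 else 0) * exp (\<i> * of_real (\<kappa> * z)) * g 0 z) \<le> 1 * M"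
    using g assms(2) by (simp add: norm_mult deriv_tower_def)
qed

definition interp_const :: "nat \<Rightarrow> real" where
  "interp_const q = tower_const q * (2 * (\<Sum>m. 1 / (real m + 1) ^ 2))"

text \<open>Interpolation is exact up to degree \<open>n_pts L\<close>, which is at least L, and has
  error at most 2 on the other T_m. Of the q powers of m + 1, two make the series converge and one
  gives 1 / L; the slow rate serves only a limit.\<close>

lemma functional_bound_interp_error:
  assumes q: "3 \<le> q" and \<kappa>: "\<bar>\<kappa>\<bar> \<le> 1" and x: "x \<in> {-1..1}" "x \<in> S" and L: "2 \<le> L"
    and S: "finite S" "nodes L \<subseteq> S" "S \<subseteq> {-1..1}"
  shows "functional_bound q S (\<lambda>z. (Q_weight L z x - (if z = x then 1 else 0)) * exp (\<i> * of_real (\<kappa> * z)))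
    (interp_const q / real L)"
proof -
  define b where "b m = (if m \<le> L then 0 else 2 :: real)" for m
  have le: "b m / (real m + 1) ^ q \<le> 2 / real L * (1 / (real m + 1) ^ 2)" for m
  proof (cases "m \<le> L")
    case False
    have "q = q - 2 + 2"
      using q by simp
    then have "(real m + 1) ^ q = (real m + 1) ^ (q - 2 + 2)"
      by (rule arg_cong)
    then have "(real m + 1) ^ q = (real m + 1) ^ (q - 2) * (real m + 1) ^ 2"
      unfolding power_add .
    moreover have "real L \<le> (real m + 1) ^ (q - 2)"
    proof -
      have "real L \<le> (real m + 1) ^ 1" using False by simp
      also have "\<dots> \<le> (real m + 1) ^ (q - 2)" using q by (intro power_increasing) auto
      finally show ?thesis .
    qed
    ultimately have "real L * (real m + 1) ^ 2 \<le> (real m + 1) ^ q"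
      by (simp add: mult_right_mono)
    then have "2 / (real m + 1) ^ q \<le> 2 / (real L * (real m + 1) ^ 2)"
      using L by (intro divide_left_mono mult_pos_pos) auto
    then show ?thesis using False by (simp add: b_def)
  qed (simp add: b_def)
  have sum': "summable (\<lambda>m. 2 / real L * (1 / (real m + 1) ^ 2))"
    by (intro summable_mult summable_inverse_power_Suc) simp
  have sum: "summable (\<lambda>m. b m / (real m + 1) ^ q)"
    by (rule summable_comparison_test'[OF sum', of 0]) (use le in \<open>auto simp: b_def\<close>)
  have "functional_bound q S (\<lambda>z. (Q_weight L z x - (if z = x then 1 else 0)) * exp (\<i> * of_real (\<kappa> * z)))
    (tower_const q * (\<Sum>m. b m / (real m + 1) ^ q))"
  proof (rule functional_bound_of_cheb[OF _ \<kappa> S(1,3) _ sum])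
    fix m
    have "(\<Sum>z\<in>S. (Q_weight L z x - (if z = x then 1 else 0)) * cheb m z) =
        (\<Sum>z\<in>S. Q_weight L z x * cheb m z) - (\<Sum>z\<in>S. if z = x then cheb m x else 0)"
      unfolding sum_subtractf[symmetric] by (intro sum.cong) (auto simp: left_diff_distrib)
    also have "\<dots> = Q_op L (cheb m) x - cheb m x"
      using x S grid_subset_nodes[of L L] by (subst Q_op_eq_sum[OF S(1)]) (auto simp: sum.delta)
    also have "norm \<dots> \<le> b m"
    proof -
      obtain m' where m': "m \<le> n_pts L \<Longrightarrow> m' = m" "\<And>x. x \<in> {-1..1} \<Longrightarrow> Q_op L (cheb m) x = cheb m' x"
        using Q_op_cheb[OF L, of m] by metis
      have "L \<le> n_pts L"
        using less_exp[of "L - 1"] L unfolding n_pts_def by linarith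
      then show ?thesis
        using m' x norm_triangle_ineq4[of "cheb m' x" "cheb m x"] norm_cheb_le[of m' x] norm_cheb_le[of m x]
        by (auto simp: b_def)
    qed
    finally show "norm (\<Sum>z\<in>S. (Q_weight L z x - (if z = x then 1 else 0)) * cheb m z) \<le> b m" .
  qed (use q in simp)
  then show ?thesis
  proof (rule functional_bound_mono)
    have "(\<Sum>m. b m / (real m + 1) ^ q) \<le> (\<Sum>m. 2 / real L * (1 / (real m + 1) ^ 2))"
      by (rule suminf_le[OF le sum sum'])
    also have "\<dots> = 2 / real L * (\<Sum>m. 1 / (real m + 1) ^ 2)"
      by (rule suminf_mult[OF summable_inverse_power_Suc]) simp
    finally have "tower_const q * (\<Sum>m. b m / (real m + 1) ^ q) \<le> tower_const q * (2 / real L * (\<Sum>m. 1 / (real m + 1) ^ 2))"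
      using tower_const_pos[of q] by (intro mult_left_mono) auto
    then show "tower_const q * (\<Sum>m. b m / (real m + 1) ^ q) \<le> interp_const q / real L"
      by (simp add: interp_const_def)
  qed
qed

section \<open>Tensor products of functionals\<close>

definition override :: "'d set \<Rightarrow> ('d \<Rightarrow> real) \<Rightarrow> real ^ 'd \<Rightarrow> real ^ 'd" where
  "override A z y = (\<chi> i. if i \<in> A then z i else y $ i)"

text \<open>Only the coordinates in A are contracted and the others stay free, which permits
  induction over A although the coordinates carry no order.\<close>

definition tens :: "'d set \<Rightarrow> ('d \<Rightarrow> real set) \<Rightarrow> ('d \<Rightarrow> real \<Rightarrow> complex) \<Rightarrow> (real ^ 'd \<Rightarrow> complex) \<Rightarrow> real ^ 'd \<Rightarrow> complex" where
  "tens A S w f y = (\<Sum>z\<in>Pi\<^sub>E A S. (\<Prod>j\<in>A. w j (z j)) * f (override A z y))"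

lemma tens_empty [simp]: "tens {} S w f y = f y"
  by (simp add: tens_def override_def)

lemma override_upd: "j \<notin> A \<Longrightarrow> override A z (upd y j t) = upd (override A z y) j t"
  by (auto simp: override_def upd_def vec_eq_iff)

lemma tens_insert:
  fixes A :: "('d :: finite) set"
  assumes "j \<notin> A"
  shows "tens (insert j A) S w f y = (\<Sum>t\<in>S j. w j t * tens A S w f (upd y j t))"
proof -
  have "tens (insert j A) S w f y =
      (\<Sum>(t, z)\<in>S j \<times> Pi\<^sub>E A S. (\<Prod>i\<in>insert j A. w i ((z(j := t)) i)) * f (override (insert j A) (z(j := t)) y))"
    unfolding tens_def PiE_insert_eq
    by (subst sum.reindex[OF inj_combinator[OF assms]]) (simp add: case_prod_unfold o_def)
  also have "\<dots> = (\<Sum>(t, z)\<in>S j \<times> Pi\<^sub>E A S. w j t * ((\<Prod>i\<in>A. w i (z i)) * f (override A z (upd y j t))))"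
  proof (intro sum.cong refl, clarify)
    fix t z
    have "(\<Prod>i\<in>insert j A. w i ((z(j := t)) i)) = w j t * (\<Prod>i\<in>A. w i ((z(j := t)) i))"
      using assms by simp
    also have "(\<Prod>i\<in>A. w i ((z(j := t)) i)) = (\<Prod>i\<in>A. w i (z i))"
      using assms by (intro prod.cong) auto
    finally have 1: "(\<Prod>i\<in>insert j A. w i ((z(j := t)) i)) = w j t * (\<Prod>i\<in>A. w i (z i))" .
    have 2: "override (insert j A) (z(j := t)) y = override A z (upd y j t)"
      using assms by (auto simp: override_def upd_def vec_eq_iff)
    show "(\<Prod>i\<in>insert j A. w i ((z(j := t)) i)) * f (override (insert j A) (z(j := t)) y) =
        w j t * ((\<Prod>i\<in>A. w i (z i)) * f (override A z (upd y j t)))"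
      unfolding 1 2 by (simp add: mult.assoc)
  qed
  also have "\<dots> = (\<Sum>t\<in>S j. w j t * tens A S w f (upd y j t))"
    by (simp add: tens_def sum.cartesian_product[symmetric] sum_distrib_left)
  finally show ?thesis .
qed

lemma tens_cong_weight:
  assumes "\<And>j z. j \<in> A \<Longrightarrow> w j z = w' j z"
  shows "tens A S w f y = tens A S w' f y"
  unfolding tens_def by (intro sum.cong arg_cong2[where f = "(*)"] prod.cong) (use assms in auto)

lemma cube_upd: "y \<in> cube \<Longrightarrow> t \<in> {-1..1} \<Longrightarrow> upd y j t \<in> cube"
  by (auto simp: cube_def upd_def)

lemma cube_override: "y \<in> cube \<Longrightarrow> z \<in> Pi\<^sub>E A S \<Longrightarrow> (\<And>j. S j \<subseteq> {-1..1}) \<Longrightarrow> override A z y \<in> cube"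
  by (fastforce simp: cube_def override_def PiE_iff)

lemma upd_same [simp]: "upd (upd y j s) j t = upd y j t"
  by (auto simp: upd_def vec_eq_iff)

lemma upd_nth [simp]: "upd y j t $ j = t"
  by (simp add: upd_def)

lemma continuous_on_upd: "continuous_on T (\<lambda>t. upd y j t)"
  unfolding upd_def
proof (rule continuous_on_vec_lambda)
  show "continuous_on T (\<lambda>t. if i = j then t else y $ i)" for i
    by (cases "i = j") auto
qed

lemma cube_eq_cbox: "cube = cbox (\<chi> i. -1) (\<chi> i. 1)"
  by (auto simp: cube_def mem_box_cart)

lemma compact_cube: "compact (cube :: (real ^ 'd) set)"
  by (simp add: cube_eq_cbox)

lemma cube_nonempty: "0 \<in> cube"
  by (simp add: cube_def)

section \<open>Tensor bounds in the norm of mixed derivatives\<close>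

lemma W_norm_upper:
  fixes f :: "real ^ 'd \<Rightarrow> real"
  assumes f: "f \<in> W_space q" and js: "js \<in> mixed_orders q" and y: "y \<in> cube"
  shows "\<bar>mixed_deriv js f y\<bar> \<le> W_norm q f"
proof -
  have "bdd_above ((\<lambda>y. \<bar>mixed_deriv js f y\<bar>) ` cube)"
    using f js by (intro bounded_imp_bdd_above compact_imp_bounded compact_continuous_image compact_cube
        continuous_intros) (auto simp: W_space_def)
  then have "\<bar>mixed_deriv js f y\<bar> \<le> (SUP y\<in>cube. \<bar>mixed_deriv js f y\<bar>)"
    using y by (intro cSUP_upper)
  also have "\<dots> \<le> W_norm q f"
    unfolding W_norm_def using js finite_mixed_orders by (intro Max_ge) auto
  finally show ?thesis .
qed

lemma W_norm_nonneg: "f \<in> W_space q \<Longrightarrow> 0 \<le> W_norm q f"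
  using W_norm_upper[of f q "[]" 0] Nil_in_mixed_orders cube_nonempty by (meson abs_ge_zero order_trans)

lemma count_list_replicate: "count_list (replicate n x) y = (if x = y then n else 0)"
  by (induction n) auto

text \<open>Coordinates are contracted one at a time while the remaining ones may still be
  differentiated, hence the list js outside A. As a function of the new coordinate j, the
  contraction over A is a tower: its s-th derivative contracts the mixed derivative of f with s more
  copies of j, bounded by the induction hypothesis. The functional in direction j then contributes
  \<open>B j\<close>.\<close>

lemma norm_tens_le_aux:
  fixes f :: "real ^ 'd \<Rightarrow> real" and A :: "'d set"
  assumes f: "f \<in> W_space q" and S: "\<And>j. S j \<subseteq> {-1..1}" "\<And>j. finite (S j)"
    and B: "\<And>j. functional_bound q (S j) (w j) (B j)"
    and js: "js \<in> mixed_orders q" "set js \<inter> A = {}" and y: "y \<in> cube"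
  shows "norm (tens A S w (\<lambda>y. of_real (mixed_deriv js f y)) y) \<le> (\<Prod>j\<in>A. B j) * W_norm q f"
  using finite[of A] js y
proof (induction A arbitrary: js y rule: finite_induct)
  case empty
  then show ?case using W_norm_upper[OF f] by simp
next
  case (insert j A)
  have j: "j \<notin> set js" using insert.prems by auto
  \<comment> \<open>New derivatives are put in front of js, where \<open>mixed_deriv\<close> applies
    them last, so \<open>F (Suc s)\<close> is the j-derivative of \<open>F s\<close>. As j does not
    occur in js, up to q copies stay within \<open>mixed_orders q\<close>.\<close>
  define F where "F s = mixed_deriv (replicate s j @ js) f" for s
  define g where "g s t = tens A S w (\<lambda>y. of_real (F s y)) (upd y j t)" for s t
  have F_Suc: "F (Suc s) = pdiff j (F s)" for s
    by (simp add: F_def mixed_deriv_def)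
  have orders: "replicate s j @ js \<in> mixed_orders q" if "s \<le> q" for s
    using insert.prems(1) j that by (auto simp: mixed_orders_def count_list_replicate)
  have g_eq: "g s t = (\<Sum>z\<in>Pi\<^sub>E A S. (\<Prod>i\<in>A. w i (z i)) * of_real (F s (upd (override A z y) j t)))" for s t
    unfolding g_def tens_def using insert.hyps by (simp add: override_upd)
  have in_cube: "upd (override A z y) j t \<in> cube" if "z \<in> Pi\<^sub>E A S" "t \<in> {-1..1}" for z t
    by (intro cube_upd cube_override[OF _ that(1)] insert.prems S that)
  have "deriv_tower q g ((\<Prod>j\<in>A. B j) * W_norm q f)"
    unfolding deriv_tower_def
  proof (intro conjI allI impI ballI)
    fix s x assume s: "s < q" and x: "x \<in> {-1..1::real}"
    have "((\<lambda>t. F s (upd (override A z y) j t)) has_vector_derivative F (Suc s) (upd (override A z y) j x))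
        (at x within {-1..1})" if z: "z \<in> Pi\<^sub>E A S" for z
    proof -
      have "j # replicate s j @ js \<in> mixed_orders q" using orders[of "Suc s"] s by simp
      then have "pdifferentiable j (F s)"
        using f orders[of s] s unfolding W_space_def F_def by auto
      then have "(\<lambda>t. F s (upd (upd (override A z y) j x) j t)) differentiable (at (upd (override A z y) j x $ j) within {-1..1})"
        using in_cube[OF z x] unfolding pdifferentiable_def by blast
      then show ?thesis
        unfolding F_Suc pdiff_def by (simp add: vector_derivative_works)
    qed
    then show "(g s has_vector_derivative g (Suc s) x) (at x within {-1..1})"
      unfolding g_eq[abs_def]
      by (intro has_vector_derivative_sum has_vector_derivative_mult_right
          bounded_linear.has_vector_derivative[OF bounded_linear_of_real])
  next
    have "continuous_on cube (F q)"
      using f orders[of q] unfolding W_space_def F_def by auto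
    then have "continuous_on {-1..1} (\<lambda>t. F q (upd (override A z y) j t))" if "z \<in> Pi\<^sub>E A S" for z
      by (rule continuous_on_compose2[OF _ continuous_on_upd]) (use in_cube[OF that] in auto)
    then show "continuous_on {-1..1} (g q)"
      unfolding g_eq[abs_def] by (intro continuous_intros)
  next
    fix s x assume s: "s \<le> q" and x: "x \<in> {-1..1::real}"
    show "norm (g s x) \<le> (\<Prod>j\<in>A. B j) * W_norm q f"
      unfolding g_def F_def using insert.prems insert.hyps
      by (intro insert.IH orders s cube_upd x) auto
  qed
  then have "norm (\<Sum>t\<in>S j. w j t * g 0 t) \<le> B j * ((\<Prod>j\<in>A. B j) * W_norm q f)"
    using B[of j] unfolding functional_bound_def by blast
  then show ?case
    using insert.hyps by (simp add: tens_insert g_def F_def mult.assoc)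
qed

lemma norm_tens_le:
  fixes f :: "real ^ 'd \<Rightarrow> real"
  assumes "f \<in> W_space q" "\<And>j. S j \<subseteq> {-1..1}" "\<And>j. finite (S j)" "\<And>j. functional_bound q (S j) (w j) (B j)"
  shows "norm (tens UNIV S w (\<lambda>y. of_real (f y)) 0) \<le> (\<Prod>j\<in>UNIV. B j) * W_norm q f"
  using norm_tens_le_aux[where js = "[]" and y = 0 and A = UNIV, OF assms Nil_in_mixed_orders _ cube_nonempty]
  by (simp add: mixed_deriv_def)

lemma override_UNIV: "override UNIV z y = (\<chi> i. z i)"
  by (simp add: override_def vec_eq_iff)

lemma tens_UNIV: "tens UNIV S w f y = (\<Sum>z\<in>Pi\<^sub>E UNIV S. (\<Prod>j\<in>UNIV. w j (z j)) * f (\<chi> i. z i))"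
  by (simp add: tens_def override_UNIV)

text \<open>Moves a product phase from the function into the weights, so that the tensor bound is
  applied to f itself.\<close>

lemma tens_phase:
  assumes "\<And>y. g y = of_real (f y) * (\<Prod>j\<in>UNIV. e j (y $ j))"
  shows "tens UNIV S w g y = tens UNIV S (\<lambda>j z. w j z * e j z) (\<lambda>y. of_real (f y)) 0"
  unfolding tens_UNIV assms by (simp add: prod.distrib mult_ac)

text \<open>Replacing the weights \<open>b\<close> by \<open>a\<close> one coordinate at a time.\<close>

lemma norm_tens_diff_le:
  fixes f :: "real ^ 'd \<Rightarrow> real"
  assumes f: "f \<in> W_space q" and S: "\<And>j. S j \<subseteq> {-1..1}" "\<And>j. finite (S j)"
    and C: "1 \<le> C" "0 \<le> e"
    and a: "\<And>j. functional_bound q (S j) (a j) C" and b: "\<And>j. functional_bound q (S j) (b j) C"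
    and ab: "\<And>j. functional_bound q (S j) (\<lambda>z. a j z - b j z) e"
  shows "norm (tens UNIV S a (\<lambda>y. of_real (f y)) 0 - tens UNIV S b (\<lambda>y. of_real (f y)) 0)
    \<le> real CARD('d) * (e * C ^ CARD('d)) * W_norm q f"
proof -
  let ?f = "\<lambda>y. complex_of_real (f y)"
  define mix where "mix A = (\<lambda>j. if j \<in> A then a j else b j)" for A
  have step: "norm (tens UNIV S (mix A) ?f 0 - tens UNIV S b ?f 0) \<le> real (card A) * (e * C ^ CARD('d) * W_norm q f)" for A :: "'d set"
    using finite[of A]
  proof (induction A rule: finite_induct)
    case empty
    then show ?case by (simp add: mix_def)
  next
    case (insert i A)
    \<comment> \<open>Consecutive hybrids differ in coordinate i only, so their difference is again
      a tensor, with the small factor there and \<open>C\<close> in the other coordinates.\<close>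
    define w where "w = (\<lambda>j. if j = i then (\<lambda>z. a j z - b j z) else mix A j)"
    have prod: "(\<Prod>j\<in>UNIV. mix (insert i A) j (z j)) - (\<Prod>j\<in>UNIV. mix A j (z j)) = (\<Prod>j\<in>UNIV. w j (z j))" for z
    proof -
      have "(\<Prod>j\<in>UNIV - {i}. mix (insert i A) j (z j)) = (\<Prod>j\<in>UNIV - {i}. mix A j (z j))"
        by (intro prod.cong) (auto simp: mix_def)
      moreover have "(\<Prod>j\<in>UNIV - {i}. w j (z j)) = (\<Prod>j\<in>UNIV - {i}. mix A j (z j))"
        by (intro prod.cong) (auto simp: w_def)
      moreover have split: "(\<Prod>j\<in>UNIV. u j (z j)) = u i (z i) * (\<Prod>j\<in>UNIV - {i}. u j (z j))" for u :: "'d \<Rightarrow> real \<Rightarrow> complex"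
        by (rule prod.remove) auto
      moreover have "mix (insert i A) i (z i) - mix A i (z i) = w i (z i)"
        using insert.hyps by (simp add: mix_def w_def)
      ultimately show ?thesis
        unfolding split[of "mix (insert i A)"] split[of "mix A"] split[of w]
        by (simp only: left_diff_distrib[symmetric])
    qed
    have "tens UNIV S (mix (insert i A)) ?f 0 - tens UNIV S (mix A) ?f 0 = tens UNIV S w ?f 0"
      unfolding tens_UNIV sum_subtractf[symmetric] left_diff_distrib[symmetric] prod ..
    moreover have "norm (tens UNIV S w ?f 0) \<le> (\<Prod>j\<in>UNIV. if j = i then e else C) * W_norm q f"
      by (rule norm_tens_le[OF f S]) (auto simp: w_def mix_def a b ab)
    moreover have "(\<Prod>j\<in>UNIV. if j = i then e else C) \<le> e * C ^ CARD('d)"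
    proof -
      have "(\<Prod>j\<in>UNIV. if j = i then e else C) = e * (\<Prod>j\<in>UNIV - {i}. C)"
        by (subst prod.remove[of _ i]) (auto intro!: prod.cong)
      also have "\<dots> \<le> e * C ^ CARD('d)"
        using C by (intro mult_left_mono) (auto simp: card_Diff_singleton intro!: power_increasing)
      finally show ?thesis .
    qed
    ultimately have "norm (tens UNIV S (mix (insert i A)) ?f 0 - tens UNIV S (mix A) ?f 0) \<le> e * C ^ CARD('d) * W_norm q f"
      using W_norm_nonneg[OF f] by (smt (verit) mult_right_mono)
    then have "norm (tens UNIV S (mix (insert i A)) ?f 0 - tens UNIV S b ?f 0) \<le>
        e * C ^ CARD('d) * W_norm q f + real (card A) * (e * C ^ CARD('d) * W_norm q f)"
      using insert.IH by (smt (verit) norm_diff_triangle_ineq norm_triangle_ineq diff_add_cancel add_diff_eq)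
    then show ?case
      using insert.hyps by (simp add: algebra_simps)
  qed
  have "mix UNIV = a" by (simp add: mix_def)
  then show ?thesis using step[of UNIV] by (simp add: mult.assoc)
qed

text \<open>The node sets may exceed the grids: later they are \<open>nodes L\<close>, possibly with
  an evaluation point added.\<close>

lemma tensor_D_eq_tens:
  fixes g :: "real ^ 'd \<Rightarrow> complex"
  assumes S: "\<And>j. finite (S j)" "\<And>j. grid (l j) \<subseteq> S j" "\<And>j. grid (l j - 1) \<subseteq> S j"
  shows "tensor_D l g y = tens UNIV S (\<lambda>j z. D_weight (l j) z (y $ j)) g y"
proof -
  interpret comp_fun_commute "\<lambda>j :: 'd. in_var j (D_op (l j))"
    by (rule comp_fun_commute_D_op)
  have "Finite_Set.fold (\<lambda>j. in_var j (D_op (l j))) g A y = tens A S (\<lambda>j z. D_weight (l j) z (y $ j)) g y" for A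
    using finite[of A]
  proof (induction A arbitrary: y rule: finite_induct)
    case (insert j A)
    have "Finite_Set.fold (\<lambda>j. in_var j (D_op (l j))) g (insert j A) y =
       D_op (l j) (\<lambda>t. Finite_Set.fold (\<lambda>j. in_var j (D_op (l j))) g A (upd y j t)) (y $ j)"
      using insert.hyps by (simp add: in_var_def)
    also have "\<dots> = (\<Sum>t\<in>S j. D_weight (l j) t (y $ j) *
        tens A S (\<lambda>i z. D_weight (l i) z (upd y j t $ i)) g (upd y j t))"
      unfolding insert.IH by (rule D_op_eq_sum[OF S])
    also have "\<dots> = (\<Sum>t\<in>S j. D_weight (l j) t (y $ j) *
        tens A S (\<lambda>i z. D_weight (l i) z (y $ i)) g (upd y j t))"
      using insert.hyps by (intro sum.cong refl arg_cong2[where f = "(*)"] tens_cong_weight) (auto simp: upd_def)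
    also have "\<dots> = tens (insert j A) S (\<lambda>i z. D_weight (l i) z (y $ i)) g y"
      using insert.hyps by (simp add: tens_insert)
    finally show ?case .
  qed simp
  then show ?thesis unfolding tensor_D_def .
qed

lemma tens_eval:
  fixes g :: "real ^ 'd \<Rightarrow> complex"
  assumes "\<And>j. finite (S j)" "\<And>j. y $ j \<in> S j"
  shows "tens UNIV S (\<lambda>j z. if z = y $ j then 1 else 0) g x = g y"
proof -
  have "(\<Prod>j\<in>UNIV. if z j = y $ j then 1 else 0 :: complex) = (if z = (\<lambda>j. y $ j) then 1 else 0)" for z
    by (auto simp: fun_eq_iff intro!: prod.neutral)
  then have "tens UNIV S (\<lambda>j z. if z = y $ j then 1 else 0) g x =
      (\<Sum>z\<in>Pi\<^sub>E UNIV S. if z = (\<lambda>j. y $ j) then g y else 0)"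
    unfolding tens_UNIV by (intro sum.cong) auto
  also have "\<dots> = g y"
    using assms by (subst sum.delta) (auto intro!: finite_PiE simp: PiE_iff)
  finally show ?thesis .
qed

section \<open>The error of the quadrature rule\<close>

text \<open>\<open>lborel\<close> is the image of a product measure under the sum over basis
  vectors, which reduces both claims to Fubini for finite products.\<close>

lemma lborel_integral_prod:
  fixes f :: "'a::euclidean_space \<Rightarrow> real \<Rightarrow> complex"
  assumes f: "\<And>b. b \<in> Basis \<Longrightarrow> integrable lborel (f b)"
  shows "integrable lborel (\<lambda>x::'a. \<Prod>b\<in>Basis. f b (x \<bullet> b))" (is ?int)
    and "(\<integral>x. (\<Prod>b\<in>Basis. f b ((x::'a) \<bullet> b)) \<partial>lborel) = (\<Prod>b\<in>Basis. \<integral>x. f b x \<partial>lborel)" (is ?eq)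
proof -
  interpret product_sigma_finite "\<lambda>b::'a. lborel :: real measure"
    by standard
  have [measurable]: "b \<in> Basis \<Longrightarrow> f b \<in> borel_measurable borel" for b
    using borel_measurable_integrable[OF f] by simp
  have eq: "(\<Prod>b\<in>Basis. f b ((\<Sum>c\<in>Basis. x c *\<^sub>R c) \<bullet> b)) = (\<Prod>b\<in>Basis. f b (x b))" for x :: "'a \<Rightarrow> real"
    by (intro prod.cong refl) (simp add: inner_sum_left inner_Basis if_distrib sum.delta cong: if_cong)
  have m1: "(\<lambda>x. \<Sum>b\<in>Basis. x b *\<^sub>R b) \<in> measurable (\<Pi>\<^sub>M b\<in>Basis. lborel) (borel :: 'a measure)"
    by measurable
  have m2: "(\<lambda>x::'a. \<Prod>b\<in>Basis. f b (x \<bullet> b)) \<in> borel_measurable borel"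
    by measurable
  show ?int
    unfolding lborel_eq[where 'a = 'a] integrable_distr_eq[OF m1 m2] eq
    by (rule product_integrable_prod) (use f in auto)
  show ?eq
    unfolding lborel_eq[where 'a = 'a] integral_distr[OF m1 m2] eq
    by (rule product_integral_prod) (use f in auto)
qed

text \<open>Cutting each factor off by the indicator of [-1,1] turns the integral over the cube into
  one over the whole space, where the factorization applies.\<close>

lemma has_integral_cube_prod:
  fixes \<phi> :: "'d :: finite \<Rightarrow> real \<Rightarrow> complex"
  assumes cont: "\<And>j. continuous_on {-1..1} (\<phi> j)"
  shows "((\<lambda>y :: real ^ 'd. \<Prod>j\<in>UNIV. \<phi> j (y $ j)) has_integral (\<Prod>j\<in>UNIV. integral {-1..1} (\<phi> j))) cube"
proof -
  define \<psi> where "\<psi> j x = indicator {-1..1} x *\<^sub>R \<phi> j x" for j x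
  have int1: "set_integrable lborel {-1..1} (\<phi> j)" for j
    by (rule borel_integrable_atLeastAtMost') (rule cont)
  then have int: "integrable lborel (\<psi> j)" for j
    unfolding set_integrable_def \<psi>_def .
  have val: "(\<integral>x. \<psi> j x \<partial>lborel) = integral {-1..1} (\<phi> j)" for j
    using set_borel_integral_eq_integral(2)[OF int1[of j]] unfolding set_lebesgue_integral_def \<psi>_def .
  \<comment> \<open>The factors are indexed by coordinates, the product integral by basis vectors;
    \<open>F\<close> translates through \<open>axis\<close>.\<close>
  define F where "F b = \<psi> (THE j. b = axis j 1)" for b :: "real ^ 'd"
  have F: "F (axis j 1) = \<psi> j" for j
  proof -
    have "(THE i. axis j (1::real) = axis i 1) = j"
      by (rule the_equality) (auto simp: axis_eq_axis)
    then show ?thesis by (simp add: F_def)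
  qed
  have Basis: "(Basis :: (real ^ 'd) set) = (\<lambda>j. axis j 1) ` UNIV"
    by (auto simp: Basis_vec_def)
  have inj: "inj (\<lambda>j::'d. axis j (1::real))"
    by (auto simp: inj_on_def axis_eq_axis)
  have prod: "(\<Prod>b\<in>Basis. h b) = (\<Prod>j\<in>UNIV. h (axis j 1))" for h :: "real ^ 'd \<Rightarrow> complex"
    unfolding Basis by (subst prod.reindex[OF inj]) (simp add: o_def)
  have intF: "b \<in> Basis \<Longrightarrow> integrable lborel (F b)" for b
    by (auto simp: Basis F int)
  have I: "integrable lborel (\<lambda>y :: real ^ 'd. \<Prod>j\<in>UNIV. \<psi> j (y $ j))"
    "(\<integral>y. (\<Prod>j\<in>UNIV. \<psi> j ((y :: real ^ 'd) $ j)) \<partial>lborel) = (\<Prod>j\<in>UNIV. integral {-1..1} (\<phi> j))"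
    using lborel_integral_prod[of F, OF intF]
    by (simp_all add: prod F inner_axis val)
  have ind: "(\<Prod>j\<in>UNIV. \<psi> j (y $ j)) = indicator cube y *\<^sub>R (\<Prod>j\<in>UNIV. \<phi> j (y $ j))" for y :: "real ^ 'd"
  proof (cases "y \<in> cube")
    case True
    then show ?thesis by (simp add: \<psi>_def cube_def)
  next
    case False
    then obtain j where "\<not> (-1 \<le> y $ j \<and> y $ j \<le> 1)" by (auto simp: cube_def)
    then have "\<psi> j (y $ j) = 0" by (auto simp: \<psi>_def)
    then have "(\<Prod>j\<in>UNIV. \<psi> j (y $ j)) = 0" by (subst prod_zero_iff) auto
    then show ?thesis using False by simp
  qed
  have S: "set_integrable lborel cube (\<lambda>y :: real ^ 'd. \<Prod>j\<in>UNIV. \<phi> j (y $ j))"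
    using I(1) unfolding set_integrable_def ind .
  have "(\<lambda>y :: real ^ 'd. \<Prod>j\<in>UNIV. \<phi> j (y $ j)) integrable_on cube"
    "integral cube (\<lambda>y :: real ^ 'd. \<Prod>j\<in>UNIV. \<phi> j (y $ j)) = (\<Prod>j\<in>UNIV. integral {-1..1} (\<phi> j))"
    using set_borel_integral_eq_integral[OF S] I(2) unfolding set_lebesgue_integral_def ind by simp_all
  then show ?thesis using integrable_integral by metis
qed

lemma exp_phase:
  fixes v y :: "real ^ 'd"
  shows "exp (\<i> * complex_of_real (k * (v \<bullet> y))) = (\<Prod>j\<in>UNIV. exp (\<i> * of_real (k * v $ j * y $ j)))"
proof -
  have "\<i> * complex_of_real (k * (v \<bullet> y)) = (\<Sum>j\<in>UNIV. \<i> * of_real (k * v $ j * y $ j))"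
    by (simp add: inner_vec_def sum_distrib_left mult_ac)
  then show ?thesis by (simp only: exp_sum[OF finite])
qed

lemma f_hat_eq: "f_hat k a f y = of_real (f y) * (\<Prod>j\<in>UNIV. exp (\<i> * of_real (k * a_hat k a $ j * y $ j)))"
  unfolding f_hat_def exp_phase ..

lemma osc_integral_eq:
  "osc_integral k a f = integral cube (\<lambda>y. f_hat k a f y * exp (\<i> * complex_of_real (k * (a_tilde k a \<bullet> y))))"
proof -
  have "exp (\<i> * complex_of_real (k * (a \<bullet> y))) =
      exp (\<i> * complex_of_real (k * (a_hat k a \<bullet> y))) * exp (\<i> * complex_of_real (k * (a_tilde k a \<bullet> y)))" for y
  proof -
    have "a \<bullet> y = a_hat k a \<bullet> y + a_tilde k a \<bullet> y"
      unfolding a_hat_def inner_add_left[symmetric] by simp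
    then show ?thesis by (simp add: exp_add[symmetric] algebra_simps)
  qed
  then show ?thesis unfolding osc_integral_def f_hat_def by (simp add: mult.assoc)
qed

text \<open>Each coordinate of the phase is either entirely fast or entirely slow. These are the
  conditions on \<kappa>, \<alpha> and \<omega> in the functional bounds.\<close>

lemma phase_split:
  assumes "0 < k" "a $ j \<noteq> 0"
  shows "\<bar>k * a_hat k a $ j\<bar> \<le> 1" "0 < k * \<bar>a $ j\<bar>"
    "\<bar>k * a_tilde k a $ j\<bar> = k * \<bar>a $ j\<bar> \<or> k * \<bar>a $ j\<bar> < 1"
  using assms by (auto simp: a_hat_def a_tilde_def abs_mult)

text \<open>Weights and fast phase are products over the coordinates, so for each node the integral
  over the cube factorizes into one-dimensional \<open>osc_weight\<close> terms.\<close>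

lemma has_integral_tensor_D:
  fixes g :: "real ^ 'd \<Rightarrow> complex"
  assumes l: "\<And>j. l j \<le> L"
  shows "((\<lambda>y. tensor_D l g y * exp (\<i> * complex_of_real (k * (v \<bullet> y)))) has_integral
    tens UNIV (\<lambda>_. nodes L) (\<lambda>j z. osc_weight (l j) (k * v $ j) z) g 0) cube"
proof -
  have D: "tensor_D l g y = tens UNIV (\<lambda>_. nodes L) (\<lambda>j z. D_weight (l j) z (y $ j)) g y" for y
    using l by (intro tensor_D_eq_tens finite_nodes grid_subset_nodes) (auto intro: le_trans[OF diff_le_self])
  have eq: "tensor_D l g y * exp (\<i> * complex_of_real (k * (v \<bullet> y))) =
     (\<Sum>z\<in>Pi\<^sub>E UNIV (\<lambda>_. nodes L). (\<Prod>j\<in>UNIV. D_weight (l j) (z j) (y $ j) * exp (\<i> * of_real (k * v $ j * y $ j))) * g (\<chi> i. z i))" for y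
    unfolding D tens_UNIV exp_phase sum_distrib_right prod.distrib by (simp only: mult_ac)
  show ?thesis
    unfolding eq tens_UNIV osc_weight_def
    by (intro has_integral_sum has_integral_mult_left has_integral_cube_prod continuous_intros
        continuous_on_D_weight finite_PiE finite finite_nodes)
qed

lemma functional_bound_add:
  assumes "functional_bound q S v A" "functional_bound q S w B"
  shows "functional_bound q S (\<lambda>z. v z + w z) (A + B)"
  unfolding functional_bound_def
proof (intro allI impI)
  fix g M assume "deriv_tower q g M"
  then have "norm (\<Sum>z\<in>S. v z * g 0 z) \<le> A * M" "norm (\<Sum>z\<in>S. w z * g 0 z) \<le> B * M"
    using assms unfolding functional_bound_def by blast+
  then show "norm (\<Sum>z\<in>S. (v z + w z) * g 0 z) \<le> (A + B) * M"
    unfolding distrib_right sum.distrib by (rule norm_triangle_le[OF add_mono])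
qed

text \<open>Over a full box the sum of products is a product of sums, and each one-dimensional sum
  telescopes.\<close>

lemma sum_tensor_D:
  fixes g :: "real ^ 'd \<Rightarrow> complex"
  assumes S: "\<And>j. finite (S j)" "\<And>j. nodes L \<subseteq> S j"
  shows "(\<Sum>l\<in>Pi\<^sub>E UNIV (\<lambda>_. {1..L}). tensor_D l g y) = tens UNIV S (\<lambda>j z. Q_weight L z (y $ j)) g y"
proof -
  have "(\<Sum>l\<in>Pi\<^sub>E UNIV (\<lambda>_. {1..L}). tensor_D l g y) =
      (\<Sum>l\<in>Pi\<^sub>E UNIV (\<lambda>_. {1..L}). tens UNIV S (\<lambda>j z. D_weight (l j) z (y $ j)) g y)"
  proof (intro sum.cong refl tensor_D_eq_tens S(1))
    fix l :: "'d \<Rightarrow> nat" and j assume "l \<in> Pi\<^sub>E UNIV (\<lambda>_. {1..L})"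
    then have "l j \<le> L" by (auto simp: PiE_iff)
    then have "l j \<le> L" "l j - 1 \<le> L" by auto
    then show "grid (l j) \<subseteq> S j" "grid (l j - 1) \<subseteq> S j"
      by - (rule order_trans[OF grid_subset_nodes S(2)], assumption)+
  qed
  also have "\<dots> = (\<Sum>z\<in>Pi\<^sub>E UNIV S. (\<Sum>l\<in>Pi\<^sub>E UNIV (\<lambda>_. {1..L}). \<Prod>j\<in>UNIV. D_weight (l j) (z j) (y $ j)) * g (\<chi> i. z i))"
    unfolding tens_UNIV by (subst sum.swap) (simp only: sum_distrib_right)
  also have "\<dots> = (\<Sum>z\<in>Pi\<^sub>E UNIV S. (\<Prod>j\<in>UNIV. \<Sum>n=1..L. D_weight n (z j) (y $ j)) * g (\<chi> i. z i))"
    by (subst prod_sum_PiE) auto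
  also have "\<dots> = tens UNIV S (\<lambda>j z. Q_weight L z (y $ j)) g y"
    unfolding sum_D_weight tens_UNIV ..
  finally show ?thesis .
qed

lemma interp_const_nonneg: "0 \<le> interp_const q"
  unfolding interp_const_def using tower_const_pos[of q]
  by (intro mult_nonneg_nonneg suminf_nonneg summable_inverse_power_Suc) auto

text \<open>Interpolation and evaluation at y are two tensors of functionals that differ by O(1/L)
  in each coordinate, so one can be exchanged for the other coordinate by coordinate.\<close>

lemma norm_interp_error_le:
  fixes f :: "real ^ 'd \<Rightarrow> real"
  assumes f: "f \<in> W_space q" and q: "3 \<le> q" and \<kappa>: "\<And>j. \<bar>\<kappa> j\<bar> \<le> 1" and L: "2 \<le> L" and y: "y \<in> cube"
    and g: "\<And>y. g y = of_real (f y) * (\<Prod>j\<in>UNIV. exp (\<i> * of_real (\<kappa> j * y $ j)))"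
  shows "norm ((\<Sum>l\<in>Pi\<^sub>E UNIV (\<lambda>_. {1..L}). tensor_D l g y) - g y) \<le>
    real CARD('d) * (interp_const q / real L * (1 + interp_const q) ^ CARD('d)) * W_norm q f"
proof -
  \<comment> \<open>The evaluation point joins the nodes so that both tensors live on the same
    finite sets.\<close>
  define S where "S j = insert (y $ j) (nodes L)" for j
  let ?e = "\<lambda>j z. exp (\<i> * complex_of_real (\<kappa> j * z))"
  have S: "finite (S j)" "nodes L \<subseteq> S j" "S j \<subseteq> {-1..1}" "y $ j \<in> S j" "y $ j \<in> {-1..1}" for j
    using y finite_nodes nodes_subset by (auto simp: S_def cube_def)
  have diff: "functional_bound q (S j) (\<lambda>z. (Q_weight L z (y $ j) - (if z = y $ j then 1 else 0)) * ?e j z) (interp_const q / real L)" for j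
    by (rule functional_bound_interp_error[OF q \<kappa> S(5,4) L S(1,2,3)])
  have one: "functional_bound q (S j) (\<lambda>z. (if z = y $ j then 1 else 0) * ?e j z) 1" for j
    by (rule functional_bound_eval[OF \<kappa> S(5,1,4)])
  have div: "interp_const q / real L \<le> interp_const q"
    using interp_const_nonneg[of q] L by (simp add: divide_le_eq mult_le_cancel_left1)
  have "functional_bound q (S j) (\<lambda>z. (if z = y $ j then 1 else 0) * ?e j z +
      (Q_weight L z (y $ j) - (if z = y $ j then 1 else 0)) * ?e j z) (1 + interp_const q / real L)" for j
    by (rule functional_bound_add[OF one diff])
  then have Q: "functional_bound q (S j) (\<lambda>z. Q_weight L z (y $ j) * ?e j z) (1 + interp_const q / real L)" for j
    by (simp add: algebra_simps)
  have "(\<Sum>l\<in>Pi\<^sub>E UNIV (\<lambda>_. {1..L}). tensor_D l g y) = tens UNIV S (\<lambda>j z. Q_weight L z (y $ j) * ?e j z) (\<lambda>y. of_real (f y)) 0"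
    unfolding sum_tensor_D[where S = S, OF S(1,2)] by (rule tens_phase[where e = ?e, OF g])
  moreover have "g y = tens UNIV S (\<lambda>j z. (if z = y $ j then 1 else 0) * ?e j z) (\<lambda>y. of_real (f y)) 0"
    unfolding tens_eval[where S = S, OF S(1,4), of g 0, symmetric] by (rule tens_phase[where e = ?e, OF g])
  moreover have "norm (tens UNIV S (\<lambda>j z. Q_weight L z (y $ j) * ?e j z) (\<lambda>y. of_real (f y)) 0 -
      tens UNIV S (\<lambda>j z. (if z = y $ j then 1 else 0) * ?e j z) (\<lambda>y. of_real (f y)) 0) \<le>
      real CARD('d) * (interp_const q / real L * (1 + interp_const q) ^ CARD('d)) * W_norm q f"
  proof (rule norm_tens_diff_le[OF f S(3,1)])
    show "functional_bound q (S j) (\<lambda>z. Q_weight L z (y $ j) * ?e j z) (1 + interp_const q)" for j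
      by (rule functional_bound_mono[OF Q]) (use div in simp)
    show "functional_bound q (S j) (\<lambda>z. (if z = y $ j then 1 else 0) * ?e j z) (1 + interp_const q)" for j
      by (rule functional_bound_mono[OF one]) (use interp_const_nonneg in simp)
    show "functional_bound q (S j) (\<lambda>z. Q_weight L z (y $ j) * ?e j z - (if z = y $ j then 1 else 0) * ?e j z) (interp_const q / real L)" for j
      using diff[of j] by (simp only: left_diff_distrib)
  qed (use interp_const_nonneg[of q] in auto)
  ultimately show ?thesis by simp
qed

text \<open>Coordinate i admits the quadratic estimate and contributes an extra factor
  \<open>1 / \<alpha> i\<close>. It is bounded by the sum over all coordinates, because i varies
  with l and the final bound must not.\<close>

lemma norm_osc_tens_le:
  fixes f :: "real ^ 'd \<Rightarrow> real"
  assumes f: "f \<in> W_space (p + 3)" and p: "1 \<le> p" and \<kappa>: "\<And>j. \<bar>\<kappa> j\<bar> \<le> 1"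
    and \<alpha>: "\<And>j. 0 < \<alpha> j" "\<And>j. \<bar>\<omega> j\<bar> = \<alpha> j \<or> \<alpha> j < 1"
    and l: "\<And>j. 1 \<le> l j" "\<And>j. l j \<le> L" "3 \<le> l i"
    and g: "\<And>y. g y = of_real (f y) * (\<Prod>j\<in>UNIV. exp (\<i> * of_real (\<kappa> j * y $ j)))"
  shows "norm (tens UNIV (\<lambda>_. nodes L) (\<lambda>j z. osc_weight (l j) (\<omega> j) z) g 0) \<le>
    decay_const p ^ CARD('d) * 2 powr (- (real p - 3 / 4) * real (\<Sum>j\<in>UNIV. l j)) *
      ((\<Prod>j\<in>UNIV. 1 / \<alpha> j) * (\<Sum>j\<in>UNIV. 1 / \<alpha> j)) * W_norm (p + 3) f"
proof -
  let ?s = "- (real p - 3 / 4)"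
  define B where "B j = decay_const p * 2 powr (?s * real (l j)) * (1 / \<alpha> j) * (if j = i then 1 / \<alpha> i else 1)" for j
  have b: "functional_bound (p + 3) (nodes L) (\<lambda>z. osc_weight (l j) (\<omega> j) z * exp (\<i> * of_real (\<kappa> j * z))) (B j)" for j
  proof (cases "j = i")
    case True
    then show ?thesis
      using functional_bound_osc'[OF p \<kappa>[of i] l(3) l(2) \<alpha>(1)[of i] \<alpha>(2)[of i]]
      by (simp add: B_def power2_eq_square)
  next
    case False
    then show ?thesis
      using functional_bound_osc[OF p \<kappa>[of j] l(1) l(2) \<alpha>(1)[of j] \<alpha>(2)[of j]]
      by (simp add: B_def)
  qed
  have "norm (tens UNIV (\<lambda>_. nodes L) (\<lambda>j z. osc_weight (l j) (\<omega> j) z) g 0) \<le> (\<Prod>j\<in>UNIV. B j) * W_norm (p + 3) f"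
    unfolding tens_phase[where e = "\<lambda>j z. exp (\<i> * complex_of_real (\<kappa> j * z))", OF g]
    by (rule norm_tens_le[OF f nodes_subset finite_nodes b])
  also have "(\<Prod>j\<in>UNIV. B j) = decay_const p ^ CARD('d) * 2 powr (?s * real (\<Sum>j\<in>UNIV. l j)) * ((\<Prod>j\<in>UNIV. 1 / \<alpha> j) * (1 / \<alpha> i))"
  proof -
    have "(\<Prod>j\<in>UNIV. 2 powr (?s * real (l j))) = 2 powr (?s * real (\<Sum>j\<in>UNIV. l j))"
      by (simp add: sum_distrib_left powr_sum)
    moreover have "(\<Prod>j\<in>UNIV. if j = i then 1 / \<alpha> i else 1) = 1 / \<alpha> i"
      by (simp add: prod.delta)
    ultimately show ?thesis
      unfolding B_def by (simp only: prod.distrib prod_constant mult.assoc)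
  qed
  also have "\<dots> * W_norm (p + 3) f \<le> decay_const p ^ CARD('d) * 2 powr (?s * real (\<Sum>j\<in>UNIV. l j)) *
      ((\<Prod>j\<in>UNIV. 1 / \<alpha> j) * (\<Sum>j\<in>UNIV. 1 / \<alpha> j)) * W_norm (p + 3) f"
  proof (intro mult_right_mono mult_left_mono W_norm_nonneg[OF f])
    show "1 / \<alpha> i \<le> (\<Sum>j\<in>UNIV. 1 / \<alpha> j)"
      using \<alpha>(1) by (intro member_le_sum) (auto intro: less_imp_le)
    show "0 \<le> (\<Prod>j\<in>UNIV. 1 / \<alpha> j)"
      using \<alpha>(1) by (intro prod_nonneg) (auto intro: less_imp_le)
  qed (use decay_const_nonneg in simp)
  finally show ?thesis .
qed

definition geom_const :: real where
  "geom_const = (\<Sum>n. (2 powr (- 1 / 8)) ^ n)"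

lemma summable_geom: "summable (\<lambda>n. (2 powr (- 1 / 8) :: real) ^ n)"
proof -
  have "(2 powr (- 1 / 8) :: real) < 2 powr 0"
    by (subst powr_less_cancel_iff) auto
  then show ?thesis by (intro summable_geometric) simp
qed

text \<open>A part 1/8 of the exponent is set aside: over the box it gives a product of geometric
  sums, bounded independently of L. The rest is controlled by the total level, which is at least r
  for the omitted vectors.\<close>

lemma sum_decay_le:
  fixes r L :: nat
  assumes s: "0 \<le> s"
  shows "(\<Sum>l\<in>Pi\<^sub>E UNIV (\<lambda>_ :: 'd :: finite. {1..L}) - levels r. 2 powr (- (s + 1 / 8) * real (\<Sum>j\<in>UNIV. l j)))
    \<le> geom_const ^ CARD('d) * 2 powr (- s * real r)"
proof -
  let ?x = "2 powr (- 1 / 8) :: real"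
  let ?Z = "Pi\<^sub>E UNIV (\<lambda>_ :: 'd. {1..L})"
  have fin: "finite ?Z" by (intro finite_PiE) auto
  have "(\<Sum>l\<in>?Z - levels r. 2 powr (- (s + 1 / 8) * real (\<Sum>j\<in>UNIV. l j))) \<le>
      (\<Sum>l\<in>?Z - levels r. 2 powr (- s * real r) * (\<Prod>j\<in>UNIV. ?x ^ l j))"
  proof (rule sum_mono)
    fix l assume l: "l \<in> ?Z - levels r"
    define n where "n = (\<Sum>j\<in>UNIV. l j)"
    have "1 \<le> l j" for j using l by (auto simp: PiE_iff)
    with l have "r \<le> n" unfolding levels_def n_def by auto
    have "2 powr (- (s + 1 / 8) * real n) = 2 powr (- s * real n) * 2 powr (- 1 / 8 * real n)"
      by (simp add: powr_add[symmetric] algebra_simps)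
    also have "2 powr (- 1 / 8 * real n) = ?x ^ n"
      by (simp only: powr_powr[symmetric]) (simp add: powr_realpow)
    also have "?x ^ n = (\<Prod>j\<in>UNIV. ?x ^ l j)"
      by (simp add: n_def power_sum)
    also have "2 powr (- s * real n) * (\<Prod>j\<in>UNIV. ?x ^ l j) \<le> 2 powr (- s * real r) * (\<Prod>j\<in>UNIV. ?x ^ l j)"
      using \<open>r \<le> n\<close> s by (intro mult_right_mono powr_mono prod_nonneg) (auto simp: mult_left_mono)
    finally show "2 powr (- (s + 1 / 8) * real (\<Sum>j\<in>UNIV. l j)) \<le> 2 powr (- s * real r) * (\<Prod>j\<in>UNIV. ?x ^ l j)"
      by (simp add: n_def)
  qed
  also have "\<dots> \<le> (\<Sum>l\<in>?Z. 2 powr (- s * real r) * (\<Prod>j\<in>UNIV. ?x ^ l j))"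
    by (rule sum_mono2[OF fin]) (auto intro!: mult_nonneg_nonneg prod_nonneg)
  also have "\<dots> = 2 powr (- s * real r) * (\<Prod>j\<in>(UNIV :: 'd set). \<Sum>n=1..L. ?x ^ n)"
    by (subst prod_sum_PiE) (auto simp: sum_distrib_left)
  also have "\<dots> \<le> 2 powr (- s * real r) * (\<Prod>j\<in>(UNIV :: 'd set). geom_const)"
  proof (intro mult_left_mono prod_mono conjI)
    show "(\<Sum>n=1..L. ?x ^ n) \<le> geom_const"
      unfolding geom_const_def by (rule sum_le_suminf[OF summable_geom]) auto
  qed (auto intro: sum_nonneg)
  finally show ?thesis by (simp add: mult.commute)
qed

lemma levels_subset:
  fixes r L :: nat
  assumes "r + CARD('d) \<le> L"
  shows "levels r \<subseteq> Pi\<^sub>E UNIV (\<lambda>_ :: 'd :: finite. {1..L})"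
proof
  fix l :: "'d \<Rightarrow> nat" assume l: "l \<in> levels r"
  have "l j \<le> L" for j
  proof -
    have "l j \<le> (\<Sum>j\<in>UNIV. l j)" by (rule member_le_sum) auto
    with l assms show ?thesis unfolding levels_def mem_Collect_eq by linarith
  qed
  then show "l \<in> Pi\<^sub>E UNIV (\<lambda>_. {1..L})" using l by (auto simp: levels_def PiE_iff)
qed

lemma quadrature_error_le:
  fixes f :: "real ^ 'd \<Rightarrow> real"
  assumes f: "f \<in> W_space (p + 3)" and p: "1 \<le> p" and a: "\<And>j. a $ j \<noteq> 0" and k: "0 < k" and r: "CARD('d) < r"
  shows "norm (osc_integral k a f - fccs k a r f) \<le>
    decay_const p ^ CARD('d) * geom_const ^ CARD('d) * 2 powr (- (real p - 7 / 8) * real r) *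
    ((\<Prod>j\<in>UNIV. 1 / (k * \<bar>a $ j\<bar>)) * (\<Sum>j\<in>UNIV. 1 / (k * \<bar>a $ j\<bar>))) * W_norm (p + 3) f"
    (is "_ \<le> ?bound")
proof -
  let ?E = "\<lambda>y. exp (\<i> * complex_of_real (k * (a_tilde k a \<bullet> y)))"
  let ?g = "f_hat k a f"
  let ?box = "\<lambda>L. Pi\<^sub>E UNIV (\<lambda>_ :: 'd. {1..L})"
  let ?\<alpha> = "\<lambda>j. k * \<bar>a $ j\<bar>"
  let ?P = "(\<Prod>j\<in>UNIV. 1 / ?\<alpha> j) * (\<Sum>j\<in>UNIV. 1 / ?\<alpha> j)"
  let ?W = "W_norm (p + 3) f"
  define T where "T L l = tens UNIV (\<lambda>_. nodes L) (\<lambda>j z. osc_weight (l j) (k * a_tilde k a $ j) z) ?g 0" for L l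
  \<comment> \<open>\<open>K\<close> does not involve L, so the interpolation error K / L disappears
    in the limit while \<open>?bound\<close> stays.\<close>
  define K where "K = real CARD('d) * (interp_const (p + 3) * (1 + interp_const (p + 3)) ^ CARD('d)) * ?W *
      measure lborel (cbox (\<chi> i. -1) (\<chi> i. 1) :: (real ^ 'd) set)"
  have T: "((\<lambda>y. tensor_D l ?g y * ?E y) has_integral T L l) cube" if "l \<in> ?box L" for l L
    unfolding T_def by (rule has_integral_tensor_D) (use that in \<open>auto simp: PiE_iff\<close>)
  have contf: "continuous_on cube f"
    using f Nil_in_mixed_orders[of "p + 3"] unfolding W_space_def by (auto simp: mixed_deriv_def dest!: bspec[of _ _ "[]"])
  have I: "((\<lambda>y. ?g y * ?E y) has_integral osc_integral k a f) cube"
    unfolding osc_integral_eq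
  proof (rule integrable_integral)
    have "continuous_on cube (\<lambda>y. ?g y * ?E y)"
      unfolding f_hat_def by (intro continuous_intros contf)
    then show "(\<lambda>y. ?g y * ?E y) integrable_on cube"
      unfolding cube_eq_cbox by (rule integrable_continuous)
  qed
  have main: "norm (osc_integral k a f - fccs k a r f) \<le> K / real L + ?bound" if L: "r + CARD('d) \<le> L" for L
  proof -
    have "0 < CARD('d)" by simp
    then have L2: "2 \<le> L" using L r by linarith
    have fin: "finite (?box L)" by (intro finite_PiE) auto
    have sub: "levels r \<subseteq> ?box L" by (rule levels_subset[OF L])
    have "((\<lambda>y. \<Sum>l\<in>levels r. tensor_D l ?g y * ?E y) has_integral (\<Sum>l\<in>levels r. T L l)) cube"
      by (intro has_integral_sum finite_levels T) (use sub in auto)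
    then have fccs: "fccs k a r f = (\<Sum>l\<in>levels r. T L l)"
      unfolding fccs_def smolyak_def sum_distrib_right by (rule integral_unique)
    have "((\<lambda>y. (\<Sum>l\<in>?box L. tensor_D l ?g y * ?E y) - ?g y * ?E y) has_integral (\<Sum>l\<in>?box L. T L l) - osc_integral k a f) cube"
      by (intro has_integral_diff has_integral_sum fin T I)
    then have D: "((\<lambda>y. ((\<Sum>l\<in>?box L. tensor_D l ?g y) - ?g y) * ?E y) has_integral (\<Sum>l\<in>?box L. T L l) - osc_integral k a f)
        (cbox (\<chi> i. -1) (\<chi> i. 1))"
      unfolding cube_eq_cbox sum_distrib_right left_diff_distrib .
    let ?e = "real CARD('d) * (interp_const (p + 3) / real L * (1 + interp_const (p + 3)) ^ CARD('d)) * ?W"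
    have "norm ((\<Sum>l\<in>?box L. T L l) - osc_integral k a f) \<le> ?e * measure lborel (cbox (\<chi> i. -1) (\<chi> i. 1) :: (real ^ 'd) set)"
    proof (rule has_integral_bound[OF _ D])
      show "0 \<le> ?e" using interp_const_nonneg[of "p + 3"] W_norm_nonneg[OF f] by simp
      fix y :: "real ^ 'd" assume "y \<in> cbox (\<chi> i. -1) (\<chi> i. 1)"
      then have y: "y \<in> cube" by (simp only: cube_eq_cbox)
      have "norm ((\<Sum>l\<in>?box L. tensor_D l ?g y) - ?g y) \<le> ?e"
        by (rule norm_interp_error_le[where \<kappa> = "\<lambda>j. k * a_hat k a $ j" and g = ?g, OF f _ phase_split(1)[OF k a] L2 y])
          (simp, rule f_hat_eq)
      then show "norm (((\<Sum>l\<in>?box L. tensor_D l ?g y) - ?g y) * ?E y) \<le> ?e"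
        by (simp add: norm_mult)
    qed
    also have "\<dots> = K / real L" by (simp add: K_def)
    finally have 1: "norm ((\<Sum>l\<in>?box L. T L l) - osc_integral k a f) \<le> K / real L" .
    have "norm (\<Sum>l\<in>?box L - levels r. T L l) \<le> (\<Sum>l\<in>?box L - levels r.
        decay_const p ^ CARD('d) * 2 powr (- (real p - 3 / 4) * real (\<Sum>j\<in>UNIV. l j)) * ?P * ?W)"
    proof (rule sum_norm_le)
      fix l assume l: "l \<in> ?box L - levels r"
      have l1: "1 \<le> l j" "l j \<le> L" for j using l by (auto simp: PiE_iff)
      \<comment> \<open>If all levels were at most 2, their sum would be at most 2 d <= r + d - 1
        because r > d, and l would not have been omitted.\<close>
      obtain i where i: "3 \<le> l i"
      proof (rule ccontr)
        assume "\<not> thesis"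
        then have "l j \<le> 2" for j using that[of j] by (cases "3 \<le> l j") auto
        then have "(\<Sum>j\<in>UNIV. l j) \<le> (\<Sum>j\<in>(UNIV :: 'd set). 2)" by (intro sum_mono)
        then have "l \<in> levels r" using l1 r unfolding levels_def by simp
        then show False using l by simp
      qed
      show "norm (T L l) \<le> decay_const p ^ CARD('d) * 2 powr (- (real p - 3 / 4) * real (\<Sum>j\<in>UNIV. l j)) * ?P * ?W"
        unfolding T_def
        by (rule norm_osc_tens_le[where \<kappa> = "\<lambda>j. k * a_hat k a $ j" and \<alpha> = ?\<alpha> and \<omega> = "\<lambda>j. k * a_tilde k a $ j"
            and l = l and i = i and g = ?g, OF f p phase_split(1)[OF k a] phase_split(2)[OF k a] phase_split(3)[OF k a] l1 i])
          (rule f_hat_eq)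
    qed
    also have "\<dots> = decay_const p ^ CARD('d) * ?P * ?W *
        (\<Sum>l\<in>?box L - levels r. 2 powr (- (real p - 7 / 8 + 1 / 8) * real (\<Sum>j\<in>UNIV. l j)))"
    proof -
      have "(\<Sum>l\<in>X. x * h l * y * z) = x * y * z * (\<Sum>l\<in>X. h l)" for x y z :: real and h and X :: "('d \<Rightarrow> nat) set"
        by (simp add: sum_distrib_left mult_ac)
      moreover have "real p - 7 / 8 + 1 / 8 = real p - 3 / 4" by simp
      ultimately show ?thesis by (simp only:)
    qed
    also have "\<dots> \<le> decay_const p ^ CARD('d) * ?P * ?W * (geom_const ^ CARD('d) * 2 powr (- (real p - 7 / 8) * real r))"
    proof (intro mult_left_mono sum_decay_le)
      have "0 \<le> ?P"
        using phase_split(2)[OF k a] by (intro mult_nonneg_nonneg prod_nonneg sum_nonneg) (auto intro: less_imp_le)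
      then show "0 \<le> decay_const p ^ CARD('d) * ?P * ?W"
        using decay_const_nonneg[of p] W_norm_nonneg[OF f] by simp
    qed (use p in simp)
    also have "\<dots> = ?bound" by (simp only: mult_ac)
    finally have 2: "norm (\<Sum>l\<in>?box L - levels r. T L l) \<le> ?bound" .
    have "(\<Sum>l\<in>?box L. T L l) = (\<Sum>l\<in>?box L - levels r. T L l) + (\<Sum>l\<in>levels r. T L l)"
      by (rule sum.subset_diff[OF sub fin])
    then have "osc_integral k a f - fccs k a r f =
        (\<Sum>l\<in>?box L - levels r. T L l) - ((\<Sum>l\<in>?box L. T L l) - osc_integral k a f)"
      by (simp add: fccs)
    also have "norm \<dots> \<le> ?bound + K / real L"
      by (rule order_trans[OF norm_triangle_ineq4 add_mono[OF 2 1]])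
    finally show ?thesis by (simp only: add.commute)
  qed
  have "(\<lambda>L. K / real L + ?bound) \<longlonglongrightarrow> 0 + ?bound"
    by (intro tendsto_add tendsto_const lim_const_over_n)
  then have "norm (osc_integral k a f - fccs k a r f) \<le> 0 + ?bound"
    by (rule LIMSEQ_le_const) (use main in blast)
  then show ?thesis by simp
qed

section \<open>The number of points\<close>

lemma card_grid_le: "1 \<le> l \<Longrightarrow> card (grid l) \<le> 2 ^ l"
proof (cases "2 \<le> l")
  case True
  have "2 ^ (l - 1) + 1 \<le> (2::nat) * 2 ^ (l - 1)" by simp
  also have "\<dots> = 2 ^ l" using True by (simp add: power_Suc[symmetric] del: power_Suc)
  finally show ?thesis using card_grid[OF True] by (simp add: n_pts_def)
next
  case False
  assume "1 \<le> l"
  with False show ?thesis by (simp add: grid_def)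
qed

text \<open>The number of level vectors times a bound for one tensor grid, which has at most 2 to
  the total level many points; overlaps between the grids are ignored.\<close>

lemma num_pts_le: "num_pts TYPE('d::finite) r \<le> (r + CARD('d)) ^ CARD('d) * 2 ^ (r + CARD('d))"
proof -
  have card_box: "card {y :: real ^ 'd. \<forall>j. y $ j \<in> grid (l j)} \<le> 2 ^ (r + CARD('d))"
    if l: "l \<in> levels r" for l
  proof -
    let ?P = "Pi\<^sub>E UNIV (\<lambda>j. grid (l j))"
    have fin: "finite ?P" by (intro finite_PiE) (auto simp: finite_grid)
    have "{y :: real ^ 'd. \<forall>j. y $ j \<in> grid (l j)} \<subseteq> (\<lambda>z. \<chi> j. z j) ` ?P"
    proof
      fix y :: "real ^ 'd" assume "y \<in> {y. \<forall>j. y $ j \<in> grid (l j)}"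
      then show "y \<in> (\<lambda>z. \<chi> j. z j) ` ?P"
        by (intro image_eqI[of _ _ "\<lambda>j. y $ j"]) (auto simp: PiE_iff)
    qed
    then have "card {y :: real ^ 'd. \<forall>j. y $ j \<in> grid (l j)} \<le> card ?P"
      using fin by (meson card_image_le card_mono finite_imageI order_trans)
    also have "card ?P = (\<Prod>j\<in>UNIV. card (grid (l j)))"
      by (rule card_PiE) simp
    also have "\<dots> \<le> (\<Prod>j\<in>UNIV. 2 ^ l j)"
      by (intro prod_mono conjI card_grid_le) (use l in \<open>auto simp: levels_def\<close>)
    also have "\<dots> = 2 ^ (\<Sum>j\<in>UNIV. l j)" by (simp add: power_sum)
    also have "\<dots> \<le> 2 ^ (r + CARD('d))"
      using l by (intro power_increasing) (auto simp: levels_def)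
    finally show ?thesis .
  qed
  have card_levels: "card (levels r :: ('d \<Rightarrow> nat) set) \<le> (r + CARD('d)) ^ CARD('d)"
  proof -
    have "card (levels r :: ('d \<Rightarrow> nat) set) \<le> card (Pi\<^sub>E (UNIV :: 'd set) (\<lambda>_. {1..r + CARD('d)}))"
      by (intro card_mono levels_subset finite_PiE) auto
    then show ?thesis by (simp add: card_PiE)
  qed
  have "num_pts TYPE('d) r \<le> (\<Sum>l\<in>levels r. card {y :: real ^ 'd. \<forall>j. y $ j \<in> grid (l j)})"
    unfolding num_pts_def sparse_grid_def by (rule card_UN_le[OF finite_levels])
  also have "\<dots> \<le> card (levels r :: ('d \<Rightarrow> nat) set) * 2 ^ (r + CARD('d))"
    using sum_bounded_above[OF card_box] by simp
  also have "\<dots> \<le> (r + CARD('d)) ^ CARD('d) * 2 ^ (r + CARD('d))"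
    using card_levels by (rule mult_right_mono) simp
  finally show ?thesis .
qed

text \<open>Three points make N exceed e and hence ln N at least 1 in the final estimate. They lie
  on one coordinate axis, with level 2 there and level 1 elsewhere.\<close>

lemma num_pts_ge:
  assumes "2 \<le> r"
  shows "3 \<le> num_pts TYPE('d::finite) r"
proof -
  obtain i :: 'd where True by simp
  define l where "l j = (if j = i then 2 else 1 :: nat)" for j
  have "(\<Sum>j\<in>UNIV. l j) = l i + (\<Sum>j\<in>UNIV - {i}. l j)" by (rule sum.remove) auto
  also have "(\<Sum>j\<in>UNIV - {i}. l j) = (\<Sum>j\<in>UNIV - {i}. 1)" by (intro sum.cong) (auto simp: l_def)
  also have "l i + \<dots> = CARD('d) + 1" by (simp add: l_def card_Diff_singleton)
  finally have l: "l \<in> levels r" using assms by (auto simp: levels_def l_def)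
  have "inj_on (\<lambda>x :: real. axis i x :: real ^ 'd) (grid 2)" by (auto simp: inj_on_def axis_eq_axis)
  then have "card ((\<lambda>x. axis i x :: real ^ 'd) ` grid 2) = 3"
    using card_grid[of 2] by (simp add: card_image n_pts_def)
  moreover have "(\<lambda>x. axis i x :: real ^ 'd) ` grid 2 \<subseteq> sparse_grid r"
  proof clarify
    fix x assume x: "x \<in> grid 2"
    have "(axis i x :: real ^ 'd) $ j \<in> grid (l j)" for j
    proof (cases "j = i")
      case True
      then show ?thesis using x by (simp add: l_def axis_def)
    next
      case False
      then show ?thesis by (simp add: l_def axis_def grid_def)
    qed
    then show "(axis i x :: real ^ 'd) \<in> sparse_grid r"
      unfolding sparse_grid_def using l by blast
  qed
  ultimately show ?thesis
    unfolding num_pts_def using card_mono[OF finite_sparse_grid] by metis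
qed

text \<open>All terms of the exponential series but the m-th are dropped.\<close>

lemma power_le_fact_exp:
  assumes "0 \<le> (x :: real)"
  shows "x ^ m \<le> fact m * exp x"
proof -
  have "(\<Sum>n\<in>{m}. x ^ n /\<^sub>R fact n) \<le> (\<Sum>n. x ^ n /\<^sub>R fact n)"
    by (rule sum_le_suminf[OF summable_exp_generic]) (use assms in auto)
  also have "\<dots> = exp x" using exp_converges[of x] by (simp add: sums_iff)
  finally show ?thesis by (simp add: field_simps)
qed

text \<open>The decay of the error beats \<open>N\<^sup>1\<^sup>-\<^sup>p\<close> by a factor \<open>2\<close> to the power \<open>- r / 8\<close>, which absorbs every
  power of \<open>r\<close>; hence a crude bound for the number of points suffices.\<close>

lemma num_pts_decay:
  assumes p: "1 \<le> p"
  shows "\<exists>K>0. \<forall>r. 2 powr (- (real p - 7 / 8) * real r) * real (num_pts TYPE('d::finite) r) ^ (p - 1) \<le> K"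
proof -
  let ?d = "CARD('d)"
  \<comment> \<open>Raising the point bound to the power p - 1 yields the m-th power of r + d and,
    from 2 ^ (r + d), the constant 2 ^ m.\<close>
  define m where "m = ?d * (p - 1)"
  \<comment> \<open>With this c, the surplus 2 powr (- r / 8) equals exp (- c r), and the powers of
    r + d are compared with exp (c (r + d)).\<close>
  define c where "c = ln 2 / (8 :: real)"
  have c: "0 < c" by (simp add: c_def)
  define K where "K = 2 ^ m * exp (c * real ?d) * (fact m / c ^ m)"
  have "2 powr (- (real p - 7 / 8) * real r) * real (num_pts TYPE('d) r) ^ (p - 1) \<le> K" for r
  proof -
    have "real (num_pts TYPE('d) r) ^ (p - 1) \<le> real ((r + ?d) ^ ?d * 2 ^ (r + ?d)) ^ (p - 1)"
      using num_pts_le[where 'd = 'd, of r] by (intro power_mono of_nat_mono) auto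
    also have "\<dots> = real (r + ?d) ^ m * (2 ^ m * 2 ^ (r * (p - 1)))"
      by (simp add: m_def power_mult_distrib power_mult[symmetric] power_add[symmetric] algebra_simps)
    also have "(2::real) ^ (r * (p - 1)) = 2 powr ((real p - 1) * real r)"
      using p by (simp add: powr_realpow[symmetric] of_nat_diff mult.commute)
    finally have "2 powr (- (real p - 7 / 8) * real r) * real (num_pts TYPE('d) r) ^ (p - 1) \<le>
        2 powr (- (real p - 7 / 8) * real r) * (real (r + ?d) ^ m * (2 ^ m * 2 powr ((real p - 1) * real r)))"
      by (rule mult_left_mono) simp
    also have "\<dots> = 2 ^ m * (real (r + ?d) ^ m * (2 powr (- (real p - 7 / 8) * real r) * 2 powr ((real p - 1) * real r)))"
      by (simp only: mult_ac)
    also have "2 powr (- (real p - 7 / 8) * real r) * 2 powr ((real p - 1) * real r) = exp (- (c * real r))"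
    proof -
      have "2 powr (- (real p - 7 / 8) * real r) * 2 powr ((real p - 1) * real r) = 2 powr (- (real r / 8))"
        unfolding powr_add[symmetric] by (rule arg_cong[where f = "\<lambda>x. 2 powr x"]) (simp add: algebra_simps)
      then show ?thesis by (simp add: powr_def c_def mult_ac)
    qed
    also have "real (r + ?d) ^ m = (c * real (r + ?d)) ^ m / c ^ m"
      using c by (simp add: power_mult_distrib)
    also have "2 ^ m * ((c * real (r + ?d)) ^ m / c ^ m * exp (- (c * real r))) \<le>
        2 ^ m * (fact m * exp (c * real (r + ?d)) / c ^ m * exp (- (c * real r)))"
      using c by (intro mult_left_mono mult_right_mono divide_right_mono power_le_fact_exp) auto
    also have "\<dots> = 2 ^ m * (exp (c * real (r + ?d)) * exp (- (c * real r))) * (fact m / c ^ m)"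
      by simp
    also have "exp (c * real (r + ?d)) * exp (- (c * real r)) = exp (c * real ?d)"
      by (simp add: exp_add[symmetric] algebra_simps)
    finally show ?thesis unfolding K_def .
  qed
  moreover have "0 < K" using c by (simp add: K_def)
  ultimately show ?thesis by blast
qed

theorem theorem1p3:
  fixes p :: nat and a :: "real ^ 'd"
  assumes "p \<ge> 1" and "\<And>j. a $ j \<noteq> 0"
  shows "\<exists>C > 0. \<exists>r0 \<ge> 1. \<forall>r \<ge> r0. \<forall>k > 0. \<forall>f \<in> W_space (p + 3).
    cmod (osc_integral k a f - fccs k a r f) \<le>
      C * k powi (- (int CARD('d) + 1)) *
      (ln (real (num_pts TYPE('d) r)) ^ (CARD('d) - 1)) ^ p *
      (1 / real (num_pts TYPE('d) r)) ^ (p - 1) * W_norm (p + 3) f"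
proof -
  obtain K where K: "K > 0" "\<And>r. 2 powr (- (real p - 7 / 8) * real r) * real (num_pts TYPE('d) r) ^ (p - 1) \<le> K"
    using num_pts_decay[OF assms(1), where 'd = 'd] by blast
  let ?A = "(\<Prod>j\<in>UNIV. 1 / \<bar>a $ j\<bar>) * (\<Sum>j\<in>UNIV. 1 / \<bar>a $ j\<bar>)"
  let ?c = "decay_const p ^ CARD('d) * geom_const ^ CARD('d)"
  \<comment> \<open>The summand 1 keeps C positive, since \<open>decay_const\<close> is only known
    to be nonnegative.\<close>
  define C where "C = ?c * ?A * K + 1"
  have c0: "0 \<le> ?c"
    unfolding geom_const_def
    by (intro mult_nonneg_nonneg zero_le_power decay_const_nonneg suminf_nonneg summable_geom) auto
  have A0: "0 \<le> ?A"
    by (intro mult_nonneg_nonneg prod_nonneg sum_nonneg) auto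
  have C: "0 < C" using c0 A0 K(1) by (auto simp: C_def intro!: add_nonneg_pos)
  show ?thesis
  \<comment> \<open>The threshold is the condition r > d of the quadrature estimate; it also gives r
    >= 2 for the lower bound on the number of points.\<close>
  proof (intro exI[of _ C] exI[of _ "CARD('d) + 1"] conjI allI impI ballI C)
    fix r k :: real and f :: "real ^ 'd \<Rightarrow> real"
    show "1 \<le> CARD('d) + 1" by simp
  next
    fix r :: nat and k :: real and f :: "real ^ 'd \<Rightarrow> real"
    assume r: "CARD('d) + 1 \<le> r" and k: "0 < k" and f: "f \<in> W_space (p + 3)"
    let ?N = "real (num_pts TYPE('d) r)" and ?W = "W_norm (p + 3) f"
    let ?k = "k powi (- (int CARD('d) + 1))"
    have W: "0 \<le> ?W" by (rule W_norm_nonneg[OF f])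
    have "0 < CARD('d)" by simp
    then have "3 \<le> num_pts TYPE('d) r" using r by (intro num_pts_ge) linarith
    then have N: "3 \<le> ?N" by simp
    have "ln (exp 1) \<le> ln ?N" using N exp_le by (subst ln_le_cancel_iff) auto
    then have lnN: "1 \<le> (ln ?N ^ (CARD('d) - 1)) ^ p" by (intro one_le_power) simp
    \<comment> \<open>The product contributes k to the power -d and the sum one more 1 / k.\<close>
    have kpow: "(\<Prod>j\<in>UNIV. 1 / (k * \<bar>a $ j\<bar>)) * (\<Sum>j\<in>UNIV. 1 / (k * \<bar>a $ j\<bar>)) = ?k * ?A"
    proof -
      have "?k = 1 / k ^ Suc CARD('d)"
      proof -
        have "- (int CARD('d) + 1) = - int (Suc CARD('d))" by simp
        then show ?thesis by (simp only: power_int_minus power_int_of_nat inverse_eq_divide)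
      qed
      moreover have "1 / (k * x) = (1 / k) * (1 / x)" for x
        by simp
      moreover have "(1 / k) ^ n * x * (1 / k * y) = 1 / k ^ Suc n * (x * y)" for n and x y :: real
        by (simp add: power_one_over)
      ultimately show ?thesis
        by (simp only: prod.distrib prod_constant sum_distrib_left[symmetric])
    qed
    have decay: "2 powr (- (real p - 7 / 8) * real r) \<le> K * (1 / ?N) ^ (p - 1)"
      using K(2)[of r] N by (simp add: power_one_over field_simps)
    have "cmod (osc_integral k a f - fccs k a r f) \<le> ?c * 2 powr (- (real p - 7 / 8) * real r) * (?k * ?A) * ?W"
      using quadrature_error_le[OF f assms(1) assms(2) k, of r] r unfolding kpow by simp
    also have "\<dots> \<le> ?c * (K * (1 / ?N) ^ (p - 1)) * (?k * ?A) * ?W"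
      using c0 A0 W k decay by (intro mult_right_mono mult_left_mono) auto
    also have "\<dots> = (?c * ?A * K) * ?k * 1 * (1 / ?N) ^ (p - 1) * ?W"
      by (simp only: mult_ac mult_1_right)
    also have "\<dots> \<le> C * ?k * (ln ?N ^ (CARD('d) - 1)) ^ p * (1 / ?N) ^ (p - 1) * ?W"
      using c0 A0 K(1) k lnN W N C
      by (intro mult_mono mult_right_mono) (auto simp: C_def)
    finally show "cmod (osc_integral k a f - fccs k a r f) \<le>
      C * ?k * (ln ?N ^ (CARD('d) - 1)) ^ p * (1 / ?N) ^ (p - 1) * ?W" .
  qed
qed

end
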